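(* Let $n\ge 3$, put $N=\operatorname{lcm}(n,2)$, and let $\varLambda\subset\mathbb C$ be a strong $n$-cyclotomic Delone set. (a) There are sets $U$ of four pairwise nonparallel $\varLambda$-directions such that the convex subsets of $\varLambda$ are determined by the X-rays in the directions of $U$. In addition, no set of fewer than four pairwise nonparallel $\varLambda$-directions has this property. (b) There is a finite number $m_n\in\mathbb N$, depending only on $n$ (and not on $\varLambda$), such that the convex subsets of $\varLambda$ are determined by the X-rays in the directions of any set of $m_n$ pairwise nonparallel $\varLambda$-directions. Moreover, for $n=4$ one may take $m_4=7$, and for every $n\ne 4$ with $3\le n\le 50$ or $n=61$ one may take $m_n=N+1$; in each of these cases the value is best possible, i.e. it is the least natural number $m$ such that the convex subsets of $\varLambda$ are determined by the X-rays in the directions of any set of $m$ pairwise nonparallel $\varLambda$-directions.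
   Context: The Euclidean plane is identified with $\mathbb C$, and $\zeta_n=e^{2\pi i/n}$. A Delone set is a subset of $\mathbb C$ that is uniformly discrete and relatively dense. For a Delone set $\varLambda\subset\mathbb C$, $K_\varLambda$ denotes the smallest subfield of $\mathbb C$ containing $\mathbb Q$, the difference set $\varLambda-\varLambda$ and its image under complex conjugation. A homothety of $\mathbb C$ is a map $z\mapsto\lambda z+t$ with $\lambda\in\mathbb R$, $\lambda>0$, $t\in\mathbb C$. For $n\ge 3$, a Delone set $\varLambda\subset\mathbb C$ is called a strong $n$-cyclotomic Delone set if (i) $K_\varLambda=\mathbb Q(\zeta_n)$, and (ii) for every finite subset $F$ of $K_\varLambda$ there is a homothety of $\mathbb C$ that maps the elements of $F$ into $\varLambda$. A direction is an element of the unit circle $\mathbb S^1\subset\mathbb C$; a $\varLambda$-direction is a direction parallel to a nonzero element of $\varLambda-\varLambda$. A convex subset of $\varLambda$ is a bounded (hence finite) set $C\subset\varLambda$ with $C=\operatorname{conv}(C)\cap\varLambda$. For a finite set $F\subset\mathbb C$ and a direction $u$, the (discrete parallel) X-ray $X_uF$ of $F$ in direction $u$ is the function which assigns to each line $\ell$ in direction $u$ the number $\operatorname{card}(F\cap\ell)$. The convex subsets of $\varLambda$ are determined by the X-rays in the directions of a finite set $U\subset\mathbb S^1$ if any two different convex subsets $C\neq C'$ of $\varLambda$ satisfy $X_uC\ne X_uC'$ for at least one $u\in U$. *)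

theory Defs
  imports "HOL-Analysis.Analysis" "HOL-Algebra.Algebraic_Closure_Type"
begin

definition relatively_dense :: "complex set \<Rightarrow> bool" where
  "relatively_dense \<Lambda> \<longleftrightarrow> (\<exists>R>0. \<forall>x. cball x R \<inter> \<Lambda> \<noteq> {})"

definition delone_set :: "complex set \<Rightarrow> bool" where
  "delone_set \<Lambda> \<longleftrightarrow> uniform_discrete \<Lambda> \<and> relatively_dense \<Lambda>"

(* ring_of_type_algebra is the field of complex numbers as an object with carrier UNIV. *)
definition smallest_subfield :: "complex set \<Rightarrow> complex set" where
  "smallest_subfield S = (\<lambda>K. subfield K (ring_of_type_algebra :: complex ring)) hull S"

definition difference_set :: "complex set \<Rightarrow> complex set" where
  "difference_set \<Lambda> = {x - y | x y. x \<in> \<Lambda> \<and> y \<in> \<Lambda>}"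

definition delone_field :: "complex set \<Rightarrow> complex set" where
  "delone_field \<Lambda> =
     smallest_subfield (\<rat> \<union> difference_set \<Lambda> \<union> cnj ` difference_set \<Lambda>)"

definition cyclotomic_field :: "nat \<Rightarrow> complex set" where
  "cyclotomic_field n = smallest_subfield (\<rat> \<union> {exp (2 * of_real pi * \<i> / of_nat n)})"

definition homothety :: "(complex \<Rightarrow> complex) \<Rightarrow> bool" where
  "homothety h \<longleftrightarrow> (\<exists>(c::real) t. c > 0 \<and> h = (\<lambda>z. of_real c * z + t))"

definition strong_cyclotomic_delone_set :: "nat \<Rightarrow> complex set \<Rightarrow> bool" where
  "strong_cyclotomic_delone_set n \<Lambda> \<longleftrightarrow>
     delone_set \<Lambda> \<and>
     delone_field \<Lambda> = cyclotomic_field n \<and>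
     (\<forall>F. finite F \<and> F \<subseteq> delone_field \<Lambda> \<longrightarrow> (\<exists>h. homothety h \<and> h ` F \<subseteq> \<Lambda>))"

definition parallel :: "complex \<Rightarrow> complex \<Rightarrow> bool" where
  "parallel u v \<longleftrightarrow> (\<exists>c::real. c \<noteq> 0 \<and> u = of_real c * v)"

definition directions_of :: "complex set \<Rightarrow> complex set" where
  "directions_of \<Lambda> = {u \<in> sphere 0 1. \<exists>v \<in> difference_set \<Lambda> - {0}. parallel u v}"

definition nonparallel_directions :: "complex set \<Rightarrow> complex set \<Rightarrow> bool" where
  "nonparallel_directions \<Lambda> U \<longleftrightarrow>
     finite U \<and> U \<subseteq> directions_of \<Lambda> \<and> pairwise (\<lambda>u v. \<not> parallel u v) U"

definition convex_subset :: "complex set \<Rightarrow> complex set \<Rightarrow> bool" where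
  "convex_subset \<Lambda> C \<longleftrightarrow> C \<subseteq> \<Lambda> \<and> bounded C \<and> C = convex hull C \<inter> \<Lambda>"

definition lines_in_direction :: "complex \<Rightarrow> complex set set" where
  "lines_in_direction u = range (\<lambda>z. range (\<lambda>t::real. z + of_real t * u))"

definition X_ray :: "complex \<Rightarrow> complex set \<Rightarrow> (complex set \<Rightarrow> nat)" where
  "X_ray u F = (\<lambda>l \<in> lines_in_direction u. card (F \<inter> l))"

definition determined_by :: "complex set \<Rightarrow> complex set \<Rightarrow> bool" where
  "determined_by \<Lambda> U \<longleftrightarrow>
     (\<forall>C C'. convex_subset \<Lambda> C \<and> convex_subset \<Lambda> C' \<and> C \<noteq> C' \<longrightarrow>
        (\<exists>u\<in>U. X_ray u C \<noteq> X_ray u C'))"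

definition determined_by_any :: "complex set \<Rightarrow> nat \<Rightarrow> bool" where
  "determined_by_any \<Lambda> m \<longleftrightarrow>
     (\<forall>U. nonparallel_directions \<Lambda> U \<and> card U = m \<longrightarrow> determined_by \<Lambda> U)"

definition least_determining_number :: "complex set \<Rightarrow> nat \<Rightarrow> bool" where
  "least_determining_number \<Lambda> m \<longleftrightarrow>
     determined_by_any \<Lambda> m \<and> (\<forall>k. determined_by_any \<Lambda> k \<longrightarrow> m \<le> k)"

end

theory Submission
  imports Defs "HOL-Number_Theory.Cong"
begin

hide_const (open) Polynomials.degree up_ring.monom up_ring.coeff module.smult Divisibility.prime

text \<open>
  Suppose two different convex subsets have the same X-rays in the directions of \<open>U\<close>. Seen from the common centroid
  of their two differences \<open>A\<close> and \<open>B\<close>, the points of \<open>A \<union> B\<close> form \<open>M\<close> angular blocks, alternately from \<open>A\<close> and \<open>B\<close>,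
  and the lines in a direction \<open>u\<close> pair these blocks by a reflection \<open>i \<mapsto> S\<^sub>u - i\<close> of \<open>\<int>/M\<close>. Hence the first Fourier
  mode of the block sums, a linear map of the plane that is injective by a Sturm argument, carries \<open>U\<close> to directions
  whose cross ratios are those of the roots of unity \<open>\<zeta>\<^sub>M\<close> to the power \<open>S\<^sub>u\<close>.

  For \<open>\<Lambda>\<close>-directions these cross ratios lie in the \<open>n\<close>-th cyclotomic field. Applying the automorphisms that fix this field,
  every prime (power) in the order of the roots of unity that does not divide \<open>lcm(n,2)\<close> can be removed as soon as there
  are seven of them, so that \<open>card U \<le> max (lcm(n,2)) 6\<close>; this works for every \<open>n\<close>. The cross ratio \<open>5\<close> never occurs, because
  differences of roots of unity have small \<open>5\<close>-adic valuation; this gives four directions that suffice.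

  The lower bounds come from a generic orbit of the dihedral group of order \<open>2N\<close>, whose \<open>N\<close> reflections swap its two
  cyclic halves: \<open>N = lcm(n,2)\<close>, or a linear image of the case \<open>N = 6\<close>, which also covers any three directions.
\<close>

subsection \<open>Irreducibility of the cyclotomic polynomials\<close>

text \<open>The obstacle is that the number \<open>M\<close> of blocks is out of control: it depends
  on the two convex subsets, and one block may hold many points spread over many lines. The roots of
  unity therefore have unbounded order, and the arithmetic must treat all orders at once, lowering
  the order prime by prime. Cross ratios are the right invariant because they survive both a real
  rescaling of each direction and an injective linear map of the plane; an image direction
  \<open>F u\<close> becomes a root of unity as \<open>F u / cnj (F u)\<close>. Seven is the first
  size at which a nonconstant class map to the \<open>p\<close>-th roots of unity can be refuted for
  every prime \<open>p\<close>. Size six really occurs, for instance when \<open>n = 4\<close>,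
  where the hexagonal pattern beats the bound \<open>lcm n 2 = 4\<close>. The prime 5 is the least
  \<open>p\<close> with \<open>2 / (p - 1) < 1\<close>, so that a product of two nonzero differences
  of roots of unity is never divisible by \<open>p\<close>. Field automorphisms are not constructed
  as maps: an integer polynomial vanishing at a root of unity is shown to vanish at its conjugates
  as well.\<close>

definition ieval :: "int poly \<Rightarrow> complex \<Rightarrow> complex" where
  "ieval p z = poly (map_poly of_int p) z"

lemma ieval_0 [simp]: "ieval 0 z = 0"
  by (simp add: ieval_def)

lemma ieval_pCons [simp]: "ieval (pCons a p) z = of_int a + z * ieval p z"
  by (simp add: ieval_def map_poly_pCons)

lemma ieval_1 [simp]: "ieval 1 z = 1"
  by (simp add: ieval_def)

lemma ieval_add [simp]: "ieval (p + q) z = ieval p z + ieval q z"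
proof (induction p arbitrary: q)
  case (pCons a p)
  then show ?case by (cases q) (simp add: algebra_simps)
qed simp

lemma ieval_smult [simp]: "ieval (smult c p) z = of_int c * ieval p z"
  by (induction p) (simp_all add: algebra_simps)

lemma ieval_minus [simp]: "ieval (- p) z = - ieval p z"
  using ieval_smult[of "-1" p z] by simp

lemma ieval_diff [simp]: "ieval (p - q) z = ieval p z - ieval q z"
  using ieval_add[of p "- q" z] by simp

lemma ieval_mult [simp]: "ieval (p * q) z = ieval p z * ieval q z"
  by (induction p) (simp_all add: algebra_simps)

lemma ieval_power [simp]: "ieval (p ^ k) z = ieval p z ^ k"
  by (induction k) simp_all

lemma ieval_monom [simp]: "ieval (monom c k) z = of_int c * z ^ k"
  by (induction k) (simp_all add: monom_Suc monom_0)

lemma ieval_of_nat [simp]: "ieval (of_nat k) z = of_nat k"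
  by (induction k) simp_all

lemma ieval_pcompose [simp]: "ieval (pcompose p q) z = ieval p (ieval q z)"
  by (induction p) (simp_all add: pcompose_pCons)

lemma cnj_ieval: "cnj (ieval p z) = ieval p (cnj z)"
  by (induction p) simp_all

section \<open>Integer polynomials of least degree with a given root\<close>

text \<open>Unique factorisation of integer polynomials: units have no roots, so one of the prime
  factors has to vanish at \<open>z\<close>.\<close>

lemma root_factor:
  assumes "f \<noteq> 0" "ieval f z = 0"
  obtains g where "prime_elem g" "g dvd f" "ieval g z = 0"
proof -
  have "\<exists>g. prime_elem g \<and> g dvd f \<and> ieval g z = 0" using assms
  proof (induction f rule: prime_divisors_induct)
    case (unit f)
    then obtain g where "1 = f * g" by (auto elim: dvdE)
    hence "ieval f z * ieval g z = 1"
      by (metis ieval_mult ieval_1)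
    thus ?case using unit by simp
  next
    case (factor p f)
    then consider "ieval p z = 0" | "ieval f z = 0" by auto
    thus ?case
    proof cases
      case 1
      thus ?thesis using factor by (intro exI[of _ p]) auto
    next
      case 2
      with factor obtain g where "prime_elem g" "g dvd f" "ieval g z = 0" by auto
      thus ?thesis by (intro exI[of _ g]) auto
    qed
  qed simp
  thus ?thesis using that by blast
qed

text \<open>This takes the place of Gauss's lemma. By pseudo-division, a nonzero \<open>b\<close> of
  least degree divides a constant multiple of \<open>g\<close>. If \<open>g\<close> had larger
  degree, the prime \<open>g\<close> would divide the cofactor, and cancelling \<open>g\<close>
  would leave \<open>b\<close> constant.\<close>

lemma prime_elem_minimal_degree:
  assumes "prime_elem g" "ieval g z = 0" "h \<noteq> 0" "ieval h z = 0"
  shows "degree g \<le> degree h"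
proof -
  define b where "b = arg_min degree (\<lambda>h. h \<noteq> 0 \<and> ieval h z = 0)"
  have b: "b \<noteq> 0 \<and> ieval b z = 0" and bmin: "\<And>h. h \<noteq> 0 \<and> ieval h z = 0 \<Longrightarrow> degree b \<le> degree h"
    unfolding b_def using arg_min_nat_lemma[of "\<lambda>h. h \<noteq> 0 \<and> ieval h z = 0" h degree] assms by auto
  have "degree g \<le> degree b"
  proof (rule ccontr)
    assume less: "\<not> degree g \<le> degree b"
    define r where "r = pseudo_mod g b"
    obtain a k where ak: "a \<noteq> 0" "smult a g = b * k + r"
      using pseudo_mod(1)[of b g] b r_def by auto
    have "ieval r z = 0"
      using arg_cong[OF ak(2), of "\<lambda>p. ieval p z"] assms b by simp
    hence "r = 0" using pseudo_mod(2)[of b g] bmin[of r] b by (force simp: r_def)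
    with ak have eq: "smult a g = b * k" by simp
    hence "g dvd b * k" by (metis dvd_refl dvd_smult)
    moreover have "\<not> g dvd b" using less b by (meson dvd_imp_degree_le)
    ultimately have "g dvd k" using assms(1) by (simp add: prime_elem_dvd_mult_iff)
    then obtain k' where k': "k = g * k'" by (auto elim: dvdE)
    have "g \<noteq> 0" using assms(1) by auto
    have "g * [:a:] = g * (b * k')" using eq k' by (simp add: ac_simps)
    hence "[:a:] = b * k'" using \<open>g \<noteq> 0\<close> by (metis mult_left_cancel)
    hence "degree b = 0" using ak(1)
      by (metis b degree_mult_eq degree_pCons_0 add_is_0 mult_eq_0_iff pCons_eq_0_iff)
    then obtain c where "b = [:c:]" by (metis degree_eq_zeroE)
    with b show False by simp
  qed
  thus ?thesis using bmin[of h] assms by auto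
qed

section \<open>Roots of unity and an integral basis\<close>

definition root_unity :: "nat \<Rightarrow> complex" where
  "root_unity n = cis (2 * pi / n)"

lemma root_unity_power: "root_unity n ^ k = cis (2 * pi * k / n)"
  by (simp add: root_unity_def Complex.DeMoivre ac_simps)

lemma root_unity_power_self [simp]: "n > 0 \<Longrightarrow> root_unity n ^ n = 1"
  by (simp add: root_unity_power)

lemma root_unity_nonzero [simp]: "root_unity n \<noteq> 0"
  by (simp add: root_unity_def)

lemma norm_root_unity [simp]: "norm (root_unity n) = 1"
  by (simp add: root_unity_def)

lemma root_unity_power_mod: "n > 0 \<Longrightarrow> root_unity n ^ (k mod n) = root_unity n ^ k"
  by (metis div_mult_mod_eq mult.commute mult_1 power_add power_mult power_one root_unity_power_self)

lemma root_unity_div: "m > 0 \<Longrightarrow> d > 0 \<Longrightarrow> root_unity (m * d) ^ m = root_unity d"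
  by (simp add: root_unity_power) (simp add: root_unity_def)

lemma root_unity_powers:
  assumes "n > 0" "z ^ n = 1"
  obtains e where "e < n" "z = root_unity n ^ e"
proof -
  have "z \<in> {z. z ^ n = 1}" using assms by simp
  also have "{z. z ^ n = 1} = (\<lambda>k. cis (2 * pi * real k / real n)) ` {..<n}"
    using Complex.bij_betw_roots_unity[OF assms(1)] by (simp add: bij_betw_def)
  finally show ?thesis using that by (auto simp: root_unity_power)
qed

text \<open>The powers below \<open>d\<close> of the root of unity form an integral basis,
  \<open>d\<close> being the degree of a prime factor \<open>g\<close> of \<open>X^n - 1\<close>. As
  that polynomial is monic, \<open>g\<close> has leading coefficient 1 or -1, so division by
  \<open>g\<close> stays integral.\<close>

lemma root_unity_basis:
  assumes n: "n > 0"
  obtains d where "d > 0"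
    "\<And>f. \<exists>r. degree r < d \<and> ieval f (root_unity n) = ieval r (root_unity n)"
    "\<And>r. degree r < d \<Longrightarrow> ieval r (root_unity n) = 0 \<Longrightarrow> r = 0"
proof -
  let ?z = "root_unity n"
  define F :: "int poly" where "F = monom 1 n - 1"
  have coeffF: "coeff F n = 1" using n by (simp add: F_def)
  have degF: "degree F = n"
  proof (rule antisym)
    show "degree F \<le> n" unfolding F_def
      by (rule degree_diff_le) (simp_all add: degree_monom_le)
    show "n \<le> degree F" using coeffF by (intro le_degree) simp
  qed
  have "F \<noteq> 0" using coeffF by auto
  moreover have "ieval F ?z = 0" using n by (simp add: F_def)
  ultimately obtain g where g: "prime_elem g" "g dvd F" "ieval g ?z = 0" by (rule root_factor)
  have "g \<noteq> 0" using g(1) by auto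
  have "degree g > 0"
  proof (rule ccontr)
    assume "\<not> degree g > 0"
    then obtain c where "g = [:c:]" by (metis degree_eq_zeroE gr0I)
    with g \<open>g \<noteq> 0\<close> show False by simp
  qed
  obtain k where "F = g * k" using g(2) by (elim dvdE)
  hence "Polynomial.lead_coeff g * Polynomial.lead_coeff k = 1" using coeffF degF by (metis lead_coeff_mult)
  hence lc: "Polynomial.lead_coeff g * Polynomial.lead_coeff g = 1"
    by (auto simp: zmult_eq_1_iff)
  have ex: "\<exists>r. degree r < degree g \<and> ieval f ?z = ieval r ?z" for f
  proof -
    obtain q r where qr: "pseudo_divmod f g = (q, r)" by fastforce
    define e where "e = Suc (degree f) - degree g"
    have 1: "smult (Polynomial.lead_coeff g ^ e) f = g * q + r" and 2: "r = 0 \<or> degree r < degree g"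
      using pseudo_divmod[OF \<open>g \<noteq> 0\<close> qr] by (auto simp: e_def)
    \<comment> \<open>Multiplying the pseudo-division identity once more by the same power of the
      leading coefficient removes it, whatever its sign.\<close>
    have le: "Polynomial.lead_coeff g ^ e * Polynomial.lead_coeff g ^ e = 1"
      by (metis lc power_mult_distrib power_one)
    have "ieval f ?z = ieval (smult (Polynomial.lead_coeff g ^ e) r) ?z"
    proof -
      have "smult (Polynomial.lead_coeff g ^ e) (smult (Polynomial.lead_coeff g ^ e) f) = smult (Polynomial.lead_coeff g ^ e) (g * q + r)"
        using 1 by simp
      hence "f = smult (Polynomial.lead_coeff g ^ e) (g * q + r)" by (simp only: smult_smult le smult_1_left)
      hence "ieval f ?z = ieval (smult (Polynomial.lead_coeff g ^ e) (g * q + r)) ?z" by simp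
      thus ?thesis using g(3) by simp
    qed
    moreover have "degree (smult (Polynomial.lead_coeff g ^ e) r) < degree g"
      using 2 \<open>degree g > 0\<close> by auto
    ultimately show ?thesis by blast
  qed
  have un: "r = 0" if "degree r < degree g" "ieval r ?z = 0" for r
    using prime_elem_minimal_degree[OF g(1,3) _ that(2)] that(1) by linarith
  show ?thesis using that[of "degree g"] \<open>degree g > 0\<close> ex un by blast
qed

text \<open>Compare constant coordinates in the integral basis: a ring element divisible by
  \<open>a\<close> has all its coordinates divisible by \<open>a\<close>. This turns divisibility of
  cyclotomic integers back into divisibility of integers.\<close>

lemma of_int_dvd_root_unity:
  assumes "n > 0" "of_int a * ieval f (root_unity n) = of_int b"
  shows "a dvd b"
proof -
  obtain d where d: "d > 0"
    "\<And>f. \<exists>r. degree r < d \<and> ieval f (root_unity n) = ieval r (root_unity n)"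
    "\<And>r. degree r < d \<Longrightarrow> ieval r (root_unity n) = 0 \<Longrightarrow> r = 0"
    using root_unity_basis[OF assms(1)] by metis
  obtain r where r: "degree r < d" "ieval f (root_unity n) = ieval r (root_unity n)" using d(2) by blast
  have "smult a r - [:b:] = 0"
  proof (rule d(3))
    show "degree (smult a r - [:b:]) < d" using r(1) by (intro degree_diff_less) auto
    show "ieval (smult a r - [:b:]) (root_unity n) = 0" using assms(2) r(2) by simp
  qed
  hence "coeff (smult a r) 0 = b" by simp
  thus ?thesis by auto
qed

section \<open>Frobenius congruences and conjugation\<close>

lemma add_power_prime:
  fixes x y :: "'a :: comm_ring_1"
  assumes "prime q"
  shows "\<exists>w. (x + y) ^ q = x ^ q + y ^ q + of_nat q * w"
proof -
  have q: "q > 0" using assms by (simp add: prime_gt_0_nat)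
  have "\<exists>w. of_nat (q choose k) * x ^ k * y ^ (q - k) = of_nat q * w" if "k \<in> {0<..<q}" for k
  proof -
    have "q dvd (q choose k)" using that assms q by (intro dvd_choose_prime) auto
    then obtain c where "q choose k = q * c" by (elim dvdE)
    thus ?thesis by (intro exI[of _ "of_nat c * x ^ k * y ^ (q - k)"]) (simp add: algebra_simps)
  qed
  then obtain w where w: "\<And>k. k \<in> {0<..<q} \<Longrightarrow> of_nat (q choose k) * x ^ k * y ^ (q - k) = of_nat q * w k"
    by metis
  have "{..q} = insert 0 (insert q {0<..<q})" using q by auto
  hence "(x + y) ^ q = x ^ q + y ^ q + (\<Sum>k\<in>{0<..<q}. of_nat (q choose k) * x ^ k * y ^ (q - k))"
    using q by (simp add: binomial_ring add.commute)
  also have "(\<Sum>k\<in>{0<..<q}. of_nat (q choose k) * x ^ k * y ^ (q - k)) = of_nat q * (\<Sum>k\<in>{0<..<q}. w k)"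
    using w by (simp add: sum_distrib_left)
  finally show ?thesis by blast
qed

lemma int_power_prime:
  assumes "prime (q :: nat)"
  shows "\<exists>w::int. a ^ q = a + of_nat q * w"
proof (induction a rule: int_induct[where k = 0])
  case base
  show ?case using assms by (intro exI[of _ 0]) (simp add: prime_gt_0_nat)
next
  case (step1 i)
  obtain w where "i ^ q = i + of_nat q * w" using step1 by blast
  moreover obtain v where "(i + 1) ^ q = i ^ q + 1 ^ q + of_nat q * v"
    using add_power_prime[OF assms] by blast
  ultimately show ?case by (intro exI[of _ "w + v"]) (simp add: algebra_simps)
next
  case (step2 i)
  obtain w where "i ^ q = i + of_nat q * w" using step2 by blast
  moreover obtain v where "((i - 1) + 1) ^ q = (i - 1) ^ q + 1 ^ q + of_nat q * v"
    using add_power_prime[OF assms] by blast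
  ultimately show ?case by (intro exI[of _ "w - v"]) (simp add: algebra_simps)
qed

text \<open>Frobenius modulo \<open>q\<close>. The error polynomial \<open>g\<close> is chosen
  before \<open>z\<close>, so that it can later be composed with a power of the variable.\<close>

lemma ieval_power_prime:
  assumes "prime q"
  shows "\<exists>g. \<forall>z. ieval f (z ^ q) = ieval f z ^ q + of_nat q * ieval g z"
proof (induction f)
  case 0
  show ?case using assms by (intro exI[of _ 0]) (simp add: prime_gt_0_nat)
next
  case (pCons a f)
  obtain g where g: "\<And>z. ieval f (z ^ q) = ieval f z ^ q + of_nat q * ieval g z" using pCons by blast
  obtain w where w: "a ^ q = a + of_nat q * w" using int_power_prime[OF assms] by blast
  obtain v where v: "([:a:] + monom 1 1 * f) ^ q = [:a:] ^ q + (monom 1 1 * f) ^ q + of_nat q * v"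
    using add_power_prime[OF assms] by blast
  show ?case
  proof (intro exI[of _ "monom 1 q * g - [:w:] - v"] allI)
    fix z
    have "(of_int a + z * ieval f z) ^ q = of_int a ^ q + (z * ieval f z) ^ q + of_nat q * ieval v z"
      using arg_cong[OF v, of "\<lambda>p. ieval p z"] by simp
    moreover have "(of_int a :: complex) ^ q = of_int a + of_nat q * of_int w"
      using arg_cong[OF w, of "of_int :: int \<Rightarrow> complex"] by simp
    ultimately show "ieval (pCons a f) (z ^ q) = ieval (pCons a f) z ^ q + of_nat q * ieval (monom 1 q * g - [:w:] - v) z"
      by (simp add: g algebra_simps power_mult_distrib)
  qed
qed

text \<open>Landau's argument: \<open>f(\<zeta>\<^sup>b) = 0\<close> makes \<open>f(\<zeta>\<^bsup>bq\<^esup>)\<close> divisible by \<open>q\<close>, while its coordinates in the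
  integral basis are bounded independently of \<open>q\<close>.\<close>
lemma ieval_root_unity_large_prime:
  assumes n: "n > 0"
  obtains A where "\<And>b q. prime q \<Longrightarrow> q > A \<Longrightarrow> ieval f (root_unity n ^ b) = 0 \<Longrightarrow> ieval f (root_unity n ^ (b * q)) = 0"
proof -
  let ?z = "root_unity n"
  obtain d where d: "d > 0"
    "\<And>f. \<exists>r. degree r < d \<and> ieval f ?z = ieval r ?z"
    "\<And>r. degree r < d \<Longrightarrow> ieval r ?z = 0 \<Longrightarrow> r = 0"
    using root_unity_basis[OF n] by metis
  have "\<exists>r. degree r < d \<and> ieval f (?z ^ k) = ieval r ?z" for k
    using d(2)[of "pcompose f (monom 1 k)"] by simp
  then obtain R where R: "\<And>k. degree (R k) < d" "\<And>k. ieval f (?z ^ k) = ieval (R k) ?z" by metis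
  \<comment> \<open>The maximum runs over the \<open>n\<close> residues of the exponent only; this
    is why the bound does not depend on \<open>q\<close>.\<close>
  define A where "A = Max ((\<lambda>(k, i). nat \<bar>coeff (R k) i\<bar>) ` ({..<n} \<times> {..d}))"
  show ?thesis
  proof (rule that[of A])
    fix b q :: nat assume q: "prime q" "q > A" and 0: "ieval f (?z ^ b) = 0"
    define k where "k = (b * q) mod n"
    have k: "?z ^ k = ?z ^ (b * q)" using n by (simp add: k_def root_unity_power_mod)
    obtain g where g: "\<And>z. ieval f (z ^ q) = ieval f z ^ q + of_nat q * ieval g z"
      using ieval_power_prime[OF q(1)] by blast
    obtain s where s: "degree s < d" "ieval (pcompose g (monom 1 b)) ?z = ieval s ?z" using d(2) by blast
    have "ieval (R k) ?z = of_nat q * ieval s ?z"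
      using g[of "?z ^ b"] 0 R(2)[of k] s(2) prime_gt_0_nat[OF q(1)] k by (simp add: power_mult zero_power)
    hence "R k - smult (int q) s = 0"
      using R(1)[of k] s(1) by (intro d(3) degree_diff_less) auto
    hence eq: "R k = smult (int q) s" by simp
    have "coeff (R k) i = 0" for i
    proof (cases "i \<le> d")
      case True
      have "nat \<bar>coeff (R k) i\<bar> \<le> A" unfolding A_def
        using True n by (intro Max_ge) (auto simp: k_def intro!: image_eqI[of _ _ "(k, i)"])
      hence "\<bar>coeff (R k) i\<bar> < int q" using q(2) by linarith
      moreover have "int q dvd coeff (R k) i" using eq by simp
      ultimately show ?thesis using dvd_imp_le_int[of "coeff (R k) i" "int q"] by linarith
    next
      case False
      thus ?thesis using R(1)[of k] by (simp add: coeff_eq_0)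
    qed
    hence "R k = 0" by (simp add: poly_eq_iff)
    thus "ieval f (?z ^ (b * q)) = 0" using R(2)[of k] k by simp
  qed
qed

text \<open>The irreducibility of the cyclotomic polynomial, in the form in which it acts as a
  Galois conjugation. The exponent \<open>a\<close> is replaced by some \<open>N\<close> congruent
  to \<open>a\<close> modulo \<open>n\<close> whose prime factors all exceed Landau's bound; these
  primes are then applied one after another.\<close>

theorem ieval_root_unity_conjugate:
  assumes n: "n > 0" and a: "coprime a n" and 0: "ieval f (root_unity n) = 0"
  shows "ieval f (root_unity n ^ a) = 0"
proof -
  let ?z = "root_unity n"
  obtain A where A: "\<And>b q. prime q \<Longrightarrow> q > A \<Longrightarrow> ieval f (?z ^ b) = 0 \<Longrightarrow> ieval f (?z ^ (b * q)) = 0"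
    using ieval_root_unity_large_prime[OF n] by metis
  have step: "ieval f (?z ^ (b * N)) = 0"
    if "N > 0" "\<And>q. prime q \<Longrightarrow> q dvd N \<Longrightarrow> q > A" "ieval f (?z ^ b) = 0" for N b
    using that
  proof (induction N arbitrary: b rule: prime_divisors_induct)
    case (factor p x)
    have "ieval f (?z ^ (b * p)) = 0" using factor by (intro A) auto
    hence "ieval f (?z ^ (b * p * x)) = 0" using factor by (intro factor.IH) auto
    thus ?case by (simp add: mult.assoc)
  qed auto
  \<comment> \<open>A prime \<open>q \<le> A\<close> divides exactly one of \<open>a\<close> and
    \<open>n * P\<close>, hence not their sum \<open>N\<close>. This avoids primes in arithmetic
    progressions.\<close>
  define P where "P = \<Prod>{p. prime p \<and> p \<le> A \<and> \<not> p dvd a}"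
  define N where "N = a + n * P"
  have fin: "finite {p::nat. prime p \<and> p \<le> A \<and> \<not> p dvd a}" by simp
  have "P > 0" unfolding P_def by (intro prod_pos) (auto simp: prime_gt_0_nat)
  have "ieval f (?z ^ (1 * N)) = 0"
  proof (rule step)
    show "N > 0" using n \<open>P > 0\<close> by (simp add: N_def)
    show "q > A" if q: "prime q" "q dvd N" for q
    proof (rule ccontr)
      assume "\<not> q > A"
      show False
      proof (cases "q dvd a")
        case True
        hence "q dvd n * P" using q(2) by (simp add: N_def dvd_add_right_iff)
        hence "q dvd n \<or> q dvd P" using q(1) by (simp add: prime_dvd_mult_iff)
        moreover have "\<not> q dvd n" using True a q(1)
          by (meson coprime_common_divisor not_prime_unit)
        moreover have "\<not> q dvd P" unfolding P_def
        proof
          assume "q dvd \<Prod>{p. prime p \<and> p \<le> A \<and> \<not> p dvd a}"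
          then obtain p where "prime p" "\<not> p dvd a" "q dvd p"
            using prime_dvd_prod_iff[OF fin q(1), of "\<lambda>x. x"] by auto
          thus False using True q(1) primes_dvd_imp_eq by blast
        qed
        ultimately show False by blast
      next
        case False
        have "q dvd P" unfolding P_def
          using fin q \<open>\<not> q > A\<close> False by (intro dvd_prodI[of _ _ "\<lambda>x. x", simplified]) auto
        hence "q dvd a" using q(2) by (simp add: N_def dvd_add_left_iff)
        with False show False by blast
      qed
    qed
  qed (use 0 in simp)
  moreover have "?z ^ N = ?z ^ a" using n by (simp add: N_def power_add power_mult)
  ultimately show ?thesis by simp
qed

subsection \<open>Cross ratios of roots of unity\<close>

definition cyclotomic_int :: "nat \<Rightarrow> complex set" where
  "cyclotomic_int n = range (\<lambda>p. ieval p (root_unity n))"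

lemma cyclotomic_int_add: "x \<in> cyclotomic_int n \<Longrightarrow> y \<in> cyclotomic_int n \<Longrightarrow> x + y \<in> cyclotomic_int n"
  unfolding cyclotomic_int_def by (auto simp flip: ieval_add)

lemma cyclotomic_int_diff: "x \<in> cyclotomic_int n \<Longrightarrow> y \<in> cyclotomic_int n \<Longrightarrow> x - y \<in> cyclotomic_int n"
  unfolding cyclotomic_int_def by (auto simp flip: ieval_diff)

lemma cyclotomic_int_mult: "x \<in> cyclotomic_int n \<Longrightarrow> y \<in> cyclotomic_int n \<Longrightarrow> x * y \<in> cyclotomic_int n"
  unfolding cyclotomic_int_def by (auto simp flip: ieval_mult)

lemma cyclotomic_int_of_int: "of_int k \<in> cyclotomic_int n"
  unfolding cyclotomic_int_def by (rule image_eqI[of _ _ "[:k:]"]) simp_all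

lemma cyclotomic_int_1: "1 \<in> cyclotomic_int n"
  using cyclotomic_int_of_int[of 1] by simp

lemma cyclotomic_int_0: "0 \<in> cyclotomic_int n"
  using cyclotomic_int_of_int[of 0] by simp

lemma cyclotomic_int_power: "x \<in> cyclotomic_int n \<Longrightarrow> x ^ k \<in> cyclotomic_int n"
  by (induction k) (auto intro: cyclotomic_int_mult cyclotomic_int_1)

lemma cyclotomic_int_sum: "(\<And>i. i \<in> I \<Longrightarrow> f i \<in> cyclotomic_int n) \<Longrightarrow> sum f I \<in> cyclotomic_int n"
  by (induction I rule: infinite_finite_induct) (auto intro: cyclotomic_int_add cyclotomic_int_0)

lemma cyclotomic_int_prod: "(\<And>i. i \<in> I \<Longrightarrow> f i \<in> cyclotomic_int n) \<Longrightarrow> prod f I \<in> cyclotomic_int n"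
  by (induction I rule: infinite_finite_induct) (auto intro: cyclotomic_int_mult cyclotomic_int_1)

lemma root_unity_in_cyclotomic_int: "root_unity n \<in> cyclotomic_int n"
  unfolding cyclotomic_int_def by (rule image_eqI[of _ _ "monom 1 1"]) simp_all

lemma unity_in_cyclotomic_int:
  assumes "n > 0" "z ^ n = 1"
  shows "z \<in> cyclotomic_int n"
  using root_unity_powers[OF assms] cyclotomic_int_power root_unity_in_cyclotomic_int by metis

lemma cnj_root_unity: "n > 0 \<Longrightarrow> cnj (root_unity n) = root_unity n ^ (n - 1)"
proof -
  assume n: "n > 0"
  have "root_unity n * cnj (root_unity n) = 1"
    by (simp add: complex_norm_square[symmetric])
  moreover have "root_unity n * root_unity n ^ (n - 1) = 1"
    using n root_unity_power_self[OF n] by (metis power_minus_mult mult.commute)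
  ultimately show ?thesis by (metis mult_left_cancel root_unity_nonzero)
qed

lemma cyclotomic_int_cnj:
  assumes n: "n > 0" and x: "x \<in> cyclotomic_int n"
  shows "cnj x \<in> cyclotomic_int n"
proof -
  obtain p where "x = ieval p (root_unity n)" using x by (auto simp: cyclotomic_int_def)
  hence "cnj x = ieval (pcompose p (monom 1 (n - 1))) (root_unity n)"
    using n by (simp add: cnj_ieval cnj_root_unity)
  thus ?thesis unfolding cyclotomic_int_def by blast
qed

section \<open>Prime factors of differences of roots of unity\<close>

lemma geometric_factor:
  assumes "\<eta> \<in> cyclotomic_int n"
  shows "\<exists>w\<in>cyclotomic_int n. 1 - \<eta> ^ k = (1 - \<eta>) * w"
proof
  show "1 - \<eta> ^ k = (1 - \<eta>) * (\<Sum>i<k. \<eta> ^ i)" by (rule one_diff_power_eq)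
  show "(\<Sum>i<k. \<eta> ^ i) \<in> cyclotomic_int n"
    using assms by (auto intro: cyclotomic_int_sum cyclotomic_int_power)
qed

text \<open>The polynomial \<open>1 + X + ... + X^(p-1)\<close> and the product of the
  \<open>X - w^j\<close> are monic of degree \<open>p - 1\<close> and share \<open>p - 1\<close>
  roots, so they agree; evaluate both at 1.\<close>

lemma prod_one_minus_powers:
  fixes w :: complex
  assumes p: "prime p" and w: "w ^ p = 1" "w \<noteq> 1"
  shows "(\<Prod>j\<in>{1..<p}. 1 - w ^ j) = of_nat p"
proof -
  have p1: "p > 1" using p by (rule prime_gt_1_nat)
  have inj: "inj_on (\<lambda>j. w ^ j) {1..<p}"
  proof -
    have ne: "w ^ i \<noteq> w ^ j" if ij: "1 \<le> i" "i < j" "j < p" for i j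
    proof
      assume "w ^ i = w ^ j"
      hence "w ^ i * w ^ (j - i) = w ^ i * 1" using that
        by (metis le_add_diff_inverse less_imp_le mult.right_neutral power_add)
      moreover have "w \<noteq> 0" using w(1) p1 by (auto simp: zero_power)
      ultimately have 1: "w ^ (j - i) = 1" by simp
      have "coprime (j - i) p" using that p
        by (metis coprime_commute diff_less dvd_imp_le less_trans linorder_not_less prime_imp_coprime zero_less_diff less_le_trans zero_less_one)
      then obtain x y where xy: "(j - i) * x = p * y + 1"
        using p1 coprime_bezout_strong[of "j - i" p] ij by auto
      have "w = w ^ (p * y + 1)" using w(1) by (simp add: power_mult)
      also have "\<dots> = (w ^ (j - i)) ^ x" by (simp only: xy[symmetric] power_mult)
      also have "\<dots> = 1" using 1 by simp
      finally show False using w(2) by simp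
    qed
    show ?thesis unfolding inj_on_def
      by (metis ne atLeastLessThan_iff linorder_less_linear)
  qed
  define S where "S = (\<lambda>j. w ^ j) ` {1..<p}"
  define G where "G = (\<Sum>i<p. monom (1::complex) i)"
  define H where "H = (\<Prod>s\<in>S. [:- s, 1:])"
  have fS: "finite S" and cS: "card S = p - 1" using inj by (auto simp: S_def card_image)
  have G0: "poly G s = 0" if s: "s \<in> S" for s
  proof -
    obtain j where j: "s = w ^ j" "1 \<le> j" "j < p" using s by (auto simp: S_def)
    have "s \<noteq> 1"
    proof
      assume "s = 1"
      hence "w ^ j = 1" using j by simp
      have "coprime j p" using j p
        by (metis coprime_commute dvd_imp_le linorder_not_less prime_imp_coprime less_le_trans zero_less_one)
      then obtain x y where xy: "j * x = p * y + 1"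
        using p1 coprime_bezout_strong[of j p] by auto
      have "w = w ^ (p * y + 1)" using w(1) by (simp add: power_mult)
      also have "\<dots> = (w ^ j) ^ x" by (simp only: xy[symmetric] power_mult)
      also have "\<dots> = 1" using \<open>w ^ j = 1\<close> by simp
      finally show False using w(2) by simp
    qed
    have "s ^ p = 1" using j w(1) by (metis power_mult mult.commute power_one)
    hence "(1 - s) * (\<Sum>i<p. s ^ i) = 0" by (simp flip: one_diff_power_eq)
    thus ?thesis using \<open>s \<noteq> 1\<close> by (simp add: G_def poly_sum poly_monom)
  qed
  have degH: "degree H = p - 1" unfolding H_def
    by (subst degree_prod_eq_sum_degree) (auto simp: cS)
  have lcH: "coeff H (p - 1) = 1"
    proof -
    have "Polynomial.lead_coeff H = 1" unfolding H_def by (simp add: lead_coeff_prod)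
    thus ?thesis using degH by simp
  qed
  have degG: "degree G \<le> p - 1" unfolding G_def
    by (intro degree_sum_le) (auto intro: order.trans[OF degree_monom_le])
  have lcG: "coeff G (p - 1) = 1" using p1 by (simp add: G_def coeff_sum)
  have "G - H = 0"
  proof (rule ccontr)
    assume "G - H \<noteq> 0"
    have "coeff (G - H) (p - 1) = 0" using lcG lcH by simp
    moreover have "degree (G - H) \<le> p - 1" using degG degH by (intro degree_diff_le) auto
    ultimately have "degree (G - H) < p - 1"
      using \<open>G - H \<noteq> 0\<close> by (metis leading_coeff_0_iff le_neq_implies_less)
    moreover have "S \<subseteq> {x. poly (G - H) x = 0}"
      using G0 fS by (auto simp: H_def poly_prod)
    hence "p - 1 \<le> card {x. poly (G - H) x = 0}"
      using cS card_mono[OF poly_roots_finite[OF \<open>G - H \<noteq> 0\<close>]] by metis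
    ultimately show False using card_poly_roots_bound[OF \<open>G - H \<noteq> 0\<close>] by linarith
  qed
  hence "poly G 1 = poly H 1" by simp
  moreover have "poly G 1 = of_nat p" by (simp add: G_def poly_sum poly_monom)
  moreover have "poly H 1 = (\<Prod>j\<in>{1..<p}. 1 - w ^ j)"
    unfolding H_def S_def by (subst prod.reindex[OF inj]) (simp add: poly_prod)
  ultimately show ?thesis by simp
qed

text \<open>Bounds the \<open>p\<close>-adic valuation of \<open>1 - \<eta>\<close> by
  \<open>1 / (p - 1)\<close>, with \<open>k\<close> absorbing what is prime to \<open>p\<close>. The
  proof splits according to whether the order \<open>p^a * s\<close> of \<open>\<eta>\<close> is a
  power of \<open>p\<close>.\<close>

lemma one_minus_unity_dvd:
  assumes p: "prime p" and Q: "Q > 0" and \<eta>: "\<eta> ^ Q = 1" "\<eta> \<noteq> 1"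
  shows "\<exists>k. \<exists>f\<in>cyclotomic_int Q. \<not> p dvd k \<and> (1 - \<eta>) ^ (p - 1) * f = of_nat (p * k)"
proof -
  define r where "r = (LEAST r. r > 0 \<and> \<eta> ^ r = 1)"
  have r: "r > 0" "\<eta> ^ r = 1" and rmin: "\<And>s. s > 0 \<Longrightarrow> \<eta> ^ s = 1 \<Longrightarrow> r \<le> s"
    unfolding r_def using LeastI[of "\<lambda>r. r > 0 \<and> \<eta> ^ r = 1" Q] Q \<eta> by (auto intro: Least_le)
  have \<eta>int: "\<eta> \<in> cyclotomic_int Q" using unity_in_cyclotomic_int Q \<eta>(1) by blast
  define a where "a = multiplicity p r"
  obtain s where s: "r = p ^ a * s" "\<not> p dvd s"
    using multiplicity_decompose'[of r p] r(1) p unfolding a_def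
    by (metis not_prime_unit not_gr_zero)
  show ?thesis
  proof (cases "s = 1")
    case True
    have "r \<noteq> 1" using r \<eta>(2) by auto
    then obtain b where b: "a = Suc b" using s True by (cases a) auto
    \<comment> \<open>A primitive \<open>p\<close>-th root of unity that is a power of
      \<open>\<eta>\<close>: every factor \<open>1 - w^j\<close> of the product formula for
      \<open>p\<close> contains \<open>1 - \<eta>\<close>.\<close>
    define w where "w = \<eta> ^ (p ^ b)"
    have "w ^ p = 1" using r(2) s True b by (simp add: w_def power_mult[symmetric] mult.commute)
    moreover have "w \<noteq> 1"
    proof
      assume "w = 1"
      hence "r \<le> p ^ b" using p by (intro rmin) (auto simp: w_def prime_gt_0_nat)
      moreover have "r > p ^ b" using s True b prime_gt_1_nat[OF p] by simp
      ultimately show False by simp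
    qed
    ultimately have P: "(\<Prod>j\<in>{1..<p}. 1 - w ^ j) = of_nat p" using prod_one_minus_powers[OF p] by blast
    have "\<exists>v\<in>cyclotomic_int Q. 1 - w ^ j = (1 - \<eta>) * v" for j
      using geometric_factor[OF \<eta>int, of "p ^ b * j"] by (simp add: w_def power_mult)
    then obtain v where v: "\<And>j. v j \<in> cyclotomic_int Q" "\<And>j. 1 - w ^ j = (1 - \<eta>) * v j" by metis
    have "of_nat p = (1 - \<eta>) ^ (p - 1) * (\<Prod>j\<in>{1..<p}. v j)"
      using P by (simp add: v(2) prod.distrib)
    moreover have "(\<Prod>j\<in>{1..<p}. v j) \<in> cyclotomic_int Q" by (intro cyclotomic_int_prod v)
    moreover have "\<not> p dvd 1" using p not_prime_unit by blast
    ultimately show ?thesis by (metis mult.right_neutral)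
  next
    case False
    \<comment> \<open>The powers of \<open>t\<close> up to its exponent \<open>s\<close> sum to
      zero, which makes \<open>s\<close>, a number prime to \<open>p\<close>, a multiple of
      \<open>1 - \<eta>\<close>. The factor \<open>p\<close> in the claim is then put in by
      hand.\<close>
    define t where "t = \<eta> ^ (p ^ a)"
    have ts: "t ^ s = 1" using r(2) s by (simp add: t_def power_mult[symmetric])
    have "s > 0" using s(1) r(1) by (cases s) auto
    have "t \<noteq> 1"
    proof
      assume "t = 1"
      hence "r \<le> p ^ a" using p by (intro rmin) (auto simp: t_def prime_gt_0_nat)
      thus False using s(1) False \<open>s > 0\<close> prime_gt_0_nat[OF p] by (cases s) auto
    qed
    have "(1 - t) * (\<Sum>i<s. t ^ i) = 0" using ts by (simp flip: one_diff_power_eq)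
    hence S0: "(\<Sum>i<s. t ^ i) = 0" using \<open>t \<noteq> 1\<close> by simp
    have "\<exists>v\<in>cyclotomic_int Q. 1 - t ^ j = (1 - \<eta>) * v" for j
      using geometric_factor[OF \<eta>int, of "p ^ a * j"] by (simp add: t_def power_mult)
    then obtain v where v: "\<And>j. v j \<in> cyclotomic_int Q" "\<And>j. 1 - t ^ j = (1 - \<eta>) * v j" by metis
    have "of_nat s = (\<Sum>i<s. 1 - t ^ i)" using S0 by (simp add: sum_subtractf)
    also have "\<dots> = (1 - \<eta>) * (\<Sum>i<s. v i)" by (simp add: v(2) sum_distrib_left)
    finally have "(1 - \<eta>) ^ (p - 1) * (of_int (int p) * (\<Sum>i<s. v i) ^ (p - 1)) = of_nat (p * s ^ (p - 1))"
      by (simp add: power_mult_distrib)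
    moreover have "of_int (int p) * (\<Sum>i<s. v i) ^ (p - 1) \<in> cyclotomic_int Q"
      by (intro cyclotomic_int_mult cyclotomic_int_of_int cyclotomic_int_power cyclotomic_int_sum v)
    moreover have "\<not> p dvd s ^ (p - 1)" using s(2) p prime_dvd_power by blast
    ultimately show ?thesis by blast
  qed
qed

text \<open>The factor \<open>x\<close> is a unit of the ring, so division by it reduces the
  difference to \<open>1 - y / x\<close>.\<close>

lemma unity_diff_dvd:
  assumes p: "prime p" and Q: "Q > 0" and xy: "x ^ Q = 1" "y ^ Q = 1" "x \<noteq> y"
  shows "\<exists>k. \<exists>f\<in>cyclotomic_int Q. \<not> p dvd k \<and> (x - y) ^ (p - 1) * f = of_nat (p * k)"
proof -
  have x0: "x \<noteq> 0" using xy Q by (auto simp: zero_power)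
  have "(y / x) ^ Q = 1" "y / x \<noteq> 1" using xy x0 by (auto simp: power_divide)
  then obtain k f where kf: "f \<in> cyclotomic_int Q" "\<not> p dvd k" "(1 - y / x) ^ (p - 1) * f = of_nat (p * k)"
    using one_minus_unity_dvd[OF p Q] by metis
  have "x - y = x * (1 - y / x)" using x0 by (simp add: field_simps)
  hence "(x - y) ^ (p - 1) * (inverse x ^ (p - 1) * f) = of_nat (p * k)"
    using kf(3) x0 by (simp add: power_mult_distrib power_inverse[symmetric] flip: mult.assoc) (simp add: mult_ac flip: power_mult_distrib mult.assoc)
  moreover have "inverse x ^ Q = 1" using xy by (simp add: power_inverse)
  hence "inverse x ^ (p - 1) * f \<in> cyclotomic_int Q"
    using Q kf(1) by (intro cyclotomic_int_mult[OF cyclotomic_int_power[OF unity_in_cyclotomic_int]])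
  ultimately show ?thesis using kf(2) by blast
qed

text \<open>The \<open>5\<close>-adic valuation of a difference of two roots of unity is at most \<open>1/4\<close>.\<close>
lemma unity_cross_ratio_not_5:
  assumes Q: "Q > 0" and xs: "x1 ^ Q = 1" "x2 ^ Q = 1" "x3 ^ Q = 1" "x4 ^ Q = 1"
    and ne: "x1 \<noteq> x2" "x3 \<noteq> x4"
  shows "(x1 - x2) * (x3 - x4) \<noteq> (5::complex) * ((x1 - x3) * (x2 - x4))"
proof
  assume eq: "(x1 - x2) * (x3 - x4) = 5 * ((x1 - x3) * (x2 - x4))"
  have p: "prime (5::nat)" by simp
  obtain k f where kf: "f \<in> cyclotomic_int Q" "\<not> 5 dvd k" "(x1 - x2) ^ 4 * f = of_nat (5 * k)"
    using unity_diff_dvd[OF p Q xs(1,2) ne(1)] by auto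
  obtain l g where lg: "g \<in> cyclotomic_int Q" "\<not> 5 dvd l" "(x3 - x4) ^ 4 * g = of_nat (5 * l)"
    using unity_diff_dvd[OF p Q xs(3,4) ne(2)] by auto
  \<comment> \<open>The exponent 4 is \<open>p - 1\<close>. The product equals
    \<open>25 * (k * l)\<close> with \<open>k\<close> and \<open>l\<close> prime to 5, whereas the
    assumed equation makes it divisible by \<open>5^4\<close>. For the prime 3 the same count would
    give \<open>3^2\<close> on both sides.\<close>
  have "of_int (int (25 * (k * l))) = ((x1 - x2) ^ 4 * f) * ((x3 - x4) ^ 4 * g)"
    by (simp add: kf lg)
  also have "\<dots> = ((x1 - x2) * (x3 - x4)) ^ 4 * (f * g)" by (simp only: power_mult_distrib ac_simps)
  also have "\<dots> = of_int 625 * (((x1 - x3) * (x2 - x4)) ^ 4 * (f * g))"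
    by (simp add: eq power_mult_distrib)
  finally have *: "of_int 625 * (((x1 - x3) * (x2 - x4)) ^ 4 * (f * g)) = of_int (int (25 * (k * l)))" by simp
  have "((x1 - x3) * (x2 - x4)) ^ 4 * (f * g) \<in> cyclotomic_int Q"
    by (intro cyclotomic_int_mult cyclotomic_int_power cyclotomic_int_diff unity_in_cyclotomic_int[OF Q] xs kf(1) lg(1))
  then obtain h where "((x1 - x3) * (x2 - x4)) ^ 4 * (f * g) = ieval h (root_unity Q)"
    by (auto simp: cyclotomic_int_def)
  with * have "(625::int) dvd int (25 * (k * l))" using of_int_dvd_root_unity[OF Q] by metis
  hence "int 625 dvd int (25 * (k * l))" by simp
  hence "625 dvd 25 * (k * l)" by (simp only: int_dvd_int_iff)
  then obtain c where "25 * (k * l) = 625 * c" by (elim dvdE)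
  hence "k * l = 5 * (5 * c)" by simp
  hence "5 dvd k * l" by simp
  hence "5 dvd k \<or> 5 dvd l" using p by (simp add: prime_dvd_mult_iff)
  thus False using kf lg by blast
qed

section \<open>Lowering the order of roots of unity\<close>

text \<open>The cross ratio is the fraction \<open>a / b\<close>, cleared of denominators so that
  the relation stays inside the ring and can be conjugated.\<close>

definition cross_ratios_in :: "complex set \<Rightarrow> complex set \<Rightarrow> bool" where
  "cross_ratios_in R T \<longleftrightarrow>
     (\<forall>x1\<in>T. \<forall>x2\<in>T. \<forall>x3\<in>T. \<forall>x4\<in>T. distinct [x1, x2, x3, x4] \<longrightarrow>
        (\<exists>a\<in>R. \<exists>b\<in>R. b \<noteq> 0 \<and> b * ((x1 - x2) * (x3 - x4)) = a * ((x1 - x3) * (x2 - x4))))"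

text \<open>Fourier inversion on the group of \<open>p\<close>-th roots of unity. If only the mode
  \<open>jx\<close> can survive, then \<open>p\<close> times the class sum at \<open>r\<close> is
  \<open>inverse r ^ jx\<close> times that mode. So the class sums vanish all together, and one
  empty class is enough. The case \<open>jx \<ge> p\<close> encodes that no mode is
  exceptional.\<close>

lemma fourier_classes:
  fixes w K :: "'i \<Rightarrow> complex"
  assumes p: "p > 0" and I: "finite I" and K: "\<And>t. t \<in> I \<Longrightarrow> K t ^ p = 1"
    and S: "\<And>j. j < p \<Longrightarrow> j \<noteq> jx \<Longrightarrow> (\<Sum>t\<in>I. w t * K t ^ j) = 0"
    and ex: "jx \<ge> p \<or> (\<exists>r. r ^ p = 1 \<and> (\<Sum>t\<in>I. if K t = r then w t else 0) = 0)"
  shows "(\<Sum>t\<in>I. if K t = r then w t else 0) = 0"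
proof (cases "r ^ p = 1")
  case False
  thus ?thesis using K by (intro sum.neutral) auto
next
  case True
  define D where "D r = (\<Sum>t\<in>I. if K t = r then w t else 0)" for r
  define S0 where "S0 = (if jx < p then \<Sum>t\<in>I. w t * K t ^ jx else 0)"
  have geo: "(\<Sum>j<p. (K t / r) ^ j) = (if K t = r then of_nat p else 0)" if "t \<in> I" "r ^ p = 1" for t r
  proof -
    have r0: "r \<noteq> 0" using that p by (auto simp: zero_power)
    show ?thesis
    proof (cases "K t = r")
      case False
      have "(1 - K t / r) * (\<Sum>j<p. (K t / r) ^ j) = 0"
        using K[OF that(1)] that(2) one_diff_power_eq[of "K t / r" p] by (simp add: power_divide)
      moreover have "1 - K t / r \<noteq> 0" using False r0 by auto
      ultimately have "(\<Sum>j<p. (K t / r) ^ j) = 0" by (metis mult_eq_0_iff)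
      thus ?thesis using False by (simp only: if_False)
    qed (use r0 in simp)
  qed
  have D: "of_nat p * D r = inverse r ^ jx * S0" if "r ^ p = 1" for r
  proof -
    have "of_nat p * D r = (\<Sum>t\<in>I. w t * (\<Sum>j<p. (K t / r) ^ j))"
      using that by (auto simp: D_def sum_distrib_left geo intro!: sum.cong)
    also have "\<dots> = (\<Sum>j<p. inverse r ^ j * (\<Sum>t\<in>I. w t * K t ^ j))"
      by (simp add: sum_distrib_left sum.swap[of _ I] power_divide power_inverse divide_simps mult_ac)
    also have "\<dots> = (\<Sum>j<p. if j = jx then inverse r ^ jx * S0 else 0)"
      using S by (intro sum.cong) (auto simp: S0_def)
    also have "\<dots> = inverse r ^ jx * S0" by (auto simp: S0_def)
    finally show ?thesis .
  qed
  have "S0 = 0" using ex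
  proof
    assume "jx \<ge> p"
    thus ?thesis by (simp add: S0_def)
  next
    assume "\<exists>r. r ^ p = 1 \<and> (\<Sum>t\<in>I. if K t = r then w t else 0) = 0"
    then obtain r where r: "r ^ p = 1" "D r = 0" by (auto simp: D_def)
    moreover have "r \<noteq> 0" using r(1) p by (auto simp: zero_power)
    ultimately show ?thesis using D[of r] by simp
  qed
  hence "D r = 0" using D[OF True] p by simp
  thus ?thesis by (simp add: D_def)
qed

lemma card_unity: "p > 0 \<Longrightarrow> card {z::complex. z ^ p = 1} = p"
  using Complex.card_roots_unity_eq by blast

text \<open>The terms of the expansion of \<open>b (x\<^sub>1 - x\<^sub>2) (x\<^sub>3 - x\<^sub>4) - a (x\<^sub>1 - x\<^sub>3) (x\<^sub>2 - x\<^sub>4)\<close> whose class is \<open>r\<close>, for a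
  multiplicative class function \<open>\<kappa>\<close>.\<close>
definition class_sum ::
    "(complex \<Rightarrow> complex) \<Rightarrow> complex \<Rightarrow> complex \<Rightarrow> complex \<Rightarrow> complex \<Rightarrow> complex \<Rightarrow> complex \<Rightarrow> complex \<Rightarrow> complex" where
  "class_sum \<kappa> a b x1 x2 x3 x4 r =
     (if \<kappa> x1 * \<kappa> x3 = r then b*x1*x3 else 0) + (if \<kappa> x2 * \<kappa> x4 = r then b*x2*x4 else 0)
     - (if \<kappa> x1 * \<kappa> x2 = r then a*x1*x2 else 0) - (if \<kappa> x3 * \<kappa> x4 = r then a*x3*x4 else 0)
     + (if \<kappa> x1 * \<kappa> x4 = r then (a-b)*x1*x4 else 0) + (if \<kappa> x2 * \<kappa> x3 = r then (a-b)*x2*x3 else 0)"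

text \<open>The classes that occur among the six terms. If there are fewer than \<open>p\<close> of
  them, some class is empty and supplies the vanishing class sum that \<open>fourier_classes\<close>
  asks for.\<close>

definition class_products :: "(complex \<Rightarrow> complex) \<Rightarrow> complex \<Rightarrow> complex \<Rightarrow> complex \<Rightarrow> complex \<Rightarrow> complex set" where
  "class_products \<kappa> x1 x2 x3 x4 =
     {\<kappa> x1 * \<kappa> x3, \<kappa> x2 * \<kappa> x4, \<kappa> x1 * \<kappa> x2, \<kappa> x3 * \<kappa> x4, \<kappa> x1 * \<kappa> x4, \<kappa> x2 * \<kappa> x3}"

text \<open>The automorphism \<open>\<zeta> \<mapsto> \<zeta>\<^bsup>1+mj\<^esup>\<close> of the \<open>(pm)\<close>-th cyclotomic field multiplies a root of unity \<open>x\<close>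
  by the \<open>j\<close>-th power of \<open>x\<^sup>m\<close> and fixes the \<open>n\<close>-th cyclotomic field.\<close>
lemma six_terms:
  assumes p: "prime p" and m: "m > 0" and n: "n > 0" "n dvd m"
    and xs: "x1 ^ (p * m) = 1" "x2 ^ (p * m) = 1" "x3 ^ (p * m) = 1" "x4 ^ (p * m) = 1"
    and ab: "a \<in> cyclotomic_int n" "b \<in> cyclotomic_int n"
    and rel: "b * ((x1 - x2) * (x3 - x4)) = a * ((x1 - x3) * (x2 - x4))"
    and H: "p dvd m \<or> card (class_products (\<lambda>x. x ^ m) x1 x2 x3 x4) < p"
  shows "class_sum (\<lambda>x. x ^ m) a b x1 x2 x3 x4 r = 0"
proof -
  define Q where "Q = p * m"
  have p0: "p > 0" using p by (simp add: prime_gt_0_nat)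
  have Q0: "Q > 0" using p0 m by (simp add: Q_def)
  define z where "z = root_unity Q"
  obtain e1 where e1: "x1 = z ^ e1" using root_unity_powers[OF Q0] xs unfolding Q_def[symmetric] z_def by metis
  obtain e2 where e2: "x2 = z ^ e2" using root_unity_powers[OF Q0] xs unfolding Q_def[symmetric] z_def by metis
  obtain e3 where e3: "x3 = z ^ e3" using root_unity_powers[OF Q0] xs unfolding Q_def[symmetric] z_def by metis
  obtain e4 where e4: "x4 = z ^ e4" using root_unity_powers[OF Q0] xs unfolding Q_def[symmetric] z_def by metis
  obtain c where c: "m = n * c" using n(2) by (elim dvdE)
  have zn: "z ^ (p * c) = root_unity n"
    using root_unity_div[of "p * c" n] Q0 n(1) c by (simp add: z_def Q_def mult_ac)
  obtain pa where pa: "a = ieval pa (root_unity n)" using ab by (auto simp: cyclotomic_int_def)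
  obtain pb where pb: "b = ieval pb (root_unity n)" using ab by (auto simp: cyclotomic_int_def)
  \<comment> \<open>Expressing the coefficients through a power of \<open>z\<close> turns the
    relation into a single integer polynomial \<open>f\<close> vanishing at \<open>z\<close>, which
    can be conjugated.\<close>
  define A where "A = pcompose pa (monom 1 (p * c))"
  define B where "B = pcompose pb (monom 1 (p * c))"
  define f where "f = B * monom 1 (e1+e3) + B * monom 1 (e2+e4) - A * monom 1 (e1+e2) - A * monom 1 (e3+e4)
      + (A - B) * monom 1 (e1+e4) + (A - B) * monom 1 (e2+e3)"
  have f0: "ieval f z = 0"
  proof -
    have "ieval A z = a" "ieval B z = b" by (simp_all add: A_def B_def zn pa pb)
    thus ?thesis using rel by (simp add: f_def e1 e2 e3 e4 power_add algebra_simps)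
  qed
  have conj: "b*(x1*x3)*((x1*x3)^m)^j + b*(x2*x4)*((x2*x4)^m)^j - a*(x1*x2)*((x1*x2)^m)^j - a*(x3*x4)*((x3*x4)^m)^j
     + (a-b)*(x1*x4)*((x1*x4)^m)^j + (a-b)*(x2*x3)*((x2*x3)^m)^j = 0"
    if j: "\<not> p dvd 1 + m * j" for j
  proof -
    have "coprime (1 + m * j) m"
      by (rule coprimeI) (metis dvd_add_left_iff dvd_mult2)
    moreover have "coprime (1 + m * j) p" using j p by (simp add: coprime_commute prime_imp_coprime)
    ultimately have "coprime (1 + m * j) Q" by (simp add: Q_def)
    hence *: "ieval f (z ^ (1 + m * j)) = 0"
      unfolding z_def using ieval_root_unity_conjugate[OF Q0 _ f0[unfolded z_def]] by blast
    have "(z ^ (1 + m * j)) ^ (p * c) = (z ^ (p * c)) ^ (1 + m * j)" by (simp only: power_mult[symmetric] mult.commute)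
    also have "\<dots> = root_unity n" using zn n(1) by (simp add: c power_add power_mult)
    finally have A': "ieval A (z ^ (1 + m * j)) = a" and B': "ieval B (z ^ (1 + m * j)) = b"
      by (simp_all add: A_def B_def pa pb)
    have M: "(z ^ (1 + m * j)) ^ e = z ^ e * ((z ^ e) ^ m) ^ j" for e
      by (simp flip: power_mult power_add add: algebra_simps)
    show ?thesis using * unfolding f_def e1 e2 e3 e4
      by (simp only: ieval_add ieval_diff ieval_mult ieval_monom of_int_1 mult_1 A' B' M power_add[symmetric])
         (simp add: mult.assoc)
  qed
  define Y :: "nat \<Rightarrow> complex" where "Y t = (if t = 0 then x1*x3 else if t = 1 then x2*x4 else if t = 2 then x1*x2
    else if t = 3 then x3*x4 else if t = 4 then x1*x4 else x2*x3)" for t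
  define w where "w t = (if t < 2 then b else if t < 4 then -a else a-b) * Y t" for t :: nat
  define K where "K t = Y t ^ m" for t
  have six: "(\<Sum>t<6. g t) = g 0 + g 1 + g 2 + g 3 + g 4 + g 5" for g :: "nat \<Rightarrow> complex"
    by (simp add: eval_nat_numeral)
  have Kp: "K t ^ p = 1" if "t < 6" for t
  proof -
    have "Y t ^ (p * m) = 1" using that xs unfolding Y_def
      by (auto simp: less_Suc_eq eval_nat_numeral power_mult_distrib)
    thus ?thesis by (simp add: K_def flip: power_mult) (simp add: mult.commute)
  qed
  \<comment> \<open>The exceptional mode. If \<open>p\<close> divides \<open>m\<close>, every
    \<open>j\<close> gives an admissible exponent, encoded by \<open>j0 = p\<close>; otherwise at
    most one \<open>j\<close> below \<open>p\<close> has \<open>m * j\<close> congruent to -1 modulo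
    \<open>p\<close>.\<close>
  obtain j0 where j0: "\<And>j. j < p \<Longrightarrow> j \<noteq> j0 \<Longrightarrow> \<not> p dvd 1 + m * j" "p dvd m \<Longrightarrow> j0 \<ge> p"
  proof (cases "p dvd m")
    case True
    have "\<not> p dvd 1 + m * j" for j
      using True p by (metis dvd_add_left_iff dvd_mult2 not_prime_unit)
    thus ?thesis using that[of p] by blast
  next
    case False
    show ?thesis
    proof (cases "\<exists>j<p. p dvd 1 + m * j")
      case True
      then obtain j0 where j0: "j0 < p" "p dvd 1 + m * j0" by blast
      have "\<not> p dvd 1 + m * j" if "j < p" "j \<noteq> j0" for j
      proof
        assume "p dvd 1 + m * j"
        hence "[1 + m * j = 1 + m * j0] (mod p)" using j0 by (simp add: cong_def dvd_imp_mod_0)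
        hence "[m * j = m * j0] (mod p)" by (simp only: cong_add_lcancel_nat)
        hence "[j = j0] (mod p)" using False p
          by (metis cong_mult_lcancel_nat coprime_commute prime_imp_coprime)
        thus False using that j0 by (simp add: cong_less_modulus_unique_nat)
      qed
      thus ?thesis using that[of j0] False by blast
    qed (use that[of 0] False in blast)
  qed
  have "(\<Sum>t<6. if K t = r then w t else 0) = 0"
  proof (rule fourier_classes[OF p0, where jx = j0])
    show "(\<Sum>t<6. w t * K t ^ j) = 0" if "j < p" "j \<noteq> j0" for j
      using conj[OF j0(1)[OF that]] by (simp add: six w_def K_def Y_def algebra_simps)
    show "p \<le> j0 \<or> (\<exists>r. r ^ p = 1 \<and> (\<Sum>t<6. if K t = r then w t else 0) = 0)"
    proof (cases "p dvd m")
      case False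
      let ?H = "{(x1*x3)^m, (x2*x4)^m, (x1*x2)^m, (x3*x4)^m, (x1*x4)^m, (x2*x3)^m}"
      have "card ?H < card {z::complex. z ^ p = 1}" using H False
        unfolding class_products_def power_mult_distrib[symmetric] by (simp add: card_unity[OF p0])
      hence "\<not> {z::complex. z ^ p = 1} \<subseteq> ?H" by (metis card_mono finite.emptyI finite.insertI not_le)
      then obtain s where s: "s ^ p = 1" "s \<notin> ?H" by blast
      hence "(\<Sum>t<6. if K t = s then w t else 0) = 0" by (auto simp: six K_def Y_def)
      thus ?thesis using s(1) by blast
    qed (use j0 in blast)
  qed (use Kp in auto)
  moreover have neg: "(if c then - y else 0) = - (if c then y else 0)" for c and y :: complex by simp
  ultimately show ?thesis
    unfolding class_sum_def power_mult_distrib[symmetric]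
    by (simp add: six w_def K_def Y_def mult.assoc neg cong: if_cong split del: if_split)
qed

text \<open>The class of \<open>x \<in> T\<close> is \<open>x\<^sup>m\<close>, a \<open>p\<close>-th root of unity. With three points in one class, or two in
  each of two classes, or (for \<open>p \<ge> 7\<close>) four distinct classes, some group of terms cannot vanish.\<close>
lemma unity_classes:
  assumes p: "prime p" and m: "m > 0" and n: "n > 0" "n dvd m" and odd: "odd p \<or> p dvd m"
    and T: "finite T" "\<And>x. x \<in> T \<Longrightarrow> x ^ (p * m) = 1" and cr: "cross_ratios_in (cyclotomic_int n) T"
    and card: "card T \<ge> 7" and x: "x \<in> T" and y: "y \<in> T"
  shows "x ^ m = y ^ m"
proof (rule ccontr)
  assume xy: "x ^ m \<noteq> y ^ m"
  have p2: "p \<ge> 2" using p by (rule prime_ge_2_nat)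
  define \<kappa> where "\<kappa> x = x ^ m" for x :: complex
  have \<kappa>p: "\<kappa> x ^ p = 1" if "x \<in> T" for x
    using T(2)[OF that] by (simp add: \<kappa>_def mult.commute flip: power_mult)
  have \<kappa>0: "\<kappa> x \<noteq> 0" if "x \<in> T" for x
    using \<kappa>p[OF that] p2 by (auto simp: zero_power)
  have x0: "x \<noteq> 0" if "x \<in> T" for x
    using \<kappa>0[OF that] m by (auto simp: \<kappa>_def zero_power)
  have rel: "\<exists>a b. a \<noteq> 0 \<and> b \<noteq> 0 \<and> b * ((x1 - x2) * (x3 - x4)) = a * ((x1 - x3) * (x2 - x4)) \<and>
      (p dvd m \<or> card (class_products \<kappa> x1 x2 x3 x4) < p \<longrightarrow> (\<forall>r. class_sum \<kappa> a b x1 x2 x3 x4 r = 0))"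
    if xs: "x1 \<in> T" "x2 \<in> T" "x3 \<in> T" "x4 \<in> T" "distinct [x1, x2, x3, x4]" for x1 x2 x3 x4
  proof -
    obtain a b where ab: "a \<in> cyclotomic_int n" "b \<in> cyclotomic_int n" "b \<noteq> 0"
      and r: "b * ((x1 - x2) * (x3 - x4)) = a * ((x1 - x3) * (x2 - x4))"
      using cr xs unfolding cross_ratios_in_def by blast
    have "a \<noteq> 0" using r ab(3) that(5) by auto
    moreover have \<kappa>: "\<kappa> = (\<lambda>x. x ^ m)" by (simp add: \<kappa>_def fun_eq_iff)
    ultimately show ?thesis
      using six_terms[OF p m n T(2) T(2) T(2) T(2) ab(1,2) r, OF xs(1-4), folded \<kappa>] ab(3) r by blast
  qed
  \<comment> \<open>Three points in one class draw every fourth point into it. Otherwise the class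
    of the products with \<open>x4\<close> gives \<open>b * (x1 - x2) = a * (x1 - x3)\<close>, and
    the cross ratio relation then yields \<open>x2 = x3\<close>.\<close>
  have Q1: "\<kappa> x4 = \<kappa> x1" if "x1 \<in> T" "x2 \<in> T" "x3 \<in> T" "x4 \<in> T" "distinct [x1, x2, x3]"
    and eq: "\<kappa> x2 = \<kappa> x1" "\<kappa> x3 = \<kappa> x1" for x1 x2 x3 x4
  proof (rule ccontr)
    assume ne: "\<kappa> x4 \<noteq> \<kappa> x1"
    have d: "distinct [x1, x2, x3, x4]" using that ne by auto
    from rel[OF that(1-4) d] obtain a b where a: "a \<noteq> 0" and b: "b \<noteq> 0" and r: "b * ((x1 - x2) * (x3 - x4)) = a * ((x1 - x3) * (x2 - x4))"
      and H: "p dvd m \<or> card (class_products \<kappa> x1 x2 x3 x4) < p \<longrightarrow> (\<forall>r. class_sum \<kappa> a b x1 x2 x3 x4 r = 0)"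
      by blast
    have "p dvd m \<or> card (class_products \<kappa> x1 x2 x3 x4) < p"
    proof (cases "p = 2")
      case False
      have "class_products \<kappa> x1 x2 x3 x4 = {\<kappa> x1*\<kappa> x1, \<kappa> x1*\<kappa> x4}"
        using eq by (auto simp: class_products_def)
      also have "card \<dots> \<le> 2" by (simp add: card_insert_if)
      finally show ?thesis using False p2 by simp
    qed (use odd in auto)
    from H[rule_format, OF this, of "\<kappa> x1 * \<kappa> x4"] have "b * x2 * x4 - a * x3 * x4 + (a - b) * x1 * x4 = 0"
      using eq ne \<kappa>0[OF that(1)] by (simp add: class_sum_def)
    hence "x4 * (b * (x1 - x2) - a * (x1 - x3)) = 0" by (simp add: algebra_simps)
    hence *: "b * (x1 - x2) = a * (x1 - x3)" using x0[OF that(4)] by simp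
    have "b * (x1 - x2) * (x3 - x4) = a * (x1 - x3) * (x2 - x4)" using r by (simp add: mult.assoc)
    hence "a * (x1 - x3) * (x3 - x4) = a * (x1 - x3) * (x2 - x4)" by (simp only: *)
    thus False using a d by simp
  qed
  have square: "k = l" if sq: "k ^ 2 = l ^ 2" "k ^ p = 1" "l ^ p = 1" "odd p" for k l :: complex
  proof -
    obtain q where "p = 2 * q + 1" using sq(4) by (elim oddE)
    hence "k * (k ^ 2) ^ q = l * (l ^ 2) ^ q" using that(2,3) by (simp add: power_mult)
    moreover have "l \<noteq> 0" using that(3) p2 by (auto simp: zero_power)
    ultimately show ?thesis using that(1) by simp
  qed
  \<comment> \<open>Two pairs in two different classes are impossible: the class of
    \<open>x1 * x2\<close> contains this product only, and its coefficient is not zero.\<close>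
  have Q2: "\<kappa> x3 = \<kappa> x1" if "x1 \<in> T" "x2 \<in> T" "x3 \<in> T" "x4 \<in> T" "x1 \<noteq> x2" "x3 \<noteq> x4"
    and eq: "\<kappa> x2 = \<kappa> x1" "\<kappa> x4 = \<kappa> x3" and p5: "p \<ge> 5" for x1 x2 x3 x4
  proof (rule ccontr)
    assume ne: "\<kappa> x3 \<noteq> \<kappa> x1"
    have d: "distinct [x1, x2, x3, x4]" using that ne by auto
    have "odd p" using prime_odd_nat[OF p] p5 by simp
    from rel[OF that(1-4) d] obtain a b where a: "a \<noteq> 0" and b: "b \<noteq> 0" and r: "b * ((x1 - x2) * (x3 - x4)) = a * ((x1 - x3) * (x2 - x4))"
      and H: "p dvd m \<or> card (class_products \<kappa> x1 x2 x3 x4) < p \<longrightarrow> (\<forall>r. class_sum \<kappa> a b x1 x2 x3 x4 r = 0)"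
      by blast
    have "card (class_products \<kappa> x1 x2 x3 x4) \<le> card {\<kappa> x1*\<kappa> x1, \<kappa> x1*\<kappa> x3, \<kappa> x3*\<kappa> x3}"
      unfolding class_products_def
      by (intro card_mono) (simp_all add: eq)
    also have "\<dots> \<le> 3" using card_length[of "[\<kappa> x1*\<kappa> x1, \<kappa> x1*\<kappa> x3, \<kappa> x3*\<kappa> x3]"] by simp
    finally have c: "p dvd m \<or> card (class_products \<kappa> x1 x2 x3 x4) < p"
      using p5 by simp
    have "\<kappa> x3 * \<kappa> x3 \<noteq> \<kappa> x1 * \<kappa> x1"
      using square[OF _ \<kappa>p[OF that(3)] \<kappa>p[OF that(1)] \<open>odd p\<close>] ne unfolding power2_eq_square by blast
    with H[rule_format, OF c, of "\<kappa> x1 * \<kappa> x1"] have "a * x1 * x2 = 0"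
      using eq ne \<kappa>0[OF that(1)] by (simp add: class_sum_def)
    thus False using a x0 that by simp
  qed
  \<comment> \<open>With four distinct classes a product can share its class only with the
    complementary product. Two such coincidences are forced, and together they make the squares of
    two classes equal.\<close>
  have Q3: "\<not> distinct [\<kappa> x1, \<kappa> x2, \<kappa> x3, \<kappa> x4]" if "x1 \<in> T" "x2 \<in> T" "x3 \<in> T" "x4 \<in> T"
    and p7: "p \<ge> 7" for x1 x2 x3 x4
  proof
    assume ne: "distinct [\<kappa> x1, \<kappa> x2, \<kappa> x3, \<kappa> x4]"
    have d: "distinct [x1, x2, x3, x4]" using ne by auto
    have ne': "\<kappa> x2 \<noteq> \<kappa> x1" "\<kappa> x3 \<noteq> \<kappa> x1" "\<kappa> x4 \<noteq> \<kappa> x1" "\<kappa> x3 \<noteq> \<kappa> x2" "\<kappa> x4 \<noteq> \<kappa> x2" "\<kappa> x4 \<noteq> \<kappa> x3"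
      using ne by auto
    have "odd p" using prime_odd_nat[OF p] p7 by simp
    from rel[OF that(1-4) d] obtain a b where a: "a \<noteq> 0" and b: "b \<noteq> 0" and r: "b * ((x1 - x2) * (x3 - x4)) = a * ((x1 - x3) * (x2 - x4))"
      and H: "p dvd m \<or> card (class_products \<kappa> x1 x2 x3 x4) < p \<longrightarrow> (\<forall>r. class_sum \<kappa> a b x1 x2 x3 x4 r = 0)"
      by blast
    have "card (class_products \<kappa> x1 x2 x3 x4) \<le> 6"
      using card_length[of "[\<kappa> x1*\<kappa> x3, \<kappa> x2*\<kappa> x4, \<kappa> x1*\<kappa> x2, \<kappa> x3*\<kappa> x4, \<kappa> x1*\<kappa> x4, \<kappa> x2*\<kappa> x3]"]
      by (simp add: class_products_def)
    hence c: "p dvd m \<or> card (class_products \<kappa> x1 x2 x3 x4) < p"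
      using p7 by linarith
    have e1: "\<kappa> x3 * \<kappa> x4 = \<kappa> x1 * \<kappa> x2"
    proof (rule ccontr)
      assume "\<kappa> x3 * \<kappa> x4 \<noteq> \<kappa> x1 * \<kappa> x2"
      with H[rule_format, OF c, of "\<kappa> x1 * \<kappa> x2"] have "a * x1 * x2 = 0"
        using ne ne' \<kappa>0 that by (simp add: class_sum_def)
      thus False using a x0 that by simp
    qed
    have e2: "\<kappa> x2 * \<kappa> x4 = \<kappa> x1 * \<kappa> x3"
    proof (rule ccontr)
      assume "\<kappa> x2 * \<kappa> x4 \<noteq> \<kappa> x1 * \<kappa> x3"
      with H[rule_format, OF c, of "\<kappa> x1 * \<kappa> x3"] have "b * x1 * x3 = 0"
        using ne ne' \<kappa>0 that by (simp add: class_sum_def)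
      thus False using b x0 that by simp
    qed
    have "(\<kappa> x1 * \<kappa> x4) * \<kappa> x3 ^ 2 = (\<kappa> x1 * \<kappa> x3) * (\<kappa> x3 * \<kappa> x4)" by (simp add: power2_eq_square)
    also have "\<dots> = (\<kappa> x2 * \<kappa> x4) * (\<kappa> x1 * \<kappa> x2)" by (simp only: e1 e2)
    also have "\<dots> = (\<kappa> x1 * \<kappa> x4) * \<kappa> x2 ^ 2" by (simp add: power2_eq_square)
    finally have "\<kappa> x3 ^ 2 = \<kappa> x2 ^ 2" using \<kappa>0 that by simp
    hence "\<kappa> x3 = \<kappa> x2" using square \<kappa>p that \<open>odd p\<close> by blast
    thus False using ne by simp
  qed
  have three: False if "x1 \<in> T" "x2 \<in> T" "x3 \<in> T" "distinct [x1, x2, x3]" "\<kappa> x2 = \<kappa> x1" "\<kappa> x3 = \<kappa> x1" for x1 x2 x3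
    using Q1[OF that(1-3) _ that(4-6)] x y xy by (metis \<kappa>_def)
  \<comment> \<open>The count: each class has at most two points, so \<open>p \<ge> 5\<close>; then
    at most one class has two, so seven points fill six classes, \<open>p \<ge> 7\<close>, and four
    distinct classes contradict \<open>Q3\<close>.\<close>
  have fiber: "card {x\<in>T. \<kappa> x = k} \<le> 2" for k
  proof (rule ccontr)
    assume "\<not> card {x\<in>T. \<kappa> x = k} \<le> 2"
    hence "3 \<le> card {x\<in>T. \<kappa> x = k}" by simp
    then obtain S where "S \<subseteq> {x\<in>T. \<kappa> x = k}" "card S = 3" by (metis obtain_subset_with_card_n)
    moreover from this obtain x1 x2 x3 where "S = {x1, x2, x3}" "x1 \<noteq> x2" "x2 \<noteq> x3" "x1 \<noteq> x3"
      using card_3_iff by (auto simp: card_3_iff)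
    ultimately show False using three[of x1 x2 x3] by auto
  qed
  have im: "\<kappa> ` T \<subseteq> {z. z ^ p = 1}" using \<kappa>p by auto
  have fin: "finite {z::complex. z ^ p = 1}" using p2 by (intro finite_roots_unity) auto
  have cim: "card (\<kappa> ` T) \<le> p" using card_mono[OF fin im] p2 by (simp add: card_unity)
  have "card T = (\<Sum>k\<in>\<kappa> ` T. card {x\<in>T. \<kappa> x = k})"
    using card_eq_sum[of T] sum.image_gen[OF T(1), of "\<lambda>_. 1::nat" \<kappa>] by simp
  also have "\<dots> \<le> (\<Sum>k\<in>\<kappa> ` T. 2)" by (intro sum_mono fiber)
  finally have "card T \<le> 2 * card (\<kappa> ` T)" by simp
  hence "p \<ge> 4" using card cim by linarith
  moreover have "p \<noteq> 4" using p prime_odd_nat[of 4] by auto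
  ultimately have p5: "p \<ge> 5" by simp
  have c6: "card (\<kappa> ` T) \<ge> 6"
  proof (cases "inj_on \<kappa> T")
    case True
    thus ?thesis using card by (simp add: card_image)
  next
    case False
    then obtain u v where uv: "u \<in> T" "v \<in> T" "u \<noteq> v" "\<kappa> v = \<kappa> u" unfolding inj_on_def by metis
    have "inj_on \<kappa> (T - {u})"
    proof (rule inj_onI, rule ccontr)
      fix s t assume st: "s \<in> T - {u}" "t \<in> T - {u}" "\<kappa> s = \<kappa> t" "s \<noteq> t"
      have "\<kappa> s = \<kappa> u" using Q2[of u v s t] st uv p5 by auto
      thus False using three[of u s t] st uv by auto
    qed
    hence "card (\<kappa> ` (T - {u})) = card T - 1" using uv T(1) by (simp add: card_image)
    moreover have "card (\<kappa> ` (T - {u})) \<le> card (\<kappa> ` T)" using T(1) by (intro card_mono) auto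
    ultimately show ?thesis using card by linarith
  qed
  hence "p \<ge> 6" using cim by linarith
  moreover have "p \<noteq> 6" using p prime_odd_nat[of 6] by auto
  ultimately have p7: "p \<ge> 7" by simp
  have "4 \<le> card (\<kappa> ` T)" using c6 by linarith
  then obtain S where S: "S \<subseteq> \<kappa> ` T" "card S = 4" by (metis obtain_subset_with_card_n)
  have "finite S" using S(2) by (metis card.infinite zero_neq_numeral)
  then obtain ks where ks: "set ks = S" "distinct ks" using finite_distinct_list by blast
  hence "length ks = 4" using S(2) distinct_card by fastforce
  then obtain k1 k2 k3 k4 where "ks = [k1, k2, k3, k4]"
    by (auto simp: numeral_eq_Suc length_Suc_conv)
  with ks S(1) have "distinct [k1, k2, k3, k4]" "k1 \<in> \<kappa> ` T" "k2 \<in> \<kappa> ` T" "k3 \<in> \<kappa> ` T" "k4 \<in> \<kappa> ` T"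
    by (auto simp del: distinct.simps image_iff)
  moreover from this obtain x1 where "k1 = \<kappa> x1" "x1 \<in> T" by blast
  moreover from calculation obtain x2 where "k2 = \<kappa> x2" "x2 \<in> T" by blast
  moreover from calculation obtain x3 where "k3 = \<kappa> x3" "x3 \<in> T" by blast
  moreover from calculation obtain x4 where "k4 = \<kappa> x4" "x4 \<in> T" by blast
  ultimately show False using Q3[OF _ _ _ _ p7] by blast
qed

lemma cross_ratios_in_divide:
  assumes "cross_ratios_in R T" "c \<noteq> 0"
  shows "cross_ratios_in R ((\<lambda>x. x / c) ` T)"
  unfolding cross_ratios_in_def
proof (intro ballI impI)
  fix y1 y2 y3 y4
  assume y: "y1 \<in> (\<lambda>x. x / c) ` T" "y2 \<in> (\<lambda>x. x / c) ` T" "y3 \<in> (\<lambda>x. x / c) ` T" "y4 \<in> (\<lambda>x. x / c) ` T"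
    and d: "distinct [y1, y2, y3, y4]"
  then obtain x1 x2 x3 x4 where x: "y1 = x1 / c" "y2 = x2 / c" "y3 = x3 / c" "y4 = x4 / c"
    "x1 \<in> T" "x2 \<in> T" "x3 \<in> T" "x4 \<in> T" by blast
  have "distinct [x1, x2, x3, x4]" using d assms(2) x by auto
  then obtain a b where ab: "a \<in> R" "b \<in> R" "b \<noteq> 0" "b * ((x1 - x2) * (x3 - x4)) = a * ((x1 - x3) * (x2 - x4))"
    using assms(1) x unfolding cross_ratios_in_def by blast
  have "b * ((y1 - y2) * (y3 - y4)) = b * ((x1 - x2) * (x3 - x4)) / c\<^sup>2"
    by (simp add: x diff_divide_distrib[symmetric] power2_eq_square)
  also have "\<dots> = a * ((y1 - y3) * (y2 - y4))"
    unfolding ab(4) by (simp add: x diff_divide_distrib[symmetric] power2_eq_square)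
  finally show "\<exists>a\<in>R. \<exists>b\<in>R. b \<noteq> 0 \<and> b * ((y1 - y2) * (y3 - y4)) = a * ((y1 - y3) * (y2 - y4))"
    using ab by blast
qed

text \<open>Induction on the common order \<open>Q\<close>. As long as \<open>Q\<close> does not
  divide \<open>lcm n 2\<close>, a prime \<open>p\<close> can be split off: all \<open>x ^ m\<close>
  agree by \<open>unity_classes\<close>, and dividing by one element moves the set into the
  \<open>m\<close>-th roots of unity without changing cross ratios.\<close>

theorem card_unity_cross_ratios:
  assumes "n > 0" "n dvd Q" "Q > 0" "finite T" "\<And>x. x \<in> T \<Longrightarrow> x ^ Q = 1"
    "cross_ratios_in (cyclotomic_int n) T" "card T \<ge> 7"
  shows "card T \<le> lcm n 2"
  using assms(2-)
proof (induction Q arbitrary: T rule: less_induct)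
  case (less Q)
  show ?case
  proof (cases "Q dvd lcm n 2")
    case True
    have "card T \<le> card {z::complex. z ^ Q = 1}"
      using less.prems by (intro card_mono finite_roots_unity) auto
    also have "\<dots> = Q" using less.prems by (intro card_unity) auto
    also have "\<dots> \<le> lcm n 2" using True assms(1) by (intro dvd_imp_le) (auto simp: lcm_pos_nat)
    finally show ?thesis .
  next
    case False
    obtain d where d: "Q = n * d" using less.prems(1) by (elim dvdE)
    have d0: "d > 0" using d less.prems by auto
    \<comment> \<open>An odd prime can always be split off, the prime 2 only if an even order
      remains. The one blocked situation is \<open>n\<close> odd and \<open>d = 2\<close>, but then
      \<open>Q\<close> is \<open>lcm n 2\<close> already.\<close>
    have "\<exists>p. prime p \<and> p dvd d \<and> (odd p \<or> even (n * (d div p)))"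
    proof (cases "\<exists>p. prime p \<and> p dvd d \<and> odd p")
      case no: False
      have "d \<noteq> 1" using False d by (auto simp: dvd_lcm1)
      then obtain q where q: "prime q" "q dvd d" by (metis prime_factor_nat)
      hence "even q" using no by blast
      hence "q = 2" using q(1) by (metis primes_dvd_imp_eq two_is_prime_nat)
      have "even (n * (d div 2))"
      proof (rule ccontr)
        assume o: "odd (n * (d div 2))"
        have "d div 2 = 1"
        proof (rule ccontr)
          assume "d div 2 \<noteq> 1"
          then obtain r where r: "prime r" "r dvd d div 2" by (metis prime_factor_nat)
          hence "r dvd d" using q \<open>q = 2\<close> by (metis dvd_mult_div_cancel dvd_mult)
          hence "even r" using no r by blast
          thus False using r(2) o by (metis dvd_mult dvd_trans)
        qed
        hence "d = 2" using q \<open>q = 2\<close> by auto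
        thus False using False o d by (simp add: lcm_coprime)
      qed
      thus ?thesis using q \<open>q = 2\<close> by blast
    qed blast
    then obtain p where p: "prime p" "p dvd d" "odd p \<or> even (n * (d div p))" by blast
    define m where "m = n * (d div p)"
    have Qm: "Q = p * m" using p(2) d by (simp add: m_def)
    have m0: "m > 0" using Qm less.prems by auto
    have "odd p \<or> p dvd m" using p(1,3) unfolding m_def
      by (metis primes_dvd_imp_eq two_is_prime_nat)
    obtain c where c: "c \<in> T" using less.prems by fastforce
    have c0: "c \<noteq> 0" using less.prems(2,4) c by (metis power_0_left zero_neq_one not_gr_zero)
    define T' where "T' = (\<lambda>x. x / c) ` T"
    have inj: "inj_on (\<lambda>x. x / c) T" using c0 by (auto simp: inj_on_def)
    have "x ^ m = c ^ m" if "x \<in> T" for x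
      by (rule unity_classes[OF p(1) m0 assms(1) _ \<open>odd p \<or> p dvd m\<close> less.prems(3) _ less.prems(5,6) that c])
         (use less.prems(4) Qm in \<open>auto simp: m_def\<close>)
    hence "y ^ m = 1" if "y \<in> T'" for y using that c0 by (auto simp: T'_def power_divide)
    moreover have "m < Q" using Qm m0 prime_gt_1_nat[OF p(1)] by simp
    moreover have "cross_ratios_in (cyclotomic_int n) T'"
      unfolding T'_def by (rule cross_ratios_in_divide[OF less.prems(5) c0])
    moreover have "card T' = card T" unfolding T'_def by (rule card_image[OF inj])
    ultimately have "card T' \<le> lcm n 2" using less.prems m0
      by (intro less.IH[of m]) (auto simp: T'_def m_def)
    thus ?thesis using \<open>card T' = card T\<close> by simp
  qed
qed

subsection \<open>Counting changes along the circle\<close>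

text \<open>Two disjoint \<open>2\<pi>\<close>-periodic discrete sets of angles; a change is a point whose predecessor lies in the other set.\<close>
definition changes :: "real set \<Rightarrow> real set \<Rightarrow> real set" where
  "changes P Q = {t. (t \<in> P \<and> (\<exists>s<t. s \<in> Q \<and> {s<..<t} \<inter> (P \<union> Q) = {})) \<or>
                     (t \<in> Q \<and> (\<exists>s<t. s \<in> P \<and> {s<..<t} \<inter> (P \<union> Q) = {}))}"

text \<open>The index of the angular block containing \<open>t\<close>, up to an additive constant.
  The floor makes each change of one period contribute a unit step at all its translates by
  multiples of \<open>2*pi\<close>, so the index is defined on the whole line.\<close>

definition change_count :: "real set \<Rightarrow> real set \<Rightarrow> real \<Rightarrow> int" where
  "change_count P Q t = (\<Sum>c\<in>changes P Q \<inter> {0..<2*pi}. \<lfloor>(t - c) / (2*pi)\<rfloor>)"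

text \<open>The number \<open>M\<close> of blocks in one turn.\<close>

definition change_period :: "real set \<Rightarrow> real set \<Rightarrow> int" where
  "change_period P Q = int (card (changes P Q \<inter> {0..<2*pi}))"

definition angle_sets :: "real set \<Rightarrow> real set \<Rightarrow> bool" where
  "angle_sets P Q \<longleftrightarrow> P \<inter> Q = {} \<and> P \<noteq> {} \<and> Q \<noteq> {} \<and>
     (\<forall>a b. finite (P \<inter> {a..b})) \<and> (\<forall>a b. finite (Q \<inter> {a..b})) \<and>
     (\<forall>t (k::int). t \<in> P \<longrightarrow> t + 2*pi * k \<in> P) \<and> (\<forall>t (k::int). t \<in> Q \<longrightarrow> t + 2*pi * k \<in> Q)"

lemma changes_commute: "changes P Q = changes Q P"
  by (auto simp: changes_def Un_commute)

lemma change_count_commute: "change_count P Q = change_count Q P"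
  by (simp add: change_count_def changes_commute fun_eq_iff)

lemma change_period_commute: "change_period P Q = change_period Q P"
  by (simp add: change_period_def changes_commute)

lemma angle_sets_commute: "angle_sets P Q \<Longrightarrow> angle_sets Q P"
  by (auto simp: angle_sets_def)

lemma changes_periodic:
  assumes "angle_sets P Q" "t \<in> changes P Q"
  shows "t + 2*pi * of_int k \<in> changes P Q"
proof -
  have per: "\<And>t k. t \<in> P \<Longrightarrow> t + 2*pi * of_int k \<in> P" "\<And>t k. t \<in> Q \<Longrightarrow> t + 2*pi * of_int k \<in> Q"
    using assms(1) by (auto simp: angle_sets_def)
  have empty: "{s + 2*pi * of_int k<..<t + 2*pi * of_int k} \<inter> (P \<union> Q) = {}"
    if "{s<..<t} \<inter> (P \<union> Q) = {}" for s t
  proof -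
    have "x - 2*pi * of_int k \<in> {s<..<t} \<inter> (P \<union> Q)"
      if "x \<in> {s + 2*pi * of_int k<..<t + 2*pi * of_int k} \<inter> (P \<union> Q)" for x
      using that per(1)[of x "-k"] per(2)[of x "-k"] by auto
    with that show ?thesis by blast
  qed
  have "\<exists>s'<t + 2*pi * of_int k. s' \<in> Y \<and> {s'<..<t + 2*pi * of_int k} \<inter> (P \<union> Q) = {}"
    if ex: "\<exists>s<t. s \<in> Y \<and> {s<..<t} \<inter> (P \<union> Q) = {}" and Y: "Y = P \<or> Y = Q" for Y
  proof -
    obtain s where "s < t" "s \<in> Y" "{s<..<t} \<inter> (P \<union> Q) = {}" using ex by blast
    thus ?thesis using Y per empty by (intro exI[of _ "s + 2*pi * of_int k"]) auto
  qed
  note shift = this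
  from assms(2) consider "t \<in> P" "\<exists>s<t. s \<in> Q \<and> {s<..<t} \<inter> (P \<union> Q) = {}"
    | "t \<in> Q" "\<exists>s<t. s \<in> P \<and> {s<..<t} \<inter> (P \<union> Q) = {}"
    unfolding changes_def by blast
  thus ?thesis
  proof cases
    case 1
    thus ?thesis unfolding changes_def using per(1)[of t k] shift[of Q] by simp
  next
    case 2
    thus ?thesis unfolding changes_def using per(2)[of t k] shift[of P] by simp
  qed
qed

lemma finite_changes:
  assumes "angle_sets P Q"
  shows "finite (changes P Q \<inter> {0..<2*pi})"
proof (rule finite_subset)
  show "changes P Q \<inter> {0..<2*pi} \<subseteq> (P \<inter> {0..2*pi}) \<union> (Q \<inter> {0..2*pi})"
    by (auto simp: changes_def)
  show "finite ((P \<inter> {0..2*pi}) \<union> (Q \<inter> {0..2*pi}))" using assms by (simp add: angle_sets_def)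
qed

lemma change_count_mono: "s \<le> t \<Longrightarrow> change_count P Q s \<le> change_count P Q t"
  unfolding change_count_def by (intro sum_mono floor_mono divide_right_mono) auto

lemma change_count_periodic:
  "change_count P Q (t + 2*pi * of_int k) = change_count P Q t + k * change_period P Q"
proof -
  have "\<lfloor>(t + 2*pi * of_int k - c) / (2*pi)\<rfloor> = \<lfloor>(t - c) / (2*pi)\<rfloor> + k" for c
  proof -
    have "(t + 2*pi * of_int k - c) / (2*pi) = (t - c) / (2*pi) + of_int k" by (simp add: field_simps)
    thus ?thesis by simp
  qed
  thus ?thesis by (simp add: change_count_def change_period_def sum.distrib)
qed

lemma change_count_const:
  assumes PQ: "angle_sets P Q" and st: "s \<le> t" and no: "changes P Q \<inter> {s<..t} = {}"
  shows "change_count P Q s = change_count P Q t"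
  unfolding change_count_def
proof (rule sum.cong)
  fix c assume c: "c \<in> changes P Q \<inter> {0..<2*pi}"
  define k where "k = \<lfloor>(t - c) / (2*pi)\<rfloor>"
  have "of_int k \<le> (t - c) / (2*pi)" unfolding k_def by simp
  hence "c + 2*pi * of_int k \<le> t" by (simp add: field_simps)
  moreover have "c + 2*pi * of_int k \<in> changes P Q" using c changes_periodic[OF PQ] by blast
  ultimately have "c + 2*pi * of_int k \<le> s" using no by force
  hence "of_int k \<le> (s - c) / (2*pi)" by (simp add: field_simps)
  hence "k \<le> \<lfloor>(s - c) / (2*pi)\<rfloor>" by (simp add: le_floor_iff)
  moreover have "\<lfloor>(s - c) / (2*pi)\<rfloor> \<le> k" unfolding k_def
    using st by (intro floor_mono divide_right_mono) auto
  ultimately show "\<lfloor>(s - c) / (2*pi)\<rfloor> = \<lfloor>(t - c) / (2*pi)\<rfloor>" by (simp add: k_def)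
qed simp

lemma change_representative:
  assumes PQ: "angle_sets P Q" and q: "q \<in> changes P Q"
  obtains c k where "c \<in> changes P Q \<inter> {0..<2*pi}" "q = c + 2*pi * of_int k"
proof -
  define k where "k = \<lfloor>q / (2*pi)\<rfloor>"
  have 1: "of_int k \<le> q / (2*pi)" "q / (2*pi) < of_int k + 1" unfolding k_def by linarith+
  have "q + 2*pi * of_int (-k) \<in> changes P Q" using q changes_periodic[OF PQ] by blast
  moreover have "0 \<le> q - 2*pi * of_int k" "q - 2*pi * of_int k < 2*pi" using 1 by (simp_all add: field_simps)
  ultimately show ?thesis by (intro that[of "q - 2*pi * of_int k" k]) auto
qed

lemma change_count_less:
  assumes PQ: "angle_sets P Q" and sq: "s < q" and q: "q \<in> changes P Q"
  shows "change_count P Q s < change_count P Q q"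
proof -
  obtain c k where ck: "c \<in> changes P Q \<inter> {0..<2*pi}" "q = c + 2*pi * of_int k"
    using change_representative[OF PQ q] .
  show ?thesis unfolding change_count_def
  proof (rule sum_strict_mono_ex1)
    show "finite (changes P Q \<inter> {0..<2*pi})" by (rule finite_changes[OF PQ])
    show "\<forall>x\<in>changes P Q \<inter> {0..<2*pi}. \<lfloor>(s - x) / (2*pi)\<rfloor> \<le> \<lfloor>(q - x) / (2*pi)\<rfloor>"
      using sq by (intro ballI floor_mono divide_right_mono) auto
    have "(s - c) / (2*pi) < of_int k" using sq ck by (simp add: field_simps)
    hence "\<lfloor>(s - c) / (2*pi)\<rfloor> < k" by (simp add: floor_less_iff)
    thus "\<exists>a\<in>changes P Q \<inter> {0..<2*pi}. \<lfloor>(s - a) / (2*pi)\<rfloor> < \<lfloor>(q - a) / (2*pi)\<rfloor>"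
      using ck by (intro bexI[of _ c]) auto
  qed
qed

text \<open>A window shorter than \<open>2*pi\<close> contains only one translate of the
  representative of \<open>q\<close>, and no translate of any other representative, so exactly one
  floor moves, by one.\<close>

lemma change_count_Suc:
  assumes PQ: "angle_sets P Q" and sq: "s < q" "q < s + 2*pi" and ch: "changes P Q \<inter> {s<..q} = {q}"
  shows "change_count P Q q = change_count P Q s + 1"
proof -
  have q: "q \<in> changes P Q" using ch by auto
  obtain c k where ck: "c \<in> changes P Q \<inter> {0..<2*pi}" "q = c + 2*pi * of_int k"
    using change_representative[OF PQ q] .
  have eq: "\<lfloor>(q - x) / (2*pi)\<rfloor> = \<lfloor>(s - x) / (2*pi)\<rfloor> + (if x = c then 1 else 0)"
    if x: "x \<in> changes P Q \<inter> {0..<2*pi}" for x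
  proof (cases "x = c")
    case True
    have "\<lfloor>(s - c) / (2*pi)\<rfloor> = k - 1"
      using sq ck by (intro floor_unique) (simp_all add: field_simps)
    thus ?thesis using True ck by simp
  next
    case False
    define j where "j = \<lfloor>(q - x) / (2*pi)\<rfloor>"
    have "of_int j \<le> (q - x) / (2*pi)" unfolding j_def by simp
    hence le: "x + 2*pi * of_int j \<le> q" by (simp add: field_simps)
    have "x + 2*pi * of_int j \<noteq> q"
    proof
      assume "x + 2*pi * of_int j = q"
      hence eq: "x - c = 2*pi * of_int (k - j)" using ck by (simp add: algebra_simps)
      have "\<bar>x - c\<bar> < 2*pi" using x ck by auto
      hence "2*pi*\<bar>of_int (k - j)\<bar> < 2*pi * (1::real)" unfolding eq by (simp add: abs_mult)
      hence "\<bar>of_int (k - j)\<bar> < (1::real)" by (subst (asm) mult_less_cancel_left_pos) auto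
      hence "k - j = 0" by linarith
      thus False using eq False by simp
    qed
    moreover have "x + 2*pi * of_int j \<in> changes P Q" using x changes_periodic[OF PQ] by blast
    ultimately have "x + 2*pi * of_int j \<le> s" using ch le by force
    hence "of_int j \<le> (s - x) / (2*pi)" by (simp add: field_simps)
    hence "j \<le> \<lfloor>(s - x) / (2*pi)\<rfloor>" by (simp add: le_floor_iff)
    moreover have "\<lfloor>(s - x) / (2*pi)\<rfloor> \<le> j" unfolding j_def
      using sq by (intro floor_mono divide_right_mono) auto
    ultimately show ?thesis using False by (simp add: j_def)
  qed
  have "change_count P Q q = (\<Sum>x\<in>changes P Q \<inter> {0..<2*pi}. \<lfloor>(s - x) / (2*pi)\<rfloor> + (if x = c then 1 else 0))"
    unfolding change_count_def by (intro sum.cong refl eq)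
  also have "\<dots> = change_count P Q s + 1"
    using ck finite_changes[OF PQ] by (simp add: sum.distrib change_count_def)
  finally show ?thesis .
qed

lemma same_side_change_count:
  assumes PQ: "angle_sets P Q" and st: "s \<le> t" and s: "s \<in> P" and no: "Q \<inter> {s..t} = {}"
  shows "change_count P Q s = change_count P Q t"
proof (rule change_count_const[OF PQ st])
  have "P \<inter> Q = {}" using PQ by (simp add: angle_sets_def)
  show "changes P Q \<inter> {s<..t} = {}"
  proof (rule ccontr)
    assume "changes P Q \<inter> {s<..t} \<noteq> {}"
    then obtain x where x: "x \<in> changes P Q" "s < x" "x \<le> t" by auto
    hence "x \<notin> Q" using no by auto
    then obtain r where r: "r < x" "r \<in> Q" "{r<..<x} \<inter> (P \<union> Q) = {}" using x by (auto simp: changes_def)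
    hence "s \<le> r" using s x by force
    thus False using r no x by auto
  qed
qed

text \<open>Take \<open>q\<close> as the first point of \<open>Q\<close> after \<open>s\<close> and
  \<open>p\<close> as the last point of \<open>P\<close> before \<open>q\<close>; both exist by
  local finiteness.\<close>

lemma change_between:
  assumes PQ: "angle_sets P Q" and st: "s < t" "s \<in> P" "t \<in> Q"
  obtains p q where "p \<in> P" "q \<in> Q" "s \<le> p" "p < q" "q \<le> t" "{p<..<q} \<inter> (P \<union> Q) = {}" "q \<in> changes P Q"
    "Q \<inter> {s..<q} = {}"
proof -
  have disj: "P \<inter> Q = {}" and fin: "\<And>a b. finite (P \<inter> {a..b})" "\<And>a b. finite (Q \<inter> {a..b})"
    using PQ by (auto simp: angle_sets_def)
  define q where "q = Min (Q \<inter> {s..t})"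
  have q: "q \<in> Q \<inter> {s..t}" unfolding q_def using fin st by (intro Min_in) auto
  have qmin: "q \<le> x" if "x \<in> Q \<inter> {s..t}" for x unfolding q_def using fin that by (intro Min_le) auto
  define p where "p = Max (P \<inter> {s..q})"
  have p: "p \<in> P \<inter> {s..q}" unfolding p_def using fin st q by (intro Max_in) auto
  have pmax: "x \<le> p" if "x \<in> P \<inter> {s..q}" for x unfolding p_def using fin that by (intro Max_ge) auto
  have "p \<noteq> q" using p q disj by auto
  have emp: "{p<..<q} \<inter> (P \<union> Q) = {}"
  proof (rule ccontr)
    assume "{p<..<q} \<inter> (P \<union> Q) \<noteq> {}"
    then obtain x where "p < x" "x < q" "x \<in> P \<union> Q" by (metis IntE ex_in_conv greaterThanLessThan_iff)
    thus False using pmax[of x] qmin[of x] p q by auto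
  qed
  have "Q \<inter> {s..<q} = {}"
  proof (rule ccontr)
    assume "Q \<inter> {s..<q} \<noteq> {}"
    then obtain x where "x \<in> Q" "s \<le> x" "x < q" by auto
    thus False using qmin[of x] q by auto
  qed
  moreover have "q \<in> changes P Q" using p q emp \<open>p \<noteq> q\<close> unfolding changes_def by force
  ultimately show ?thesis using p q \<open>p \<noteq> q\<close> by (intro that[OF _ _ _ _ _ emp]) auto
qed

lemma other_side_change_count_less:
  assumes PQ: "angle_sets P Q" and st: "s < t" "s \<in> P" "t \<in> Q"
  shows "change_count P Q s < change_count P Q t"
proof -
  obtain p q where pq: "s \<le> p" "p < q" "q \<le> t" "q \<in> changes P Q" using change_between[OF assms] by metis
  have "change_count P Q s \<le> change_count P Q p" using pq by (intro change_count_mono)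
  also have "\<dots> < change_count P Q q" using pq by (intro change_count_less[OF PQ])
  also have "\<dots> \<le> change_count P Q t" using pq by (intro change_count_mono)
  finally show ?thesis .
qed

text \<open>By the separation hypothesis the points of \<open>P\<close> in the interval all come
  before those of \<open>Q\<close>, so only one block boundary is crossed.\<close>

lemma single_change_change_count:
  assumes PQ: "angle_sets P Q" and st: "s < t" "s \<in> P" "t \<in> Q"
    and sep: "\<And>p q. p \<in> P \<Longrightarrow> q \<in> Q \<Longrightarrow> s \<le> q \<Longrightarrow> q < p \<Longrightarrow> p \<le> t \<Longrightarrow> False"
  shows "change_count P Q t = change_count P Q s + 1"
proof -
  have disj: "P \<inter> Q = {}" and per: "\<And>t k. t \<in> P \<Longrightarrow> t + 2*pi * of_int k \<in> P"
    using PQ by (auto simp: angle_sets_def)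
  obtain p q where pq: "p \<in> P" "q \<in> Q" "s \<le> p" "p < q" "q \<le> t" "{p<..<q} \<inter> (P \<union> Q) = {}" "q \<in> changes P Q"
    "Q \<inter> {s..<q} = {}"
    using change_between[OF PQ st] by metis
  have "change_count P Q s = change_count P Q p"
    by (rule same_side_change_count[OF PQ pq(3) st(2)]) (use pq in auto)
  moreover have "change_count P Q q = change_count P Q p + 1"
  proof (rule change_count_Suc[OF PQ pq(4)])
    show "q < p + 2*pi"
    proof (rule ccontr)
      assume "\<not> q < p + 2*pi"
      moreover have "p + 2*pi \<in> P" using per[OF pq(1), of 1] by simp
      moreover have "p + 2*pi \<noteq> q" using calculation(2) pq(2) disj by auto
      ultimately have "p + 2*pi \<in> {p<..<q} \<inter> (P \<union> Q)" by auto
      thus False using pq(6) by auto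
    qed
    show "changes P Q \<inter> {p<..q} = {q}" using pq(4,6,7) by (force simp: changes_def)
  qed
  moreover have P_empty: "P \<inter> {q..t} = {}"
  proof (rule ccontr)
    assume "P \<inter> {q..t} \<noteq> {}"
    then obtain p' where p': "p' \<in> P" "q \<le> p'" "p' \<le> t" by auto
    hence "q < p'" using pq(2) disj by (cases "q = p'") auto
    thus False using sep[OF p'(1) pq(2)] pq p' by auto
  qed
  moreover have "change_count Q P q = change_count Q P t"
    by (rule same_side_change_count[OF angle_sets_commute[OF PQ] pq(5,2)])
       (rule P_empty)
  ultimately show ?thesis by (simp add: change_count_commute)
qed

lemma change_period_pos:
  assumes PQ: "angle_sets P Q"
  shows "change_period P Q > 0"
proof -
  obtain s t where s: "s \<in> P" and t: "t \<in> Q" using PQ by (auto simp: angle_sets_def)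
  define k where "k = \<lceil>(s - t) / (2*pi)\<rceil> + 1"
  have "(s - t) / (2*pi) < of_int k" unfolding k_def by linarith
  hence less: "s < t + 2*pi * of_int k" by (simp add: field_simps)
  have "t + 2*pi * of_int k \<in> Q" using PQ t by (auto simp: angle_sets_def)
  then obtain q where "q \<in> changes P Q" using change_between[OF PQ less s] by metis
  then obtain c where "c \<in> changes P Q \<inter> {0..<2*pi}" using change_representative[OF PQ] by metis
  thus ?thesis unfolding change_period_def using finite_changes[OF PQ] by (auto simp: card_gt_0_iff)
qed

subsection \<open>Two separated point sets on parallel lines\<close>

text \<open>What remains of convexity: for the two differences of two convex subsets, moved to their
  common centroid, no point of one set lies in the hull of the other set and the centroid.\<close>

definition sep_from_origin :: "complex set \<Rightarrow> complex set \<Rightarrow> bool" where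
  "sep_from_origin A B \<longleftrightarrow> finite A \<and> finite B \<and> A \<noteq> {} \<and> B \<noteq> {} \<and>
     A \<inter> convex hull (insert 0 B) = {} \<and> B \<inter> convex hull (insert 0 A) = {}"

lemma sep_commute: "sep_from_origin A B \<Longrightarrow> sep_from_origin B A"
  by (auto simp: sep_from_origin_def)

lemma sep_linear_image:
  assumes "sep_from_origin A B" "linear f" "inj f"
  shows "sep_from_origin (f ` A) (f ` B)"
proof -
  have 0: "insert 0 (f ` S) = f ` (insert 0 S)" for S
    using linear_0[OF assms(2)] by simp
  have "convex hull (insert 0 (f ` S)) = f ` (convex hull (insert 0 S))" for S
    by (simp only: 0 convex_hull_linear_image[OF assms(2)])
  thus ?thesis using assms(1) unfolding sep_from_origin_def
    by (simp only: image_Int[OF assms(3), symmetric] finite_imageI image_is_empty) simp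
qed

lemma sep_nonzero: "sep_from_origin P Q \<Longrightarrow> x \<in> P \<Longrightarrow> x \<noteq> 0"
  unfolding sep_from_origin_def using hull_inc[of 0 "insert 0 Q" convex] by blast

lemma sep_disjoint: "sep_from_origin P Q \<Longrightarrow> P \<inter> Q = {}"
  unfolding sep_from_origin_def using hull_subset[of "insert 0 Q" convex] by blast

lemma combination_in_hull:
  assumes "x \<in> S" "y \<in> S" "\<alpha> \<ge> 0" "\<beta> \<ge> 0" "\<alpha> + \<beta> \<le> (1::real)"
  shows "\<alpha> *\<^sub>R x + \<beta> *\<^sub>R y \<in> convex hull (insert (0::complex) S)"
proof -
  have "\<alpha> *\<^sub>R x + \<beta> *\<^sub>R y = (1 - \<alpha> - \<beta>) *\<^sub>R 0 + \<alpha> *\<^sub>R x + \<beta> *\<^sub>R y" by simp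
  hence "\<alpha> *\<^sub>R x + \<beta> *\<^sub>R y \<in> convex hull {0, x, y}"
    unfolding convex_hull_3 using assms by (intro CollectI exI[of _ "1 - \<alpha> - \<beta>"] exI[of _ \<alpha>] exI[of _ \<beta>]) auto
  moreover have "convex hull {0, x, y} \<subseteq> convex hull (insert 0 S)"
    using assms by (intro hull_mono) auto
  ultimately show ?thesis by blast
qed

text \<open>\<open>Re / Im\<close> is the cotangent of the angle, so the two inequalities place
  \<open>z\<close> between the rays through \<open>x\<close> and \<open>y\<close>. As
  \<open>z\<close> is not higher than \<open>x\<close> and \<open>y\<close>, its level cuts the
  segments from 0 to \<open>x\<close> and to \<open>y\<close>, and \<open>z\<close> lies between the
  two cuts.\<close>

lemma triangle_in_hull:
  assumes xy: "x \<in> S" "y \<in> S" and z: "0 < Im z" "Im z \<le> Im x" "Im z \<le> Im y"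
    and xz: "Re z * Im x \<le> Re x * Im z" and zy: "Re y * Im z \<le> Re z * Im y"
  shows "z \<in> convex hull (insert 0 S)"
proof -
  define p where "p w = Re w / Im w" for w
  have pos: "Im x > 0" "Im y > 0" using z by auto
  have Rep: "Re w = p w * Im w" if "Im w > 0" for w using that by (simp add: p_def)
  have p: "p z \<le> p x" "p y \<le> p z" using xz zy pos z by (simp_all add: p_def field_simps)
  obtain l where l: "0 \<le> l" "l \<le> 1" "p z = l * p x + (1 - l) * p y"
  proof (cases "p x = p y")
    case True
    thus ?thesis using that[of 1] p by simp
  next
    case False
    hence pos': "p x - p y > 0" using p by simp
    define l where "l = (p z - p y) / (p x - p y)"
    have "l * (p x - p y) = p z - p y" using pos' by (simp add: l_def)
    hence "p z = l * p x + (1 - l) * p y" by (simp add: algebra_simps)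
    moreover have "0 \<le> l" "l \<le> 1" using p pos' by (simp_all add: l_def)
    ultimately show ?thesis using that by blast
  qed
  define \<alpha> where "\<alpha> = l * (Im z / Im x)"
  define \<beta> where "\<beta> = (1 - l) * (Im z / Im y)"
  have "Im z / Im x \<le> 1" "Im z / Im y \<le> 1" "0 < Im z / Im x" "0 < Im z / Im y" using z pos by auto
  hence \<alpha>: "0 \<le> \<alpha>" "\<alpha> \<le> l" and \<beta>: "0 \<le> \<beta>" "\<beta> \<le> 1 - l"
    unfolding \<alpha>_def \<beta>_def using l
    by (auto intro!: mult_nonneg_nonneg mult_left_le simp del: times_divide_eq_right)
  have "z = \<alpha> *\<^sub>R x + \<beta> *\<^sub>R y"
  proof (rule complex_eqI)
    show "Im z = Im (\<alpha> *\<^sub>R x + \<beta> *\<^sub>R y)" using pos by (simp add: \<alpha>_def \<beta>_def algebra_simps)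
    have "Re (\<alpha> *\<^sub>R x + \<beta> *\<^sub>R y) = l * p x * Im z + (1 - l) * p y * Im z"
      using pos by (simp add: \<alpha>_def \<beta>_def p_def mult_ac)
    also have "\<dots> = p z * Im z" by (simp add: l(3) algebra_simps)
    finally show "Re z = Re (\<alpha> *\<^sub>R x + \<beta> *\<^sub>R y)" using Rep[OF z(1)] by simp
  qed
  thus ?thesis using combination_in_hull[OF xy \<alpha>(1) \<beta>(1)] \<alpha>(2) \<beta>(2) by simp
qed

lemma between_in_hull:
  assumes xy: "x \<in> S" "y \<in> S" and z: "Im x = Im z" "Im y = Im z" "Re x \<le> Re z" "Re z \<le> Re y"
  shows "z \<in> convex hull (insert 0 S)"
proof -
  obtain l where l: "0 \<le> l" "l \<le> 1" "Re z = l * Re x + (1 - l) * Re y"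
  proof (cases "Re x = Re y")
    case True
    thus ?thesis using that[of 1] z by simp
  next
    case False
    hence pos: "Re y - Re x > 0" using z by simp
    define l where "l = (Re y - Re z) / (Re y - Re x)"
    have "l * (Re y - Re x) = Re y - Re z" using pos by (simp add: l_def)
    hence "Re z = l * Re x + (1 - l) * Re y" by (simp add: algebra_simps)
    moreover have "0 \<le> l" "l \<le> 1" using z pos by (simp_all add: l_def)
    ultimately show ?thesis using that by blast
  qed
  have "z = l *\<^sub>R x + (1 - l) *\<^sub>R y"
    using l z by (simp add: complex_eq_iff algebra_simps)
  thus ?thesis using combination_in_hull[OF xy, of l "1 - l"] l by simp
qed

section \<open>Angular order of the points at the right and left of horizontal lines\<close>

text \<open>Stated for horizontal lines only; \<open>rot\<close> brings other directions into this
  position. Such a point need not be the last one on its line.\<close>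

definition right_in :: "complex set \<Rightarrow> complex set \<Rightarrow> complex \<Rightarrow> bool" where
  "right_in P Q x \<longleftrightarrow> x \<in> P \<and> (\<exists>y\<in>Q. Im y = Im x \<and> Re y < Re x)"

definition left_in :: "complex set \<Rightarrow> complex set \<Rightarrow> complex \<Rightarrow> bool" where
  "left_in P Q x \<longleftrightarrow> x \<in> P \<and> (\<exists>y\<in>Q. Im y = Im x \<and> Re x < Re y)"

text \<open>On one line the sets cannot interlock: the one of \<open>x\<close> and \<open>y\<close>
  further to the left would lie between two points of the other set.\<close>

lemma right_same_line:
  assumes sep: "sep_from_origin P Q" and x: "right_in P Q x" and y: "right_in Q P y"
  shows "Im x \<noteq> Im y"
proof
  assume eq: "Im x = Im y"
  obtain b where b: "b \<in> Q" "Im b = Im x" "Re b < Re x" and x: "x \<in> P" using x by (auto simp: right_in_def)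
  obtain a where a: "a \<in> P" "Im a = Im y" "Re a < Re y" and y: "y \<in> Q" using y by (auto simp: right_in_def)
  show False
  proof (cases "Re x \<le> Re y")
    case True
    have "x \<in> convex hull (insert 0 Q)" by (rule between_in_hull[OF b(1) y]) (use b eq True in auto)
    thus False using sep x by (auto simp: sep_from_origin_def)
  next
    case False
    have "y \<in> convex hull (insert 0 P)" by (rule between_in_hull[OF a(1) x]) (use a eq False in auto)
    thus False using sep y by (auto simp: sep_from_origin_def)
  qed
qed

text \<open>Otherwise \<open>x\<close> would lie on the segment from the origin to the point of
  \<open>Q\<close> on its left.\<close>

lemma right_real_pos:
  assumes sep: "sep_from_origin P Q" and x: "right_in P Q x" "Im x = 0"
  shows "Re x > 0"
proof (rule ccontr)
  assume "\<not> Re x > 0"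
  obtain b where b: "b \<in> Q" "Im b = Im x" "Re b < Re x" and xP: "x \<in> P" using x by (auto simp: right_in_def)
  have "x = (Re x / Re b) *\<^sub>R b + 0 *\<^sub>R b"
    using b x \<open>\<not> Re x > 0\<close> by (simp add: complex_eq_iff)
  also have "\<dots> \<in> convex hull (insert 0 Q)"
    using b \<open>\<not> Re x > 0\<close> by (intro combination_in_hull) (auto simp: divide_simps)
  finally show False using sep xP by (auto simp: sep_from_origin_def)
qed

lemma left_real_neg:
  assumes sep: "sep_from_origin P Q" and x: "left_in P Q x" "Im x = 0"
  shows "Re x < 0"
proof (rule ccontr)
  assume "\<not> Re x < 0"
  obtain b where b: "b \<in> Q" "Im b = Im x" "Re x < Re b" and xP: "x \<in> P" using x by (auto simp: left_in_def)
  have "x = (Re x / Re b) *\<^sub>R b + 0 *\<^sub>R b"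
    using b x \<open>\<not> Re x < 0\<close> by (simp add: complex_eq_iff)
  also have "\<dots> \<in> convex hull (insert 0 Q)"
    using b \<open>\<not> Re x < 0\<close> by (intro combination_in_hull) (auto simp: divide_simps)
  finally show False using sep xP by (auto simp: sep_from_origin_def)
qed

text \<open>Otherwise \<open>b\<close> would lie in the triangle formed by the origin,
  \<open>a\<close> and the point \<open>a'\<close> of \<open>P\<close> to the left of
  \<open>b\<close>.\<close>

lemma right_upper_order:
  assumes sep: "sep_from_origin P Q" and a: "right_in P Q a" and b: "right_in Q P b"
    and im: "0 < Im b" "Im b < Im a"
  shows "Re a * Im b < Re b * Im a"
proof (rule ccontr)
  assume n: "\<not> Re a * Im b < Re b * Im a"
  obtain a' where a': "a' \<in> P" "Im a' = Im b" "Re a' < Re b" and bQ: "b \<in> Q" using b by (auto simp: right_in_def)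
  have aP: "a \<in> P" using a by (simp add: right_in_def)
  have "b \<in> convex hull (insert 0 P)"
    by (rule triangle_in_hull[OF aP a'(1)]) (use im n a' in auto)
  thus False using sep bQ by (auto simp: sep_from_origin_def)
qed

text \<open>If \<open>y\<close> did not come later in angle, the lower one of \<open>x\<close> and
  \<open>y\<close> would lie in a triangle formed by the origin and two points of the other set,
  chosen among \<open>x\<close>, \<open>y\<close> and their partners \<open>x'\<close>,
  \<open>y'\<close>.\<close>

lemma right_left_upper:
  assumes sep: "sep_from_origin P Q" and x: "right_in P Q x" and y: "left_in P Q y \<or> left_in Q P y"
    and im: "0 < Im x" "0 < Im y"
  shows "Re y * Im x < Re x * Im y"
proof (rule ccontr)
  assume n: "\<not> Re y * Im x < Re x * Im y"
  obtain x' where x': "x' \<in> Q" "Im x' = Im x" "Re x' < Re x" and xP: "x \<in> P" using x by (auto simp: right_in_def)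
  have mono: "u * v \<le> w * v" if "u < w" "v > 0" for u v w :: real using that by (intro mult_right_mono) auto
  have "Re x' * Im y \<le> Re x * Im y" using x' im by (intro mono)
  hence sx: "Re x' * Im y \<le> Re y * Im x" using n by linarith
  from y show False
  proof
    assume "left_in P Q y"
    then obtain y' where y': "y' \<in> Q" "Im y' = Im y" "Re y < Re y'" and yP: "y \<in> P" by (auto simp: left_in_def)
    have "Re y * Im x \<le> Re y' * Im x" using y' im by (intro mono)
    hence sy: "Re x * Im y \<le> Re y' * Im x" using n by linarith
    show False
    proof (cases "Im x \<le> Im y")
      case True
      have "x \<in> convex hull (insert 0 Q)"
        by (rule triangle_in_hull[OF y'(1) x'(1)]) (use im n True x' y' sx sy in \<open>auto intro: mono\<close>)
      thus False using sep xP by (auto simp: sep_from_origin_def)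
    next
      case False
      have "y \<in> convex hull (insert 0 Q)"
        by (rule triangle_in_hull[OF y'(1) x'(1)]) (use im n False x' y' sx sy in \<open>auto intro: mono\<close>)
      thus False using sep yP by (auto simp: sep_from_origin_def)
    qed
  next
    assume "left_in Q P y"
    then obtain y' where y': "y' \<in> P" "Im y' = Im y" "Re y < Re y'" and yQ: "y \<in> Q" by (auto simp: left_in_def)
    have "Re y * Im x \<le> Re y' * Im x" using y' im by (intro mono)
    hence sy: "Re x * Im y \<le> Re y' * Im x" using n by linarith
    show False
    proof (cases "Im x \<le> Im y")
      case True
      have "x \<in> convex hull (insert 0 Q)"
        by (rule triangle_in_hull[OF yQ x'(1)]) (use im n True x' y' sx sy in \<open>auto intro: mono\<close>)
      thus False using sep xP by (auto simp: sep_from_origin_def)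
    next
      case False
      have "y \<in> convex hull (insert 0 P)"
        by (rule triangle_in_hull[OF y'(1) xP]) (use im n False x' y' sx sy in \<open>auto intro: mono\<close>)
      thus False using sep yQ by (auto simp: sep_from_origin_def)
    qed
  qed
qed

lemma Im_rcis_Arg: "Im z = cmod z * sin (Arg z)"
  by (metis rcis_cmod_Arg Im_rcis)

lemma Re_rcis_Arg: "Re z = cmod z * cos (Arg z)"
  by (metis rcis_cmod_Arg Re_rcis)

lemma Arg_upper: "Im z > 0 \<Longrightarrow> 0 < Arg z \<and> Arg z < pi"
  using Arg_lt_pi by blast

lemma Arg_lower: "Im z < 0 \<Longrightarrow> Arg z < 0"
  using Arg_less_0 by (meson not_le)

lemma Arg_nonneg: "Im z \<ge> 0 \<Longrightarrow> Arg z \<ge> 0"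
  using Arg_less_0 by blast

lemma Arg_cnj_lower: "Im z \<noteq> 0 \<Longrightarrow> Arg (cnj z) = - Arg z"
proof -
  assume z: "Im z \<noteq> 0"
  hence z0: "z \<noteq> 0" by auto
  show ?thesis
  proof (rule cis_Arg_unique)
    show "sgn (cnj z) = cis (- Arg z)"
      using cis_Arg[OF z0] by (simp add: sgn_eq cis_cnj[symmetric])
    have "Arg z \<noteq> pi" using z by (simp add: Arg_eq_pi)
    thus "- pi < - Arg z" "- Arg z \<le> pi" using Arg_bounded[of z] by auto
  qed
qed

lemma Arg_upper_less:
  assumes "Im x > 0" "Im y > 0"
  shows "Arg x < Arg y \<longleftrightarrow> Re y * Im x < Re x * Im y"
proof -
  have x: "cmod x > 0" and y: "cmod y > 0" using assms by auto
  have "Re x * Im y - Re y * Im x = cmod x * cmod y * sin (Arg y - Arg x)"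
    by (subst (1 2) Im_rcis_Arg, subst (1 2) Re_rcis_Arg) (simp add: sin_diff algebra_simps)
  hence "Re y * Im x < Re x * Im y \<longleftrightarrow> 0 < cmod x * cmod y * sin (Arg y - Arg x)" by linarith
  also have "\<dots> \<longleftrightarrow> sin (Arg y - Arg x) > 0" using x y 
    by (meson mult_pos_pos zero_less_mult_pos)
  also have "\<dots> \<longleftrightarrow> Arg y - Arg x > 0"
  proof
    assume *: "sin (Arg y - Arg x) > 0"
    show "Arg y - Arg x > 0"
    proof (rule ccontr)
      assume "\<not> Arg y - Arg x > 0"
      hence "sin (Arg x - Arg y) \<ge> 0"
        using Arg_upper[OF assms(1)] Arg_upper[OF assms(2)] by (intro sin_ge_zero) auto
      moreover have "sin (Arg x - Arg y) = - sin (Arg y - Arg x)" by (metis minus_diff_eq sin_minus)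
      ultimately show False using * by simp
    qed
  next
    assume "Arg y - Arg x > 0"
    thus "sin (Arg y - Arg x) > 0"
      using Arg_upper[OF assms(1)] Arg_upper[OF assms(2)] by (intro sin_gt_zero) auto
  qed
  finally show ?thesis by simp
qed

lemma sep_cnj: "sep_from_origin P Q \<Longrightarrow> sep_from_origin (cnj ` P) (cnj ` Q)"
  by (rule sep_linear_image) (auto simp: inj_on_def intro!: bounded_linear.linear bounded_linear_cnj)

lemma right_in_cnj: "right_in P Q x \<Longrightarrow> right_in (cnj ` P) (cnj ` Q) (cnj x)"
  by (auto simp: right_in_def)

lemma left_in_cnj: "left_in P Q x \<Longrightarrow> left_in (cnj ` P) (cnj ` Q) (cnj x)"
  by (auto simp: left_in_def)

text \<open>Extends the comparison from the upper half-plane to all heights: conjugation reverses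
  both heights and angles, and a right point on the real axis has angle 0.\<close>

lemma right_Arg_less:
  assumes sep: "sep_from_origin P Q" and a: "right_in P Q a" and b: "right_in Q P b" and im: "Im b < Im a"
  shows "Arg b < Arg a"
proof -
  consider "0 < Im b" | "Im b \<le> 0" "0 \<le> Im a" | "Im a < 0" by linarith
  thus ?thesis
  proof cases
    case 1
    thus ?thesis using right_upper_order[OF sep a b 1 im] im by (simp add: Arg_upper_less)
  next
    case 2
    show ?thesis
    proof (cases "Im b < 0")
      case True
      thus ?thesis using Arg_lower[OF True] Arg_nonneg[OF 2(2)] by simp
    next
      case False
      hence b0: "Im b = 0" using 2 by simp
      hence "Re b > 0" using right_real_pos[OF sep_commute[OF sep] b] by simp
      hence "b = of_real (Re b)" using b0 by (simp add: complex_eq_iff)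
      hence "Arg b = 0" using \<open>Re b > 0\<close> by (metis Arg_of_real not_less_iff_gr_or_eq)
      thus ?thesis using Arg_upper[of a] im b0 by simp
    qed
  next
    case 3
    have "Arg (cnj a) < Arg (cnj b)"
      using right_upper_order[OF sep_cnj[OF sep_commute[OF sep]] right_in_cnj[OF b] right_in_cnj[OF a]] 3 im
      by (simp add: Arg_upper_less)
    thus ?thesis using 3 im by (simp add: Arg_cnj_lower)
  qed
qed

text \<open>For both sets at once, the right points fill an arc around angle 0 and the left points
  the complementary arc around \<open>pi\<close>.\<close>

lemma right_left_Arg:
  assumes sep: "sep_from_origin P Q" and x: "right_in P Q x" and y: "left_in P Q y \<or> left_in Q P y"
  shows "if Im y \<ge> 0 then Arg x < Arg y else Arg y < Arg x"
proof -
  consider "Im y = 0" | "Im y > 0" "Im x \<le> 0" | "Im y > 0" "Im x > 0" | "Im y < 0" "Im x \<ge> 0" | "Im y < 0" "Im x < 0"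
    by linarith
  thus ?thesis
  proof cases
    case 1
    hence "Re y < 0" using left_real_neg sep sep_commute y by blast
    hence "Arg y = pi" using 1 by (simp add: Arg_eq_pi)
    moreover have "Arg x \<noteq> pi" using right_real_pos[OF sep x] by (auto simp: Arg_eq_pi)
    ultimately show ?thesis using 1 Arg_bounded[of x] by simp
  next
    case 2
    have "Arg x \<le> 0"
    proof (cases "Im x = 0")
      case True
      hence "Re x > 0" using right_real_pos[OF sep x] by simp
      hence "x = of_real (Re x)" using True by (simp add: complex_eq_iff)
      thus ?thesis using \<open>Re x > 0\<close> by (metis Arg_of_real not_less_iff_gr_or_eq order_refl)
    next
      case False
      thus ?thesis using 2 Arg_lower[of x] by simp
    qed
    thus ?thesis using Arg_upper[OF 2(1)] 2 by simp
  next
    case 3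
    thus ?thesis using right_left_upper[OF sep x y 3(2,1)] by (simp add: Arg_upper_less)
  next
    case 4
    thus ?thesis using Arg_lower[of y] Arg_nonneg[of x] by simp
  next
    case 5
    have "left_in (cnj ` P) (cnj ` Q) (cnj y) \<or> left_in (cnj ` Q) (cnj ` P) (cnj y)"
      using y left_in_cnj by blast
    from right_left_upper[OF sep_cnj[OF sep] right_in_cnj[OF x] this] 5
    have "Arg (cnj x) < Arg (cnj y)" by (simp add: Arg_upper_less)
    thus ?thesis using 5 by (simp add: Arg_cnj_lower)
  qed
qed

definition line_paired :: "complex set \<Rightarrow> complex set \<Rightarrow> bool" where
  "line_paired P Q \<longleftrightarrow> (\<forall>x\<in>P. \<exists>y\<in>Q. Im y = Im x) \<and> (\<forall>y\<in>Q. \<exists>x\<in>P. Im x = Im y)"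

lemma line_paired_commute: "line_paired P Q \<Longrightarrow> line_paired Q P"
  by (auto simp: line_paired_def)

lemma right_or_left:
  assumes "sep_from_origin P Q" "line_paired P Q" "x \<in> P"
  shows "right_in P Q x \<or> left_in P Q x"
proof -
  obtain y where y: "y \<in> Q" "Im y = Im x" using assms by (auto simp: line_paired_def)
  hence "Re y \<noteq> Re x" using sep_disjoint[OF assms(1)] assms(3) by (metis complex_eqI disjoint_iff)
  hence "Re y < Re x \<or> Re x < Re y" by linarith
  thus ?thesis using y assms(3) unfolding right_in_def left_in_def by blast
qed

lemma between_right_is_right:
  assumes sep: "sep_from_origin P Q" and pair: "line_paired P Q" and z: "z \<in> P"
    and x: "right_in P Q x \<or> right_in Q P x" and y: "right_in P Q y \<or> right_in Q P y"
    and le: "Arg x \<le> Arg z" "Arg z \<le> Arg y"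
  shows "right_in P Q z"
proof (rule ccontr)
  assume "\<not> right_in P Q z"
  hence l: "left_in P Q z" using right_or_left[OF sep pair z] by blast
  have "if Im z \<ge> 0 then Arg w < Arg z else Arg z < Arg w" if "right_in P Q w \<or> right_in Q P w" for w
    using that right_left_Arg[OF sep _ disjI1[OF l]] right_left_Arg[OF sep_commute[OF sep] _ disjI2[OF l]] by blast
  from this[OF x] this[OF y] le show False by (auto split: if_splits)
qed

text \<open>A point \<open>z\<close> of \<open>Q\<close> between them in angle would be a right
  point above both or below both, and \<open>right_Arg_less\<close> would then put its angle outside
  the interval.\<close>

lemma no_between_same:
  assumes sep: "sep_from_origin P Q" and pair: "line_paired P Q"
    and x: "right_in P Q x" and y: "right_in P Q y" and h: "Im x \<le> Im y"
    and no: "\<And>w. w \<in> P \<union> Q \<Longrightarrow> Im x < Im w \<Longrightarrow> Im w < Im y \<Longrightarrow> False"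
    and z: "z \<in> Q" and bet: "min (Arg x) (Arg y) \<le> Arg z" "Arg z \<le> max (Arg x) (Arg y)"
  shows False
proof -
  have rz: "right_in Q P z"
  proof (cases "Arg x \<le> Arg y")
    case True
    show ?thesis
      by (rule between_right_is_right[OF sep_commute[OF sep] line_paired_commute[OF pair] z, of x y])
         (use x y bet True in auto)
  next
    case False
    show ?thesis
      by (rule between_right_is_right[OF sep_commute[OF sep] line_paired_commute[OF pair] z, of y x])
         (use x y bet False in auto)
  qed
  have ne: "Im z \<noteq> Im x" "Im z \<noteq> Im y"
    using right_same_line[OF sep x rz] right_same_line[OF sep y rz] by auto
  consider "Im z < Im x" | "Im y < Im z" using ne no[of z] z by force
  thus False
  proof cases
    case 1
    thus False using right_Arg_less[OF sep x rz] right_Arg_less[OF sep y rz] h bet by auto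
  next
    case 2
    thus False using right_Arg_less[OF sep_commute[OF sep] rz x] right_Arg_less[OF sep_commute[OF sep] rz y] h bet by auto
  qed
qed

text \<open>Adjacency of the levels leaves \<open>q\<close> at or above the level of
  \<open>y\<close> and \<open>p\<close> at or below that of \<open>x\<close>. As right points of
  opposite sets they must then have the reverse angular order.\<close>

lemma no_switch_different:
  assumes sep: "sep_from_origin P Q" and pair: "line_paired P Q"
    and x: "right_in P Q x" and y: "right_in Q P y" and h: "Im x < Im y"
    and no: "\<And>w. w \<in> P \<union> Q \<Longrightarrow> Im x < Im w \<Longrightarrow> Im w < Im y \<Longrightarrow> False"
    and p: "p \<in> P" and q: "q \<in> Q" and bet: "Arg x \<le> Arg q" "Arg q < Arg p" "Arg p \<le> Arg y"
  shows False
proof -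
  have rq: "right_in Q P q"
    by (rule between_right_is_right[OF sep_commute[OF sep] line_paired_commute[OF pair] q, of x y])
       (use x y bet in auto)
  have rp: "right_in P Q p"
    by (rule between_right_is_right[OF sep pair p, of x y]) (use x y bet in auto)
  have "Im q > Im x"
    using right_same_line[OF sep x rq] right_Arg_less[OF sep x rq] bet by force
  hence 1: "Im q \<ge> Im y" using no[of q] q by force
  have "Im p < Im y"
    using right_same_line[OF sep rp y] right_Arg_less[OF sep rp y] bet by force
  hence 2: "Im p \<le> Im x" using no[of p] p by force
  have "Arg p < Arg q" using right_Arg_less[OF sep_commute[OF sep] rq rp] 1 2 h by simp
  thus False using bet by simp
qed

section \<open>The block index along successive parallel lines\<close>

definition angles :: "complex set \<Rightarrow> real set" where
  "angles A = {t. \<exists>x\<in>A. x \<noteq> 0 \<and> sgn x = cis t}"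

lemma cis_eq_obtain:
  assumes "cis s = cis t"
  obtains k :: int where "s = t + 2 * pi * of_int k"
proof -
  have "cis (s - t) = 1" using assms by (simp flip: cis_divide)
  hence "cos (s - t) = 1" by (simp add: complex_eq_iff)
  then obtain k :: int where "s - t = of_int k * 2 * pi" using cos_one_2pi_int by blast
  thus ?thesis using that[of k] by (simp add: algebra_simps)
qed

lemma cis_add_period: "cis (t + 2 * pi * of_int k) = cis t"
  by (simp flip: cis_mult add: cis_multiple_2pi)

text \<open>Disjointness is the geometric point: if points of both sets were on one ray from the
  origin, the nearer one would lie on the segment from 0 to the other.\<close>

lemma angles_angle_sets:
  assumes sep: "sep_from_origin A B"
  shows "angle_sets (angles A) (angles B)"
proof -
  have per: "t + 2 * pi * of_int k \<in> angles S" if "t \<in> angles S" for t S and k :: int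
    using that by (simp add: angles_def cis_add_period)
  have ne: "angles S \<noteq> {}" if "sep_from_origin S S'" for S S'
  proof -
    obtain x where x: "x \<in> S" using \<open>sep_from_origin S S'\<close> by (auto simp: sep_from_origin_def)
    have x0: "x \<noteq> 0" using sep_nonzero \<open>sep_from_origin S S'\<close> x by blast
    hence "Arg x \<in> angles S" using x by (auto simp: angles_def cis_Arg)
    thus ?thesis by blast
  qed
  have fin: "finite (angles S \<inter> {a..b})" if "finite S" for S a b
  proof -
    define I where "I = {\<lfloor>(a - pi) / (2*pi)\<rfloor>..\<lceil>(b + pi) / (2*pi)\<rceil>}"
    have "angles S \<inter> {a..b} \<subseteq> (\<lambda>(x, k). Arg x + 2 * pi * of_int k) ` (S \<times> I)"
    proof
      fix t assume "t \<in> angles S \<inter> {a..b}"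
      then obtain x where x: "x \<in> S" "x \<noteq> 0" "sgn x = cis t" and t: "a \<le> t" "t \<le> b" by (auto simp: angles_def)
      hence "cis t = cis (Arg x)" by (simp add: cis_Arg)
      then obtain k :: int where k: "t = Arg x + 2 * pi * of_int k" by (rule cis_eq_obtain)
      have "(a - pi) / (2*pi) \<le> of_int k" "of_int k \<le> (b + pi) / (2*pi)"
        using Arg_bounded[of x] k t by (auto simp: field_simps)
      hence "k \<in> I" unfolding I_def by (auto intro: le_floor_iff[THEN iffD1]) linarith+
      thus "t \<in> (\<lambda>(x, k). Arg x + 2 * pi * of_int k) ` (S \<times> I)" using x k by force
    qed
    thus ?thesis by (rule finite_subset) (simp add: I_def that)
  qed
  have disj: "angles A \<inter> angles B = {}"
  proof (rule ccontr)
    assume "angles A \<inter> angles B \<noteq> {}"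
    then obtain t where "t \<in> angles A" "t \<in> angles B" by blast
    then obtain a b where "a \<in> A" "b \<in> B" "a \<noteq> 0" "b \<noteq> 0" "sgn a = cis t" "sgn b = cis t"
      by (fastforce simp: angles_def)
    hence ab: "a \<in> A" "b \<in> B" "a \<noteq> 0" "b \<noteq> 0" "sgn a = sgn b" by auto
    have scale: "x \<in> convex hull (insert 0 S)"
      if "y \<in> S" "y \<noteq> 0" "sgn x = sgn y" "norm x \<le> norm y" for x y :: complex and S
    proof -
      have "x = norm x *\<^sub>R sgn x" by (cases "x = 0") (simp_all add: sgn_div_norm)
      also have "\<dots> = (norm x / norm y) *\<^sub>R y + 0 *\<^sub>R y"
        unfolding that(3) by (simp add: sgn_div_norm divide_inverse)
      also have "\<dots> \<in> convex hull (insert 0 S)"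
        using that by (intro combination_in_hull) (auto simp: divide_simps)
      finally show ?thesis .
    qed
    show False
    proof (cases "norm a \<le> norm b")
      case True
      thus False using scale[OF ab(2,4,5)] ab sep by (auto simp: sep_from_origin_def)
    next
      case False
      thus False using scale[OF ab(1,3) ab(5)[symmetric]] ab sep by (auto simp: sep_from_origin_def)
    qed
  qed
  show ?thesis unfolding angle_sets_def
    using disj ne[OF sep] ne[OF sep_commute[OF sep]] fin per sep by (auto simp: sep_from_origin_def)
qed

abbreviation rot :: "complex \<Rightarrow> complex set \<Rightarrow> complex set" where
  "rot u A \<equiv> (\<lambda>x. cnj u * x) ` A"

text \<open>The argument of \<open>x\<close> in the window of length \<open>2*pi\<close> centred at
  \<open>Arg u\<close>. There the points that are right for direction \<open>u\<close> form an
  uninterrupted run.\<close>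

definition lift :: "complex \<Rightarrow> complex \<Rightarrow> real" where
  "lift u x = Arg (cnj u * x) + Arg u"

lemma sep_rot:
  assumes "sep_from_origin A B" "u \<noteq> 0"
  shows "sep_from_origin (rot u A) (rot u B)"
  using assms by (intro sep_linear_image) (auto simp: inj_on_def intro!: bounded_linear.linear bounded_linear_mult_right)

lemma sgn_lift:
  assumes "u \<noteq> 0" "x \<noteq> 0"
  shows "cis (lift u x) = sgn x"
proof -
  have "cis (lift u x) = sgn (cnj u * x) * sgn u"
    using assms by (simp add: lift_def cis_mult[symmetric] cis_Arg)
  also have "\<dots> = sgn x * (sgn (cnj u) * sgn u)" by (simp add: sgn_mult)
  also have "sgn (cnj u) * sgn u = 1"
    using assms by (simp add: sgn_eq complex_norm_square[symmetric] field_simps power2_eq_square)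
  finally show ?thesis by simp
qed

lemma lift_in_angles: "u \<noteq> 0 \<Longrightarrow> x \<noteq> 0 \<Longrightarrow> x \<in> A \<Longrightarrow> lift u x \<in> angles A"
  by (auto simp: angles_def sgn_lift)

lemma angle_in_lift_range:
  assumes u: "u \<noteq> 0" and t: "t \<in> angles A" "- pi < t - Arg u" "t - Arg u \<le> pi"
  obtains x where "x \<in> A" "x \<noteq> 0" "lift u x = t"
proof -
  obtain x where x: "x \<in> A" "x \<noteq> 0" "sgn x = cis t" using t(1) by (auto simp: angles_def)
  have "sgn (cnj u * x) = cis (t - Arg u)"
  proof -
    have "sgn (cnj u) = cis (- Arg u)"
      using u cis_Arg[OF u] by (simp add: sgn_eq cis_cnj[symmetric])
    thus ?thesis using x(3) by (simp add: sgn_mult cis_mult)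
  qed
  hence "Arg (cnj u * x) = t - Arg u" using t by (intro cis_Arg_unique)
  thus ?thesis using that[of x] x by (simp add: lift_def)
qed

text \<open>No point of the other set intervenes in angle, by \<open>no_between_same\<close>; so the
  block does not change from one line to the next.\<close>

lemma change_count_right_step_same:
  assumes sep: "sep_from_origin P Q" and u: "u \<noteq> 0" and pair: "line_paired (rot u P) (rot u Q)"
    and x: "right_in (rot u P) (rot u Q) (cnj u * x)" "x \<in> P"
    and y: "right_in (rot u P) (rot u Q) (cnj u * y)" "y \<in> P"
    and h: "Im (cnj u * x) \<le> Im (cnj u * y)"
    and no: "\<And>w. w \<in> P \<union> Q \<Longrightarrow> Im (cnj u * x) < Im (cnj u * w) \<Longrightarrow> Im (cnj u * w) < Im (cnj u * y) \<Longrightarrow> False"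
  shows "change_count (angles P) (angles Q) (lift u x) = change_count (angles P) (angles Q) (lift u y)"
proof -
  have no': False if "w \<in> rot u P \<union> rot u Q" "Im (cnj u * x) < Im w" "Im w < Im (cnj u * y)" for w
    using that no by blast
  have x0: "x \<noteq> 0" "y \<noteq> 0" using sep_nonzero[OF sep] x(2) y(2) by auto
  have AS: "angle_sets (angles P) (angles Q)" by (rule angles_angle_sets[OF sep])
  have empty: "angles Q \<inter> {s..t} = {}" if st: "{s, t} = {lift u x, lift u y}" for s t
  proof (rule ccontr)
    assume "angles Q \<inter> {s..t} \<noteq> {}"
    then obtain r where r: "r \<in> angles Q" "s \<le> r" "r \<le> t" by auto
    have "- pi < r - Arg u" "r - Arg u \<le> pi"
      using r(2,3) st Arg_bounded[of "cnj u * x"] Arg_bounded[of "cnj u * y"]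
      by (auto simp: lift_def doubleton_eq_iff)
    then obtain z where z: "z \<in> Q" "z \<noteq> 0" "lift u z = r" using angle_in_lift_range[OF u r(1)] by blast
    show False
      by (rule no_between_same[OF sep_rot[OF sep u] pair x(1) y(1) h no', where z = "cnj u * z"])
         (use z r st in \<open>auto simp: lift_def doubleton_eq_iff\<close>)
  qed
  show ?thesis
  proof (cases "lift u x \<le> lift u y")
    case True
    thus ?thesis using same_side_change_count[OF AS True lift_in_angles[OF u x0(1) x(2)]] empty by blast
  next
    case False
    hence le: "lift u y \<le> lift u x" by simp
    thus ?thesis using same_side_change_count[OF AS le lift_in_angles[OF u x0(2) y(2)]] empty[of "lift u y" "lift u x"]
      by (simp add: insert_commute)
  qed
qed

text \<open>By \<open>no_switch_different\<close> the angles between the two right points switch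
  sets only once, so one block boundary is crossed on the way up.\<close>

lemma change_count_right_step_diff:
  assumes sep: "sep_from_origin P Q" and u: "u \<noteq> 0" and pair: "line_paired (rot u P) (rot u Q)"
    and x: "right_in (rot u P) (rot u Q) (cnj u * x)" "x \<in> P"
    and y: "right_in (rot u Q) (rot u P) (cnj u * y)" "y \<in> Q"
    and h: "Im (cnj u * x) < Im (cnj u * y)"
    and no: "\<And>w. w \<in> P \<union> Q \<Longrightarrow> Im (cnj u * x) < Im (cnj u * w) \<Longrightarrow> Im (cnj u * w) < Im (cnj u * y) \<Longrightarrow> False"
  shows "change_count (angles P) (angles Q) (lift u y) = change_count (angles P) (angles Q) (lift u x) + 1"
proof -
  have no': False if "w \<in> rot u P \<union> rot u Q" "Im (cnj u * x) < Im w" "Im w < Im (cnj u * y)" for w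
    using that no by blast
  have x0: "x \<noteq> 0" "y \<noteq> 0" using sep_nonzero[OF sep] sep_nonzero[OF sep_commute[OF sep]] x(2) y(2) by auto
  have AS: "angle_sets (angles P) (angles Q)" by (rule angles_angle_sets[OF sep])
  have less: "lift u x < lift u y"
    using right_Arg_less[OF sep_commute[OF sep_rot[OF sep u]] y(1) x(1) h] by (simp add: lift_def)
  show ?thesis
  proof (rule single_change_change_count[OF AS less lift_in_angles[OF u x0(1) x(2)] lift_in_angles[OF u x0(2) y(2)]])
    fix p q assume p: "p \<in> angles P" and q: "q \<in> angles Q" and le: "lift u x \<le> q" "q < p" "p \<le> lift u y"
    have "- pi < p - Arg u" "p - Arg u \<le> pi" "- pi < q - Arg u" "q - Arg u \<le> pi"
      using le Arg_bounded[of "cnj u * x"] Arg_bounded[of "cnj u * y"] by (auto simp: lift_def)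
    then obtain p' q' where p': "p' \<in> P" "lift u p' = p" and q': "q' \<in> Q" "lift u q' = q"
      using angle_in_lift_range[OF u p] angle_in_lift_range[OF u q] by metis
    show False
      by (rule no_switch_different[OF sep_rot[OF sep u] pair x(1) y(1) h no', where p = "cnj u * p'" and q = "cnj u * q'"])
         (use p' q' le in \<open>auto simp: lift_def\<close>)
  qed
qed

lemma constant_by_levels:
  fixes h :: "'a \<Rightarrow> real"
  assumes fin: "finite W"
    and step: "\<And>x y. x \<in> W \<Longrightarrow> y \<in> W \<Longrightarrow> h x \<le> h y \<Longrightarrow> (\<And>z. z \<in> W \<Longrightarrow> h x < h z \<Longrightarrow> h z < h y \<Longrightarrow> False) \<Longrightarrow> f x = f y"
    and x: "x \<in> W" and y: "y \<in> W"
  shows "f x = f y"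
proof -
  have *: "f x = f y" if "x \<in> W" "y \<in> W" "h x \<le> h y" for x y
    using that
  proof (induction "card {z\<in>W. h x < h z \<and> h z < h y}" arbitrary: x y rule: less_induct)
    case less
    show ?case
    proof (cases "\<exists>z\<in>W. h x < h z \<and> h z < h y")
      case False
      thus ?thesis using less.prems by (intro step) auto
    next
      case True
      then obtain z where z: "z \<in> W" "h x < h z" "h z < h y" by blast
      have "{w\<in>W. h x < h w \<and> h w < h z} \<subset> {w\<in>W. h x < h w \<and> h w < h y}"
        "{w\<in>W. h z < h w \<and> h w < h y} \<subset> {w\<in>W. h x < h w \<and> h w < h y}" using z by auto
      hence "card {w\<in>W. h x < h w \<and> h w < h z} < card {w\<in>W. h x < h w \<and> h w < h y}"
        "card {w\<in>W. h z < h w \<and> h w < h y} < card {w\<in>W. h x < h w \<and> h w < h y}"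
        using fin by (auto intro!: psubset_card_mono)
      thus ?thesis using less.hyps[of x z] less.hyps[of z y] less.prems z by simp
    qed
  qed
  show ?thesis using *[OF x y] *[OF y x] by fastforce
qed

text \<open>The block of \<open>x\<close>, encoded as an \<open>M\<close>-th root of unity; a full
  turn adds \<open>M\<close> to the index and leaves this value unchanged.\<close>

definition phase :: "complex set \<Rightarrow> complex set \<Rightarrow> complex \<Rightarrow> complex" where
  "phase A B x = cis (2 * pi * of_int (change_count (angles A) (angles B) (Arg x)) / of_int (change_period (angles A) (angles B)))"

lemma phase_lift:
  assumes sep: "sep_from_origin A B" and x: "x \<noteq> 0" "cis t = sgn x"
  shows "phase A B x = cis (2 * pi * of_int (change_count (angles A) (angles B) t) / of_int (change_period (angles A) (angles B)))"
proof -
  let ?M = "change_period (angles A) (angles B)"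
  have M: "?M > 0" by (rule change_period_pos[OF angles_angle_sets[OF sep]])
  have "cis t = cis (Arg x)" using x by (simp add: cis_Arg)
  then obtain k :: int where "t = Arg x + 2 * pi * of_int k" by (rule cis_eq_obtain)
  hence "change_count (angles A) (angles B) t = change_count (angles A) (angles B) (Arg x) + k * ?M"
    by (simp add: change_count_periodic)
  hence "2 * pi * of_int (change_count (angles A) (angles B) t) / of_int ?M
     = 2 * pi * of_int (change_count (angles A) (angles B) (Arg x)) / of_int ?M + 2 * pi * of_int k"
    using M by (simp add: field_simps)
  thus ?thesis by (simp add: phase_def cis_add_period)
qed

text \<open>The lines in direction \<open>u\<close> pair the angular blocks by a reflection \<open>i \<mapsto> S - i\<close> of \<open>\<int>/M\<close>.\<close>
lemma phase_product_constant:
  assumes sep: "sep_from_origin A B" and u: "u \<noteq> 0" and pair: "line_paired (rot u A) (rot u B)"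
  obtains S :: int where "\<And>a b. a \<in> A \<Longrightarrow> b \<in> B \<Longrightarrow> Im (cnj u * a) = Im (cnj u * b) \<Longrightarrow>
    phase A B a * phase A B b = cis (2 * pi * of_int S / of_int (change_period (angles A) (angles B)))"
proof -
  define N where "N = change_count (angles A) (angles B)"
  let ?M = "change_period (angles A) (angles B)"
  define W where "W = {(a, b). a \<in> A \<and> b \<in> B \<and> Im (cnj u * a) = Im (cnj u * b)}"
  have "finite W"
    by (rule finite_subset[of _ "A \<times> B"]) (use sep in \<open>auto simp: W_def sep_from_origin_def\<close>)
  \<comment> \<open>The index of the right point for \<open>u\<close> plus the index of its left
    partner, which is a right point for \<open>-u\<close>. This sum will be the constant of the
    reflection.\<close>
  define f where "f = (\<lambda>(a, b). if Re (cnj u * b) < Re (cnj u * a) then N (lift u a) + N (lift (-u) b)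
      else N (lift u b) + N (lift (-u) a))"
  have u': "-u \<noteq> 0" using u by simp
  have pair': "line_paired (rot (-u) A) (rot (-u) B)"
    using pair by (simp add: line_paired_def del: times_complex.sel)
  have rP: "right_in (rot u P) (rot u Q) (cnj u * a)" "right_in (rot (-u) Q) (rot (-u) P) (cnj (-u) * b)"
    if "a \<in> P" "b \<in> Q" "Im (cnj u * a) = Im (cnj u * b)" "Re (cnj u * b) < Re (cnj u * a)" for a b P Q
  proof -
    show "right_in (rot u P) (rot u Q) (cnj u * a)" unfolding right_in_def using that
      by (intro conjI bexI[of _ "cnj u * b"] imageI) simp_all
    show "right_in (rot (-u) Q) (rot (-u) P) (cnj (-u) * b)" unfolding right_in_def using that
      by (intro conjI bexI[of _ "cnj (-u) * a"] imageI) (simp_all del: times_complex.sel)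
  qed
  have pts: "\<exists>p\<in>W. Im (cnj u * w) = Im (cnj u * fst p)" if w: "w \<in> A \<union> B" for w
  proof (cases "w \<in> A")
    case True
    then obtain y where "y \<in> B" "Im (cnj u * y) = Im (cnj u * w)"
      using pair by (auto simp: line_paired_def)
    thus ?thesis using True by (intro bexI[of _ "(w, y)"]) (auto simp: W_def)
  next
    case False
    then obtain y where "y \<in> A" "Im (cnj u * y) = Im (cnj u * w)"
      using pair w by (auto simp: line_paired_def)
    thus ?thesis using False w by (intro bexI[of _ "(y, w)"]) (auto simp: W_def)
  qed
  \<comment> \<open>From one line to the next, the index at the right grows by 0 or 1. The index at
    the left drops by the same amount, because \<open>-u\<close> reverses the order of the
    lines.\<close>
  have step: "f p = f q" if p: "p \<in> W" and q: "q \<in> W" and le: "Im (cnj u * fst p) \<le> Im (cnj u * fst q)"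
    and no: "\<And>z. z \<in> W \<Longrightarrow> Im (cnj u * fst p) < Im (cnj u * fst z) \<Longrightarrow> Im (cnj u * fst z) < Im (cnj u * fst q) \<Longrightarrow> False"
    for p q
  proof -
    obtain a b where ab: "p = (a, b)" "a \<in> A" "b \<in> B" "Im (cnj u * a) = Im (cnj u * b)" using p by (auto simp: W_def)
    obtain a' b' where ab': "q = (a', b')" "a' \<in> A" "b' \<in> B" "Im (cnj u * a') = Im (cnj u * b')" using q by (auto simp: W_def)
    define h1 h2 where "h1 = Im (cnj u * a)" and "h2 = Im (cnj u * a')"
    have H: "Im (cnj u * a) = h1" "Im (cnj u * b) = h1" "Im (cnj u * a') = h2" "Im (cnj u * b') = h2"
      "Im (cnj (-u) * a) = -h1" "Im (cnj (-u) * b) = -h1" "Im (cnj (-u) * a') = -h2" "Im (cnj (-u) * b') = -h2"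
      using ab ab' by (auto simp: h1_def h2_def)
    have le: "h1 \<le> h2" using le ab ab' by (simp add: h1_def h2_def)
    \<comment> \<open>A line through any point carries a pair, so lines adjacent among pairs are
      adjacent among all points.\<close>
    have no1: False if "w \<in> A \<union> B" "h1 < Im (cnj u * w)" "Im (cnj u * w) < h2" for w
      using pts[OF that(1)] no that ab ab' H by force
    have no2: False if "w \<in> A \<union> B" "-h2 < Im (cnj (-u) * w)" "Im (cnj (-u) * w) < -h1" for w
      using no1[OF that(1)] that(2,3) by simp
    have no1': False if "w \<in> B \<union> A" "h1 < Im (cnj u * w)" "Im (cnj u * w) < h2" for w
      using no1 that by blast
    have no2': False if "w \<in> B \<union> A" "-h2 < Im (cnj (-u) * w)" "Im (cnj (-u) * w) < -h1" for w
      using no2 that by blast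
    note C = change_count_commute[of "angles B" "angles A"]
    have sep': "sep_from_origin B A" by (rule sep_commute[OF sep])
    note pc = line_paired_commute[OF pair] line_paired_commute[OF pair']
    have ne: "Re (cnj u * b) \<noteq> Re (cnj u * a)" if "a \<in> A" "b \<in> B" "Im (cnj u * a) = Im (cnj u * b)" for a b
    proof
      assume "Re (cnj u * b) = Re (cnj u * a)"
      hence "cnj u * a = cnj u * b" using that by (simp add: complex_eq_iff)
      hence "a = b" using u by simp
      thus False using that sep_disjoint[OF sep] by auto
    qed
    have strict: "h1 < h2" if r: "right_in (rot u A) (rot u B) (cnj u * x)" "right_in (rot u B) (rot u A) (cnj u * y)"
      "Im (cnj u * x) = h1 \<and> Im (cnj u * y) = h2 \<or> Im (cnj u * x) = h2 \<and> Im (cnj u * y) = h1" for x y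
      using right_same_line[OF sep_rot[OF sep u] r(1,2)] r(3) le by force
    show ?thesis
    proof (cases "Re (cnj u * b) < Re (cnj u * a)")
      case r1: True
      note R1 = rP[OF ab(2,3,4) r1]
      show ?thesis
      proof (cases "Re (cnj u * b') < Re (cnj u * a')")
        case r2: True
        note R2 = rP[OF ab'(2,3,4) r2]
        have "N (lift u a) = N (lift u a')" unfolding N_def
          by (rule change_count_right_step_same[OF sep u pair R1(1) ab(2) R2(1) ab'(2)])
             (simp only: H neg_le_iff_le neg_less_iff_less le, simp only: H, rule no1, assumption+)
        moreover have "N (lift (-u) b') = N (lift (-u) b)" unfolding N_def C[symmetric]
          by (rule change_count_right_step_same[OF sep' u' pc(2) R2(2) ab'(3) R1(2) ab(3)])
             (simp only: H neg_le_iff_le neg_less_iff_less le, simp only: H, rule no2', assumption+)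
        ultimately show ?thesis using r1 r2 by (simp add: f_def ab ab')
      next
        case r2: False
        hence r2': "Re (cnj u * a') < Re (cnj u * b')" using ne[OF ab'(2-4)] by simp
        note R2 = rP[OF ab'(3,2) ab'(4)[symmetric] r2']
        have st: "h1 < h2" by (rule strict[OF R1(1) R2(1)]) (use H in auto)
        have "N (lift u b') = N (lift u a) + 1" unfolding N_def
          by (rule change_count_right_step_diff[OF sep u pair R1(1) ab(2) R2(1) ab'(3)])
             (simp only: H neg_le_iff_le neg_less_iff_less st, simp only: H, rule no1, assumption+)
        moreover have "N (lift (-u) b) = N (lift (-u) a') + 1" unfolding N_def
          by (rule change_count_right_step_diff[OF sep u' pair' R2(2) ab'(2) R1(2) ab(3)])
             (simp only: H neg_le_iff_le neg_less_iff_less st, simp only: H, rule no2, assumption+)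
        ultimately show ?thesis using r1 r2 by (simp add: f_def ab ab')
      qed
    next
      case r1: False
      hence r1': "Re (cnj u * a) < Re (cnj u * b)" using ne[OF ab(2-4)] by simp
      note R1 = rP[OF ab(3,2) ab(4)[symmetric] r1']
      show ?thesis
      proof (cases "Re (cnj u * b') < Re (cnj u * a')")
        case r2: True
        note R2 = rP[OF ab'(2,3,4) r2]
        have st: "h1 < h2" by (rule strict[OF R2(1) R1(1)]) (use H in auto)
        have "N (lift u a') = N (lift u b) + 1" unfolding N_def C[symmetric]
          by (rule change_count_right_step_diff[OF sep' u pc(1) R1(1) ab(3) R2(1) ab'(2)])
             (simp only: H neg_le_iff_le neg_less_iff_less st, simp only: H, rule no1', assumption+)
        moreover have "N (lift (-u) a) = N (lift (-u) b') + 1" unfolding N_def C[symmetric]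
          by (rule change_count_right_step_diff[OF sep' u' pc(2) R2(2) ab'(3) R1(2) ab(2)])
             (simp only: H neg_le_iff_le neg_less_iff_less st, simp only: H, rule no2', assumption+)
        ultimately show ?thesis using r1 r2 by (simp add: f_def ab ab')
      next
        case r2: False
        hence r2': "Re (cnj u * a') < Re (cnj u * b')" using ne[OF ab'(2-4)] by simp
        note R2 = rP[OF ab'(3,2) ab'(4)[symmetric] r2']
        have "N (lift u b) = N (lift u b')" unfolding N_def C[symmetric]
          by (rule change_count_right_step_same[OF sep' u pc(1) R1(1) ab(3) R2(1) ab'(3)])
             (simp only: H neg_le_iff_le neg_less_iff_less le, simp only: H, rule no1', assumption+)
        moreover have "N (lift (-u) a') = N (lift (-u) a)" unfolding N_def
          by (rule change_count_right_step_same[OF sep u' pair' R2(2) ab'(2) R1(2) ab(2)])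
             (simp only: H neg_le_iff_le neg_less_iff_less le, simp only: H, rule no2, assumption+)
        ultimately show ?thesis using r1 r2 by (simp add: f_def ab ab')
      qed
    qed
  qed
  have const: "f p = f q" if "p \<in> W" "q \<in> W" for p q
    by (rule constant_by_levels[OF \<open>finite W\<close> step that]) auto
  obtain a0 where "a0 \<in> A" using sep by (auto simp: sep_from_origin_def)
  then obtain p0 where p0: "p0 \<in> W" using pts by blast
  show ?thesis
  proof (rule that[of "f p0"])
    fix a b assume ab: "a \<in> A" "b \<in> B" "Im (cnj u * a) = Im (cnj u * b)"
    have f: "f p0 = f (a, b)" using ab by (intro const p0) (auto simp: W_def)
    have a0: "a \<noteq> 0" "b \<noteq> 0" using sep_nonzero[OF sep] sep_nonzero[OF sep_commute[OF sep]] ab by auto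
    have ph: "phase A B x = cis (2 * pi * of_int (N (lift v x)) / of_int ?M)" if "x \<noteq> 0" "v \<noteq> 0" for x v
      unfolding N_def by (rule phase_lift[OF sep that(1) sgn_lift[OF that(2,1)]])
    have fin: "phase A B x * phase A B y = cis (2 * pi * of_int (N (lift u x) + N (lift (-u) y)) / of_int ?M)"
      if "x \<noteq> 0" "y \<noteq> 0" for x y
      unfolding ph[OF that(1) u] ph[OF that(2) u'] by (simp add: cis_mult add_divide_distrib distrib_left)
    show "phase A B a * phase A B b = cis (2 * pi * of_int (f p0) / of_int ?M)"
      using fin[OF a0] fin[OF a0(2,1)] unfolding f by (auto simp: f_def mult.commute)
  qed
qed

subsection \<open>The first Fourier mode\<close>

text \<open>The components along the direction of angle \<open>m\<close> are all positive.\<close>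

lemma sum_nonzero_half_plane:
  assumes "finite S" "S \<noteq> {}" and half: "\<And>x. x \<in> S \<Longrightarrow> x \<noteq> 0 \<and> (\<exists>t. cis t = sgn x \<and> m - pi/2 < t \<and> t < m + pi/2)"
  shows "\<Sum>S \<noteq> (0::complex)"
proof
  assume 0: "\<Sum>S = 0"
  have pos: "Re (cis (-m) * x) > 0" if x: "x \<in> S" for x
  proof -
    obtain t where t: "cis t = sgn x" "m - pi/2 < t" "t < m + pi/2" and x0: "x \<noteq> 0" using half[OF x] by blast
    have "x = of_real (norm x) * cis t" using t(1) x0 by (simp add: sgn_eq)
    hence "cis (-m) * x = of_real (norm x) * cis (t - m)" by (metis cis_mult mult.left_commute add.commute diff_conv_add_uminus)
    hence "Re (cis (-m) * x) = norm x * cos (t - m)" by simp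
    moreover have "cos (t - m) > 0" using t by (intro cos_gt_zero_pi) auto
    ultimately show ?thesis using x0 by simp
  qed
  have "0 < (\<Sum>x\<in>S. Re (cis (-m) * x))" using assms(1,2) pos by (intro sum_pos) auto
  also have "\<dots> = Re (cis (-m) * \<Sum>S)" by (simp only: sum_distrib_left Re_sum)
  finally show False using 0 by simp
qed

text \<open>The angle in \<open>(arg w, arg w + 2\<pi>]\<close>, so that the half-plane to the left of \<open>w\<close> comes first.\<close>
definition half_lift :: "complex \<Rightarrow> complex \<Rightarrow> real" where
  "half_lift w x = (if Arg (cnj w * x) > 0 then lift w x else lift w x + 2 * pi)"

lemma cis_half_lift: "w \<noteq> 0 \<Longrightarrow> x \<noteq> 0 \<Longrightarrow> cis (half_lift w x) = sgn x"
  using sgn_lift[of w x] cis_add_period[of "lift w x" 1] by (simp add: half_lift_def)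

lemma half_lift_cases:
  "Im (cnj w * x) > 0 \<Longrightarrow> Arg w < half_lift w x \<and> half_lift w x < Arg w + pi"
  "Im (cnj w * x) < 0 \<Longrightarrow> Arg w + pi < half_lift w x \<and> half_lift w x < Arg w + 2 * pi"
  "Im (cnj w * x) = 0 \<Longrightarrow> half_lift w x = Arg w + pi \<or> half_lift w x = Arg w + 2 * pi"
proof -
  let ?y = "cnj w * x"
  show "Arg w < half_lift w x \<and> half_lift w x < Arg w + pi" if "Im ?y > 0"
    using Arg_upper[OF that] by (simp add: half_lift_def lift_def)
  show "Arg w + pi < half_lift w x \<and> half_lift w x < Arg w + 2 * pi" if "Im ?y < 0"
    using Arg_lower[OF that] Arg_bounded[of ?y] by (simp add: half_lift_def lift_def)
  show "half_lift w x = Arg w + pi \<or> half_lift w x = Arg w + 2 * pi" if "Im ?y = 0"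
  proof -
    have "?y \<in> \<real>" using that by (simp add: complex_is_Real_iff)
    hence "Arg ?y = 0 \<or> Arg ?y = pi" using Arg_eq_0_pi by blast
    thus ?thesis by (auto simp: half_lift_def lift_def)
  qed
qed

lemma half_lift_bounds: "Arg w < half_lift w x \<and> half_lift w x \<le> Arg w + 2 * pi"
  using half_lift_cases[of w x] by (cases "Im (cnj w * x)" "0::real" rule: linorder_cases) auto

text \<open>The equality case of the Sturm argument. Off the line of \<open>w\<close> the set
  \<open>P\<close> meets only block \<open>i1\<close>, which is also block \<open>i1 + M\<close>,
  and \<open>Q\<close> only block \<open>i2\<close>. The sets thus fill two complementary arcs, one
  of which fits into an open half-plane, although both sums are zero.\<close>

lemma two_block_contradiction:
  assumes sep: "sep_from_origin P Q" and sums: "\<Sum>P = 0" "\<Sum>Q = 0" and w: "w \<noteq> 0"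
    and n_def: "\<And>x. n x = change_count (angles P) (angles Q) (half_lift w x)"
    and M: "M = change_period (angles P) (angles Q)"
    and x1: "x1 \<in> P" "Im (cnj w * x1) > 0" "n x1 = i1" and i12': "i1 < i2"
    and qp: "qp \<in> Q" "Im (cnj w * qp) > 0" and qn: "qn \<in> Q" "Im (cnj w * qn) < 0" and pn: "pn \<in> P" "Im (cnj w * pn) < 0"
    and pos: "\<And>x. x \<in> P \<union> Q \<Longrightarrow> Im (cnj w * x) > 0 \<Longrightarrow> n x = i1 \<or> n x = i2"
    and neg: "\<And>x. x \<in> P \<union> Q \<Longrightarrow> Im (cnj w * x) < 0 \<Longrightarrow> n x = i2 \<or> n x = i1 + M"
    and less: "\<And>x y. x \<in> P \<and> y \<in> Q \<or> x \<in> Q \<and> y \<in> P \<Longrightarrow> half_lift w x < half_lift w y \<Longrightarrow> n x < n y"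
    and wrap: "\<And>x y. x \<in> P \<and> y \<in> Q \<or> x \<in> Q \<and> y \<in> P \<Longrightarrow> n y < n x + M"
    and ne: "\<And>x y. x \<in> P \<Longrightarrow> y \<in> Q \<Longrightarrow> n x \<noteq> n y"
  shows False
proof -
  let ?T = "half_lift w"
  have mono: "n x \<le> n y" if "?T x \<le> ?T y" for x y
    unfolding n_def using that by (rule change_count_mono)
  have finP: "finite P" and finQ: "finite Q" using sep by (auto simp: sep_from_origin_def)
  have nqp: "n qp = i2" using pos[of qp] qp ne[OF x1(1) qp(1)] x1(3) by auto
  have Ppos: "n x = i1" if "x \<in> P" "Im (cnj w * x) > 0" for x
    using pos[of x] that ne[OF that(1) qp(1)] nqp by auto
  have Qpos: "n x = i2" if "x \<in> Q" "Im (cnj w * x) > 0" for x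
    using pos[of x] that ne[OF x1(1) that(1)] x1(3) by auto
  have Qneg: "n x = i2" if "x \<in> Q" "Im (cnj w * x) < 0" for x
    using neg[of x] that wrap[of x1 x] x1 by auto
  have Pneg: "n x = i1 + M" if "x \<in> P" "Im (cnj w * x) < 0" for x
    using neg[of x] that ne[OF that(1) qp(1)] nqp by auto
  have fin: "finite {x\<in>P. Im (cnj w * x) > 0}" "finite {x\<in>P. Im (cnj w * x) < 0}" using finP by auto
  define t where "t = Max (?T ` {x\<in>P. Im (cnj w * x) > 0})"
  define t' where "t' = Min (?T ` {x\<in>P. Im (cnj w * x) < 0})"
  have "t \<in> ?T ` {x\<in>P. Im (cnj w * x) > 0}" unfolding t_def using fin x1 by (intro Max_in) auto
  then obtain p where p: "p \<in> P" "Im (cnj w * p) > 0" "t = ?T p" by auto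
  have "t' \<in> ?T ` {x\<in>P. Im (cnj w * x) < 0}" unfolding t'_def using fin pn by (intro Min_in) auto
  then obtain p' where p': "p' \<in> P" "Im (cnj w * p') < 0" "t' = ?T p'" by auto
  have tmax: "?T x \<le> t" if "x \<in> P" "Im (cnj w * x) > 0" for x
    unfolding t_def using fin that by (intro Max_ge) auto
  have tmin: "t' \<le> ?T x" if "x \<in> P" "Im (cnj w * x) < 0" for x
    unfolding t'_def using fin that by (intro Min_le) auto
  have t: "Arg w < t" "t < Arg w + pi" and t': "Arg w + pi < t'" "t' < Arg w + 2 * pi"
    using half_lift_cases(1)[OF p(2)] half_lift_cases(2)[OF p'(2)] p(3) p'(3) by auto
  have i2M: "i2 < i1 + M" using wrap[of x1 qp] x1 qp nqp by auto
  have Qin: "t < ?T q \<and> ?T q < t'" if q: "q \<in> Q" for q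
  proof -
    consider "Im (cnj w * q) > 0" | "Im (cnj w * q) < 0" | "Im (cnj w * q) = 0" by linarith
    thus ?thesis
    proof cases
      case 1
      have "\<not> ?T q \<le> ?T p" using mono[of q p] Qpos[OF q 1] Ppos[OF p(1,2)] i12' by auto
      thus ?thesis using half_lift_cases(1)[OF 1] p t t' by auto
    next
      case 2
      have "\<not> ?T p' \<le> ?T q" using mono[of p' q] Qneg[OF q 2] Pneg[OF p'(1,2)] i2M by auto
      thus ?thesis using half_lift_cases(2)[OF 2] p' t t' by auto
    next
      case 3
      \<comment> \<open>A point of \<open>Q\<close> in the direction of \<open>w\<close> itself
        would come after block \<open>i1 + M\<close>, hence more than \<open>M\<close> blocks after
        \<open>x1\<close>.\<close>
      have "?T q \<noteq> Arg w + 2 * pi"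
      proof
        assume "?T q = Arg w + 2 * pi"
        hence "n p' < n q" using p' q t' by (intro less) auto
        hence "i1 + M < n q" using Pneg[OF p'(1,2)] by simp
        thus False using wrap[of x1 q] x1 q by auto
      qed
      hence "?T q = Arg w + pi" using half_lift_cases(3)[OF 3] by auto
      thus ?thesis using t t' by simp
    qed
  qed
  have Pin: "\<exists>s. cis s = sgn x \<and> t' \<le> s \<and> s \<le> t + 2 * pi" if x: "x \<in> P" for x
  proof -
    have x0: "x \<noteq> 0" using sep_nonzero[OF sep x] .
    consider "Im (cnj w * x) > 0" | "Im (cnj w * x) < 0" | "Im (cnj w * x) = 0" by linarith
    thus ?thesis
    proof cases
      case 1
      have "cis (?T x + 2 * pi) = sgn x" using cis_half_lift[OF w x0] cis_add_period[of "?T x" 1] by simp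
      thus ?thesis using tmax[OF x 1] half_lift_cases(1)[OF 1] t' by (intro exI[of _ "?T x + 2 * pi"]) auto
    next
      case 2
      thus ?thesis using cis_half_lift[OF w x0] tmin[OF x 2] half_lift_cases(2)[OF 2] t by (intro exI[of _ "?T x"]) auto
    next
      case 3
      have "?T x \<noteq> Arg w + pi"
      proof
        assume "?T x = Arg w + pi"
        hence "n qp < n x" "n x < n qn"
          using half_lift_cases(1)[OF qp(2)] half_lift_cases(2)[OF qn(2)] x qp qn by (auto intro!: less)
        thus False using nqp Qneg[OF qn] by simp
      qed
      hence "?T x = Arg w + 2 * pi" using half_lift_cases(3)[OF 3] by auto
      thus ?thesis using cis_half_lift[OF w x0] t t' by (intro exI[of _ "?T x"]) auto
    qed
  qed
  show False
  \<comment> \<open>The arc of \<open>Q\<close> lies strictly between \<open>t\<close> and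
    \<open>t'\<close>; if that gap exceeds \<open>pi\<close>, the arc of \<open>P\<close> from
    \<open>t'\<close> to \<open>t + 2 * pi\<close> is shorter than \<open>pi\<close>.\<close>
  proof (cases "t' - t \<le> pi")
    case True
    have "\<Sum>Q \<noteq> 0"
    proof (rule sum_nonzero_half_plane[where m = "(t + t') / 2"])
      fix x assume x: "x \<in> Q"
      have "x \<noteq> 0" using sep_nonzero[OF sep_commute[OF sep] x] .
      thus "x \<noteq> 0 \<and> (\<exists>s. cis s = sgn x \<and> (t + t') / 2 - pi/2 < s \<and> s < (t + t') / 2 + pi/2)"
        using Qin[OF x] True cis_half_lift[OF w] by (intro conjI exI[of _ "?T x"]) (auto simp: field_simps)
    qed (use finQ qp in auto)
    thus False using sums by simp
  next
    case False
    have "\<Sum>P \<noteq> 0"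
    proof (rule sum_nonzero_half_plane[where m = "(t' + t + 2 * pi) / 2"])
      fix x assume x: "x \<in> P"
      obtain s where s: "cis s = sgn x" "t' \<le> s" "s \<le> t + 2 * pi" using Pin[OF x] by blast
      show "x \<noteq> 0 \<and> (\<exists>s. cis s = sgn x \<and> (t' + t + 2 * pi) / 2 - pi/2 < s \<and> s < (t' + t + 2 * pi) / 2 + pi/2)"
        using s False sep_nonzero[OF sep x] by (intro conjI exI[of _ s]) (auto simp: field_simps)
    qed (use finP x1 in auto)
    thus False using sums by simp
  qed
qed

lemma exists_both_sides:
  assumes S: "finite S" "\<Sum>S = (0::complex)" and x: "x \<in> S" "Im (cnj w * x) \<noteq> 0"
  shows "(\<exists>y\<in>S. Im (cnj w * y) > 0) \<and> (\<exists>y\<in>S. Im (cnj w * y) < 0)"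
proof -
  have 0: "(\<Sum>y\<in>S. Im (cnj w * y)) = 0"
    using S by (simp flip: Im_sum sum_distrib_left del: times_complex.sel)
  have "(\<Sum>y\<in>S. - Im (cnj w * y)) = 0" using 0 by (simp add: sum_negf del: times_complex.sel)
  hence "\<not> (\<forall>y\<in>S. 0 \<le> - Im (cnj w * y))"
    using sum_nonneg_eq_0_iff[OF S(1), of "\<lambda>y. - Im (cnj w * y)"] x by force
  hence "\<not> (\<forall>y\<in>S. Im (cnj w * y) \<le> 0)" by simp
  moreover have "\<not> (\<forall>y\<in>S. Im (cnj w * y) \<ge> 0)"
    using sum_nonneg_eq_0_iff[OF S(1), of "\<lambda>y. Im (cnj w * y)"] 0 x by force
  ultimately show ?thesis by (auto simp: not_le)
qed

text \<open>Sturm's argument: \<open>cos (\<theta> - \<psi>) - cos \<delta>\<close> changes sign exactly where the linear functional does.\<close>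
lemma first_mode_nonzero:
  assumes sep: "sep_from_origin A B" and sums: "\<Sum>A = 0" "\<Sum>B = 0" and w: "w \<noteq> 0"
    and ncA: "\<exists>x\<in>A. Im (cnj w * x) \<noteq> 0" and ncB: "\<exists>x\<in>B. Im (cnj w * x) \<noteq> 0"
  shows "(\<Sum>x\<in>A \<union> B. of_real (Im (cnj w * x)) * phase A B x) \<noteq> 0"
proof
  assume zero: "(\<Sum>x\<in>A \<union> B. of_real (Im (cnj w * x)) * phase A B x) = 0"
  let ?T = "half_lift w" and ?h = "\<lambda>x. Im (cnj w * x)"
  define M where "M = change_period (angles A) (angles B)"
  define n where "n x = change_count (angles A) (angles B) (?T x)" for x
  have AS: "angle_sets (angles A) (angles B)" by (rule angles_angle_sets[OF sep])
  have AS': "angle_sets (angles B) (angles A)" by (rule angle_sets_commute[OF AS])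
  have Mpos: "M > 0" unfolding M_def by (rule change_period_pos[OF AS])
  have finA: "finite A" and finB: "finite B" using sep by (auto simp: sep_from_origin_def)
  have nz: "x \<noteq> 0" if "x \<in> A \<union> B" for x
    using that sep_nonzero[OF sep] sep_nonzero[OF sep_commute[OF sep]] by auto
  have TA: "?T x \<in> angles A" if "x \<in> A" for x
    unfolding angles_def using cis_half_lift[OF w] nz[of x] that by auto
  have TB: "?T x \<in> angles B" if "x \<in> B" for x
    unfolding angles_def using cis_half_lift[OF w] nz[of x] that by auto
  have TA2: "?T x + 2 * pi \<in> angles A" if "x \<in> A" for x
    unfolding angles_def using cis_half_lift[OF w, of x] cis_add_period[of "?T x" 1] nz[of x] that by auto
  have TB2: "?T x + 2 * pi \<in> angles B" if "x \<in> B" for x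
    unfolding angles_def using cis_half_lift[OF w, of x] cis_add_period[of "?T x" 1] nz[of x] that by auto
  have n2: "change_count (angles A) (angles B) (?T x + 2 * pi) = n x + M" for x
    using change_count_periodic[of "angles A" "angles B" "?T x" 1] by (simp add: n_def M_def)
  have mono: "n x \<le> n y" if "?T x \<le> ?T y" for x y
    unfolding n_def using that by (rule change_count_mono)
  have win: "?T y < ?T x + 2 * pi" for x y using half_lift_bounds[of w x] half_lift_bounds[of w y] by simp
  have less: "n x < n y" if "x \<in> A \<and> y \<in> B \<or> x \<in> B \<and> y \<in> A" "?T x < ?T y" for x y
    using that other_side_change_count_less[OF AS, of "?T x" "?T y"] other_side_change_count_less[OF AS', of "?T x" "?T y"]
      TA TB by (auto simp: n_def change_count_commute[of "angles B" "angles A"])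
  have wrap: "n y < n x + M" if "x \<in> A \<and> y \<in> B \<or> x \<in> B \<and> y \<in> A" for x y
    using that other_side_change_count_less[OF AS, of "?T y" "?T x + 2 * pi"]
      other_side_change_count_less[OF AS', of "?T y" "?T x + 2 * pi"] TA TB TA2 TB2 win[of y x]
    unfolding n2[symmetric] by (auto simp: n_def change_count_commute[of "angles B" "angles A"])
  have wrap_le: "n y \<le> n x + M" for x y
    unfolding n2[symmetric] n_def[of y] using win[of y x] by (intro change_count_mono) auto
  have ne: "n x \<noteq> n y" if "x \<in> A" "y \<in> B" for x y
  proof -
    have "?T x \<noteq> ?T y" using TA[OF that(1)] TB[OF that(2)] AS by (auto simp: angle_sets_def)
    thus ?thesis using less[of x y] less[of y x] that by (cases "?T x < ?T y") auto
  qed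
  obtain ap where ap: "ap \<in> A" "?h ap > 0" using ncA exists_both_sides[OF finA sums(1), of _ w] by blast
  obtain an where an: "an \<in> A" "?h an < 0" using ncA exists_both_sides[OF finA sums(1), of _ w] by blast
  obtain bp where bp: "bp \<in> B" "?h bp > 0" using ncB exists_both_sides[OF finB sums(2), of _ w] by blast
  obtain bn where bn: "bn \<in> B" "?h bn < 0" using ncB exists_both_sides[OF finB sums(2), of _ w] by blast
  define Pos where "Pos = {x \<in> A \<union> B. ?h x > 0}"
  have finPos: "finite Pos" and nePos: "Pos \<noteq> {}" using finA finB ap by (auto simp: Pos_def)
  define i1 where "i1 = Min (n ` Pos)"
  define i2 where "i2 = Max (n ` Pos)"
  have "i1 \<in> n ` Pos" unfolding i1_def using finPos nePos by (intro Min_in) auto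
  then obtain x1 where x1: "x1 \<in> Pos" "n x1 = i1" by auto
  have "i2 \<in> n ` Pos" unfolding i2_def using finPos nePos by (intro Max_in) auto
  then obtain x2 where x2: "x2 \<in> Pos" "n x2 = i2" by auto
  have i1le: "i1 \<le> n x" and i2ge: "n x \<le> i2" if "x \<in> Pos" for x
    unfolding i1_def i2_def using finPos that by auto
  have nonpos: "i2 \<le> n x \<and> n x \<le> i1 + M" if "?h x \<le> 0" for x
  proof -
    have "?T x2 \<le> ?T x"
    proof (cases "?h x = 0")
      case True
      thus ?thesis using half_lift_cases(3)[OF True] half_lift_cases(1)[of w x2] x2 by (auto simp: Pos_def)
    next
      case False
      thus ?thesis using half_lift_cases(2)[of w x] that half_lift_cases(1)[of w x2] x2 by (auto simp: Pos_def)
    qed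
    thus ?thesis using mono[of x2 x] x2 wrap_le[of x x1] x1 by auto
  qed
  \<comment> \<open>Centre and half-width of the phases of the positive side: blocks
    \<open>i1\<close> to \<open>i2\<close> go from \<open>\<psi> - \<delta>\<close> to
    \<open>\<psi> + \<delta>\<close>, and all other blocks fall into the complementary range. This
    makes the sign of \<open>cos (\<theta> x) - cos \<delta>\<close> agree weakly with that of the
    functional.\<close>
  define \<psi> where "\<psi> = pi * of_int (i1 + i2) / of_int M"
  define \<delta> where "\<delta> = pi * of_int (i2 - i1) / of_int M"
  have i12: "i1 < i2"
    using ne[OF ap(1) bp(1)] i1le[of ap] i2ge[of ap] i1le[of bp] i2ge[of bp] ap bp by (auto simp: Pos_def)
  have i2M: "i2 \<le> i1 + M" using nonpos[of an] an by auto
  have "pi * of_int (i2 - i1) \<le> pi * of_int M" using i2M by (intro mult_left_mono) auto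
  hence \<delta>: "0 < \<delta>" "\<delta> \<le> pi"
    using i12 Mpos by (auto simp: \<delta>_def divide_le_eq)
  define \<theta> where "\<theta> x = 2 * pi * of_int (n x) / of_int M - \<psi>" for x
  have \<theta>: "\<theta> x - \<delta> = 2 * pi * of_int (n x - i2) / of_int M" "\<theta> x + \<delta> = 2 * pi * of_int (n x - i1) / of_int M" for x
    by (simp_all add: \<theta>_def \<psi>_def \<delta>_def diff_divide_distrib add_divide_distrib ring_distribs)
  have npi: "\<not> pi \<le> 0" using pi_gt_zero by linarith
  have sgn_frac: "(2 * pi * of_int k / of_int M \<le> 0) = (k \<le> 0)" "(2 * pi * of_int k / of_int M < 0) = (k < 0)"
    "(0 \<le> 2 * pi * of_int k / of_int M) = (0 \<le> k)" "(0 < 2 * pi * of_int k / of_int M) = (0 < k)" for k :: int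
    using Mpos npi by (simp_all add: divide_le_0_iff divide_less_0_iff zero_le_divide_iff zero_less_divide_iff mult_le_0_iff mult_less_0_iff zero_le_mult_iff zero_less_mult_iff)
  have upper: "\<theta> x \<le> \<delta>" "-\<delta> \<le> \<theta> x" if "x \<in> Pos" for x
  proof -
    have "\<theta> x - \<delta> \<le> 0" unfolding \<theta> sgn_frac using i2ge[OF that] by simp
    thus "\<theta> x \<le> \<delta>" by simp
    have "0 \<le> \<theta> x + \<delta>" unfolding \<theta> sgn_frac using i1le[OF that] by simp
    thus "-\<delta> \<le> \<theta> x" by simp
  qed
  have cos_pos: "cos \<delta> \<le> cos (\<theta> x)" if "x \<in> Pos" for x
  proof -
    have "cos \<delta> \<le> cos \<bar>\<theta> x\<bar>" using upper[OF that] \<delta> by (intro cos_monotone_0_pi_le) auto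
    thus ?thesis by simp
  qed
  have cos_pos_strict: "n x = i1 \<or> n x = i2" if "x \<in> Pos" "cos (\<theta> x) = cos \<delta>" for x
  proof (rule ccontr)
    assume c: "\<not> (n x = i1 \<or> n x = i2)"
    have "\<theta> x - \<delta> < 0" unfolding \<theta> sgn_frac using i2ge[OF that(1)] c by simp
    moreover have "0 < \<theta> x + \<delta>" unfolding \<theta> sgn_frac using i1le[OF that(1)] c by simp
    ultimately have "cos \<delta> < cos \<bar>\<theta> x\<bar>" using \<delta> by (intro cos_monotone_0_pi) auto
    thus False using that(2) by simp
  qed
  have two: "\<theta> x + \<delta> - 2 * pi = 2 * pi * of_int (n x - i1 - M) / of_int M" for x
    unfolding \<theta> using Mpos by (simp add: field_simps)
  have lower: "\<delta> \<le> \<theta> x" "\<theta> x \<le> 2 * pi - \<delta>" if "?h x \<le> 0" for x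
  proof -
    have "0 \<le> \<theta> x - \<delta>" unfolding \<theta> sgn_frac using nonpos[OF that] by simp
    thus "\<delta> \<le> \<theta> x" by simp
    have "\<theta> x + \<delta> - 2 * pi \<le> 0" unfolding two sgn_frac using nonpos[OF that] by simp
    thus "\<theta> x \<le> 2 * pi - \<delta>" by simp
  qed
  have fold: "cos (\<theta> x) = cos (pi - \<bar>pi - \<theta> x\<bar>)" for x
    by (cases "\<theta> x \<le> pi") (auto simp: abs_if cos_2pi_minus)
  have cos_neg: "cos (\<theta> x) \<le> cos \<delta>" if "?h x \<le> 0" for x
    unfolding fold using lower[OF that] \<delta> by (intro cos_monotone_0_pi_le) (auto simp: abs_if)
  have cos_neg_strict: "n x = i2 \<or> n x = i1 + M" if "?h x \<le> 0" "cos (\<theta> x) = cos \<delta>" for x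
  proof (rule ccontr)
    assume c: "\<not> (n x = i2 \<or> n x = i1 + M)"
    have "0 < \<theta> x - \<delta>" unfolding \<theta> sgn_frac using nonpos[OF that(1)] c by auto
    moreover have "\<theta> x + \<delta> - 2 * pi < 0" unfolding two sgn_frac using nonpos[OF that(1)] c by auto
    ultimately have "cos (pi - \<bar>pi - \<theta> x\<bar>) < cos \<delta>" using \<delta> by (intro cos_monotone_0_pi) (auto simp: abs_if)
    thus False using that(2) fold[of x] by linarith
  qed
  have ph: "phase A B x = cis (2 * pi * of_int (n x) / of_int M)" if "x \<in> A \<union> B" for x
    unfolding n_def M_def by (rule phase_lift[OF sep nz[OF that] cis_half_lift[OF w nz[OF that]]])
  have Reph: "Re (cis (-\<psi>) * phase A B x) = cos (\<theta> x)" if "x \<in> A \<union> B" for x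
    using ph[OF that] by (simp add: cis_mult \<theta>_def)
  have disj: "A \<inter> B = {}" by (rule sep_disjoint[OF sep])
  have sumh: "(\<Sum>x\<in>A \<union> B. ?h x) = 0"
  proof -
    have "\<Sum>(A \<union> B) = \<Sum>A + \<Sum>B" using disj finA finB by (simp add: sum.union_disjoint)
    hence "\<Sum>(A \<union> B) = 0" using sums by simp
    hence "Im (cnj w * \<Sum>(A \<union> B)) = 0" by simp
    thus ?thesis by (simp only: sum_distrib_left Im_sum)
  qed
  have "(\<Sum>x\<in>A \<union> B. ?h x * (cos (\<theta> x) - cos \<delta>)) = (\<Sum>x\<in>A \<union> B. ?h x * cos (\<theta> x)) - cos \<delta> * (\<Sum>x\<in>A \<union> B. ?h x)"
    by (simp only: right_diff_distrib sum_subtractf sum_distrib_left mult.commute)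
  also have "(\<Sum>x\<in>A \<union> B. ?h x * cos (\<theta> x)) = (\<Sum>x\<in>A \<union> B. Re (cis (-\<psi>) * (of_real (?h x) * phase A B x)))"
  proof (rule sum.cong)
    fix x assume x: "x \<in> A \<union> B"
    have "cis (-\<psi>) * (of_real (?h x) * phase A B x) = of_real (?h x) * (cis (-\<psi>) * phase A B x)"
      by (rule mult.left_commute)
    hence "Re (cis (-\<psi>) * (of_real (?h x) * phase A B x)) = ?h x * Re (cis (-\<psi>) * phase A B x)"
      by (simp only: Re_complex_of_real Im_complex_of_real times_complex.sel)
    thus "?h x * cos (\<theta> x) = Re (cis (-\<psi>) * (of_real (?h x) * phase A B x))" using Reph[OF x] by simp
  qed simp
  also have "\<dots> = Re (cis (-\<psi>) * (\<Sum>x\<in>A \<union> B. of_real (?h x) * phase A B x))"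
    by (simp only: sum_distrib_left Re_sum)
  also have "\<dots> = 0" unfolding zero by simp
  finally have s0: "(\<Sum>x\<in>A \<union> B. ?h x * (cos (\<theta> x) - cos \<delta>)) = 0" using sumh by simp
  have nonneg: "?h x * (cos (\<theta> x) - cos \<delta>) \<ge> 0" if "x \<in> A \<union> B" for x
  proof (cases "?h x > 0")
    case True
    thus ?thesis using cos_pos[of x] that by (intro mult_nonneg_nonneg) (auto simp: Pos_def)
  next
    case False
    thus ?thesis using cos_neg[of x] by (intro mult_nonpos_nonpos) auto
  qed
  \<comment> \<open>A vanishing sum of nonnegative terms: off the line of \<open>w\<close>, only
    points in the extreme blocks remain.\<close>
  have all0: "?h x * (cos (\<theta> x) - cos \<delta>) = 0" if "x \<in> A \<union> B" for x
    using sum_nonneg_eq_0_iff[of "A \<union> B" "\<lambda>x. ?h x * (cos (\<theta> x) - cos \<delta>)"] s0 nonneg finA finB that by blast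
  have pos': "n x = i1 \<or> n x = i2" if "x \<in> A \<union> B" "?h x > 0" for x
    using all0[OF that(1)] that by (intro cos_pos_strict) (auto simp: Pos_def simp del: times_complex.sel)
  have neg': "n x = i2 \<or> n x = i1 + M" if "x \<in> A \<union> B" "?h x < 0" for x
    using all0[OF that(1)] that by (intro cos_neg_strict) (auto simp del: times_complex.sel)
  show False
  proof (cases "x1 \<in> A")
    case True
    show False
      by (rule two_block_contradiction[OF sep sums w n_def M_def True _ x1(2) i12 bp bn an pos' neg' less wrap ne])
         (use x1 in \<open>auto simp: Pos_def\<close>)
  next
    case False
    hence x1B: "x1 \<in> B" using x1 by (auto simp: Pos_def)
    have n_def': "n x = change_count (angles B) (angles A) (half_lift w x)" for x
      by (simp add: n_def change_count_commute)
    have M_def': "M = change_period (angles B) (angles A)" by (simp add: M_def change_period_commute)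
    have x1p: "?h x1 > 0" using x1 by (auto simp: Pos_def)
    have pos'': "n x = i1 \<or> n x = i2" if "x \<in> B \<union> A" "?h x > 0" for x using pos' that by blast
    have neg'': "n x = i2 \<or> n x = i1 + M" if "x \<in> B \<union> A" "?h x < 0" for x using neg' that by blast
    have less'': "n x < n y" if "x \<in> B \<and> y \<in> A \<or> x \<in> A \<and> y \<in> B" "?T x < ?T y" for x y using less that by blast
    have wrap'': "n y < n x + M" if "x \<in> B \<and> y \<in> A \<or> x \<in> A \<and> y \<in> B" for x y using wrap that by blast
    have ne'': "n x \<noteq> n y" if "x \<in> B" "y \<in> A" for x y using ne that by metis
    show False
      by (rule two_block_contradiction[OF sep_commute[OF sep] sums(2,1) w n_def' M_def' x1B x1p x1(2) i12 ap an bn pos'' neg'' less'' wrap'' ne''])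
  qed
qed

section \<open>Neither set lies on a line through the origin\<close>

text \<open>Expand \<open>x\<close> in the orthogonal basis \<open>w\<close>,
  \<open>\<i> * w\<close> and apply the functional belonging to \<open>u\<close>.\<close>

lemma plane_identity:
  "(norm w)\<^sup>2 * Im (cnj u * x) = Re (cnj w * x) * Im (cnj u * w) + Im (cnj w * x) * Re (cnj u * w)"
  by (simp add: cmod_power2) (simp add: algebra_simps power2_eq_square)

text \<open>If \<open>B\<close> lay on a line, take the lines through an extreme point of \<open>B\<close> in three other directions: a point of
  \<open>A\<close> on the middle one is cut off by the outer two.\<close>
lemma not_collinear_aux:
  assumes sep: "sep_from_origin A B" and w: "w \<noteq> 0" and col: "\<And>b. b \<in> B \<Longrightarrow> Im (cnj w * b) = 0"
    and u: "\<And>j. j \<in> {1,2,3::nat} \<Longrightarrow> Im (cnj (u j) * w) \<noteq> 0 \<and> line_paired (rot (u j) A) (rot (u j) B)"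
    and p_def: "\<And>j. p j = Re (cnj (u j) * w) / Im (cnj (u j) * w)"
    and p: "p 1 < p 2" "p 2 < p 3"
  shows False
proof -
  define \<alpha> where "\<alpha> x = Re (cnj w * x)" for x
  define \<beta> where "\<beta> x = Im (cnj w * x)" for x
  have finB: "finite B" "B \<noteq> {}" using sep by (auto simp: sep_from_origin_def)
  \<comment> \<open>In coordinates along and across \<open>w\<close>, the lines in direction
    \<open>u j\<close> are the level sets of \<open>\<alpha> + \<beta> * p j\<close>, up to a
    scalar.\<close>
  have same: "\<alpha> x + \<beta> x * p j = \<alpha> y + \<beta> y * p j"
    if "j \<in> {1,2,3}" "Im (cnj (u j) * x) = Im (cnj (u j) * y)" for j x y
  proof -
    have "\<alpha> z + \<beta> z * p j = (norm w)\<^sup>2 * Im (cnj (u j) * z) / Im (cnj (u j) * w)" for z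
      using u[OF that(1)] unfolding plane_identity[of w "u j" z] p_def \<alpha>_def \<beta>_def
      by (simp add: add_divide_distrib del: times_complex.sel)
    thus ?thesis using that(2) by simp
  qed
  have "Max (\<alpha> ` B) \<in> \<alpha> ` B" using finB by (intro Max_in) auto
  then obtain b where b: "b \<in> B" "\<alpha> b = Max (\<alpha> ` B)" by auto
  have bmax: "\<alpha> c \<le> \<alpha> b" if "c \<in> B" for c unfolding b(2) using finB that by (intro Max_ge) auto
  obtain a where a: "a \<in> A" "Im (cnj (u 2) * a) = Im (cnj (u 2) * b)"
    using u[of 2] b(1) by (auto simp: line_paired_def simp del: times_complex.sel)
  have \<beta>B: "\<beta> c = 0" if "c \<in> B" for c using col[OF that] by (simp add: \<beta>_def)
  have a2: "\<alpha> a + \<beta> a * p 2 = \<alpha> b" using same[of 2 a b] a(2) \<beta>B[OF b(1)] by simp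
  have aj: "\<alpha> a + \<beta> a * p j \<le> \<alpha> b" if j: "j \<in> {1,2,3}" for j
  proof -
    obtain c where c: "c \<in> B" "Im (cnj (u j) * c) = Im (cnj (u j) * a)"
      using u[OF j] a(1) by (auto simp: line_paired_def simp del: times_complex.sel)
    have "\<alpha> a + \<beta> a * p j = \<alpha> c" using same[OF j c(2)] \<beta>B[OF c(1)] by simp
    thus ?thesis using bmax[OF c(1)] by simp
  qed
  \<comment> \<open>As a function of the slope, \<open>\<alpha> a + \<beta> a * p\<close> attains
    its upper bound at the middle slope \<open>p 2\<close>, so it is constant.\<close>
  have "\<beta> a * (p 1 - p 2) \<le> 0" using aj[of 1] a2 by (simp add: right_diff_distrib)
  hence "0 \<le> \<beta> a" using p by (simp add: mult_le_0_iff)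
  moreover have "\<beta> a * (p 3 - p 2) \<le> 0" using aj[of 3] a2 by (simp add: right_diff_distrib)
  hence "\<beta> a \<le> 0" using p by (simp add: mult_le_0_iff)
  ultimately have "\<beta> a = 0" by simp
  hence "Re (cnj w * a) = Re (cnj w * b)" "Im (cnj w * a) = Im (cnj w * b)"
    using a2 \<beta>B[OF b(1)] by (simp_all add: \<alpha>_def \<beta>_def del: times_complex.sel)
  hence "cnj w * a = cnj w * b" by (rule complex_eqI)
  hence "a = b" using w by simp
  thus False using a(1) b(1) sep_disjoint[OF sep] by auto
qed

text \<open>At most one direction is parallel to \<open>w\<close>, so four directions leave three
  transversal ones; these are sorted by the cotangent \<open>p\<close> of their angle to
  \<open>w\<close>.\<close>

lemma not_collinear:
  assumes sep: "sep_from_origin A B" and w: "w \<noteq> 0"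
    and U: "finite U" "card U \<ge> 4" "\<And>u v. u \<in> U \<Longrightarrow> v \<in> U \<Longrightarrow> u \<noteq> v \<Longrightarrow> Im (cnj u * v) \<noteq> 0"
      "\<And>u. u \<in> U \<Longrightarrow> u \<noteq> 0 \<and> line_paired (rot u A) (rot u B)"
  shows "\<exists>x\<in>B. Im (cnj w * x) \<noteq> 0"
proof (rule ccontr)
  assume "\<not> (\<exists>x\<in>B. Im (cnj w * x) \<noteq> 0)"
  hence col: "\<And>b. b \<in> B \<Longrightarrow> Im (cnj w * b) = 0" by blast
  have w2: "(norm w)\<^sup>2 \<noteq> 0" using w by simp
  define p where "p u = Re (cnj u * w) / Im (cnj u * w)" for u
  define V where "V = {u\<in>U. Im (cnj u * w) \<noteq> 0}"
  have cross: "Im (cnj u * v) = 0" if "Re (cnj u * w) * Im (cnj v * w) = Re (cnj v * w) * Im (cnj u * w)" for u v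
  proof -
    have "(norm w)\<^sup>2 * Im (cnj u * v) = Re (cnj w * v) * Im (cnj u * w) + Im (cnj w * v) * Re (cnj u * w)"
      by (rule plane_identity)
    also have "Re (cnj w * v) = Re (cnj v * w)" by (simp add: mult.commute)
    also have "Im (cnj w * v) = - Im (cnj v * w)" by (simp add: mult.commute)
    finally have "(norm w)\<^sup>2 * Im (cnj u * v) = 0" using that by (simp add: mult.commute del: times_complex.sel)
    thus ?thesis using w2 by (simp del: times_complex.sel)
  qed
  have "card (U - V) \<le> 1"
  proof (rule ccontr)
    assume "\<not> card (U - V) \<le> 1"
    then obtain u v where "u \<in> U - V" "v \<in> U - V" "u \<noteq> v"
      using U(1) by (metis card_le_Suc0_iff_eq finite_Diff One_nat_def)
    thus False using cross[of u v] U(3) by (auto simp: V_def simp del: times_complex.sel)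
  qed
  moreover have "card (U - V) = card U - card V" using U(1) by (intro card_Diff_subset) (auto simp: V_def)
  ultimately have cV: "card V \<ge> 3" using U(2) by linarith
  have inj: "inj_on p V"
  proof (rule inj_onI, rule ccontr)
    fix u v assume uv: "u \<in> V" "v \<in> V" "p u = p v" "u \<noteq> v"
    hence "Re (cnj u * w) * Im (cnj v * w) = Re (cnj v * w) * Im (cnj u * w)"
      by (simp add: p_def V_def frac_eq_eq del: times_complex.sel)
    from cross[OF this] show False using uv U(3) by (auto simp: V_def simp del: times_complex.sel)
  qed
  have finV: "finite V" using U(1) by (simp add: V_def)
  define L where "L = sorted_list_of_set (p ` V)"
  have L: "sorted_wrt (<) L" "set L = p ` V" "length L \<ge> 3"
    using finV cV inj by (auto simp: L_def card_image strict_sorted_list_of_set)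
  have "L ! i \<in> p ` V" if "i < 3" for i using L nth_mem[of i L] that by simp
  hence "L ! 0 \<in> p ` V" "L ! 1 \<in> p ` V" "L ! 2 \<in> p ` V" by simp_all
  then obtain u1 u2 u3 where u: "u1 \<in> V" "u2 \<in> V" "u3 \<in> V" "p u1 = L ! 0" "p u2 = L ! 1" "p u3 = L ! 2"
    by auto
  have lt: "L ! 0 < L ! 1" "L ! 1 < L ! 2" using sorted_wrt_nth_less[OF L(1)] L(3) by auto
  define u where "u j = (if j = 1 then u1 else if j = 2 then u2 else u3)" for j :: nat
  show False
  proof (rule not_collinear_aux[OF sep w col, of u "\<lambda>j. p (u j)"])
    show "Im (cnj (u j) * w) \<noteq> 0 \<and> line_paired (rot (u j) A) (rot (u j) B)" if "j \<in> {1,2,3}" for j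
      using that u U(4) by (auto simp: u_def V_def simp del: times_complex.sel)
    show "p (u 1) < p (u 2)" "p (u 2) < p (u 3)" using u lt by (simp_all add: u_def)
  qed (simp_all add: p_def)
qed

text \<open>\<open>F\<close> is real linear, so it multiplies \<open>Im (cnj u * v)\<close> by its
  determinant \<open>\<delta>\<close>. The pairing gives \<open>F u = z u * cnj (F u)\<close>; hence
  \<open>z v - z u\<close> is \<open>Im (cnj u * v)\<close> up to factors that depend on
  \<open>u\<close> alone or on \<open>v\<close> alone, and such factors cancel in cross
  ratios.\<close>

theorem directions_from_roots_of_unity:
  assumes sep: "sep_from_origin A B" and sums: "\<Sum>A = 0" "\<Sum>B = 0"
    and U: "finite U" "card U \<ge> 4" "\<And>u v. u \<in> U \<Longrightarrow> v \<in> U \<Longrightarrow> u \<noteq> v \<Longrightarrow> Im (cnj u * v) \<noteq> 0"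
      "\<And>u. u \<in> U \<Longrightarrow> u \<noteq> 0"
    and \<sigma>: "\<And>u. u \<in> U \<Longrightarrow> \<exists>\<sigma>. bij_betw \<sigma> A B \<and> (\<forall>a\<in>A. Im (cnj u * \<sigma> a) = Im (cnj u * a))"
  obtains M :: nat and z :: "complex \<Rightarrow> complex" where "M > 0" "\<And>u. u \<in> U \<Longrightarrow> z u ^ M = 1" "inj_on z U"
    "\<And>u1 u2 u3 u4. u1 \<in> U \<Longrightarrow> u2 \<in> U \<Longrightarrow> u3 \<in> U \<Longrightarrow> u4 \<in> U \<Longrightarrow>
      of_real (Im (cnj u1 * u2) * Im (cnj u3 * u4)) * ((z u1 - z u3) * (z u2 - z u4)) =
      of_real (Im (cnj u1 * u3) * Im (cnj u2 * u4)) * ((z u1 - z u2) * (z u3 - z u4))"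
proof -
  define m where "m = change_period (angles A) (angles B)"
  have m: "m > 0" unfolding m_def by (rule change_period_pos[OF angles_angle_sets[OF sep]])
  have fin: "finite A" "finite B" and disj: "A \<inter> B = {}"
    using sep sep_disjoint[OF sep] by (auto simp: sep_from_origin_def)
  have pair: "line_paired (rot u A) (rot u B)" if u: "u \<in> U" for u
  proof -
    obtain \<sigma> where "bij_betw \<sigma> A B" "\<forall>a\<in>A. Im (cnj u * \<sigma> a) = Im (cnj u * a)" using \<sigma>[OF u] by blast
    thus ?thesis unfolding line_paired_def bij_betw_def by (auto simp del: times_complex.sel)
  qed
  have nz: "(\<Sum>x\<in>A \<union> B. of_real (Im (cnj w * x)) * phase A B x) \<noteq> 0" if w: "w \<noteq> 0" for w
  proof (rule first_mode_nonzero[OF sep sums w])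
    show "\<exists>x\<in>B. Im (cnj w * x) \<noteq> 0"
      by (rule not_collinear[OF sep w U(1-3)]) (use U(4) pair in auto)
    show "\<exists>x\<in>A. Im (cnj w * x) \<noteq> 0"
      by (rule not_collinear[OF sep_commute[OF sep] w U(1-3)]) (use U(4) pair line_paired_commute in auto)
  qed
  define F where "F w = (\<Sum>x\<in>A \<union> B. of_real (Im (cnj w * x)) * phase A B x)" for w
  define V where "V = (\<Sum>x\<in>A \<union> B. of_real (Re x) * phase A B x)"
  define W where "W = (\<Sum>x\<in>A \<union> B. of_real (Im x) * phase A B x)"
  define \<delta> where "\<delta> = Im (cnj V * W)"
  have F: "F w = of_real (Re w) * W - of_real (Im w) * V" for w
    by (simp add: F_def V_def W_def sum_distrib_left sum_subtractf[symmetric] algebra_simps)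
  have FF: "Im (cnj (F u) * F v) = \<delta> * Im (cnj u * v)" for u v
    by (simp add: F \<delta>_def algebra_simps)
  have \<delta>: "\<delta> \<noteq> 0"
  proof
    \<comment> \<open>With determinant zero, \<open>F (\<i> * u)\<close> would be a real multiple
      \<open>r\<close> of \<open>F u\<close>, and \<open>F\<close> would vanish at the nonzero
      vector \<open>(\<i> - r) * u\<close>.\<close>
    assume d0: "\<delta> = 0"
    obtain u where "u \<in> U" using U(2) by fastforce
    hence u0: "u \<noteq> 0" using U(4) by auto
    have im: "Im (cnj (F u) * F (\<i> * u)) = 0" by (simp add: FF d0 del: times_complex.sel)
    define r where "r = Re (cnj (F u) * F (\<i> * u)) / (norm (F u))\<^sup>2"
    have Fu: "F u \<noteq> 0" using nz[OF u0] by (simp add: F_def)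
    have re: "Re (cnj (F u) * F (\<i> * u)) = r * (norm (F u))\<^sup>2"
      using Fu by (simp add: r_def del: times_complex.sel)
    have "cnj (F u) * F (\<i> * u) = of_real (r * (norm (F u))\<^sup>2)"
      by (rule complex_eqI) (simp_all only: im re Re_complex_of_real Im_complex_of_real)
    also have "\<dots> = cnj (F u) * (of_real r * F u)" by (simp add: complex_norm_square mult_ac del: of_real_power)
    finally have "F (\<i> * u) = of_real r * F u" using Fu by simp
    hence "F (\<i> * u - of_real r * u) = 0" by (simp add: F algebra_simps)
    moreover have "\<i> * u - of_real r * u = (\<i> - of_real r) * u" by (simp add: algebra_simps)
    moreover have "\<i> - of_real r \<noteq> 0" by (simp add: complex_eq_iff)
    ultimately show False using nz[of "(\<i> - of_real r) * u"] u0 by (simp add: F_def)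
  qed
  have "\<exists>S::int. \<forall>a\<in>A. \<forall>b\<in>B. Im (cnj u * a) = Im (cnj u * b) \<longrightarrow>
      phase A B a * phase A B b = cis (2 * pi * of_int S / of_int m)" if u: "u \<in> U" for u
    using phase_product_constant[OF sep U(4)[OF u] pair[OF u]] unfolding m_def by metis
  then obtain S :: "complex \<Rightarrow> int" where S: "\<And>u a b. u \<in> U \<Longrightarrow> a \<in> A \<Longrightarrow> b \<in> B \<Longrightarrow> Im (cnj u * a) = Im (cnj u * b) \<Longrightarrow>
      phase A B a * phase A B b = cis (2 * pi * of_int (S u) / of_int m)" by metis
  define z where "z u = cis (2 * pi * of_int (S u) / of_int m)" for u
  have zF: "F u = z u * cnj (F u)" if u: "u \<in> U" for u
  proof -
    obtain \<sigma> where s: "bij_betw \<sigma> A B" "\<And>a. a \<in> A \<Longrightarrow> Im (cnj u * \<sigma> a) = Im (cnj u * a)" using \<sigma>[OF u] by blast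
    have "F u = (\<Sum>x\<in>A. of_real (Im (cnj u * x)) * phase A B x) + (\<Sum>x\<in>B. of_real (Im (cnj u * x)) * phase A B x)"
      unfolding F_def using fin disj by (rule sum.union_disjoint)
    also have "(\<Sum>x\<in>B. of_real (Im (cnj u * x)) * phase A B x) = (\<Sum>a\<in>A. of_real (Im (cnj u * \<sigma> a)) * phase A B (\<sigma> a))"
      by (rule sum.reindex_bij_betw[OF s(1), symmetric])
    also have "\<dots> = (\<Sum>a\<in>A. of_real (Im (cnj u * a)) * phase A B (\<sigma> a))"
      by (rule sum.cong) (simp_all only: s(2))
    finally have Fu: "F u = (\<Sum>a\<in>A. of_real (Im (cnj u * a)) * (phase A B a + phase A B (\<sigma> a)))"
      by (simp only: sum.distrib[symmetric] distrib_left)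
    \<comment> \<open>Two phases of modulus 1 with product \<open>z u\<close> are exchanged by
      conjugation followed by multiplication with \<open>z u\<close>.\<close>
    have swap: "z u * cnj (phase A B a + phase A B (\<sigma> a)) = phase A B a + phase A B (\<sigma> a)" if a: "a \<in> A" for a
    proof -
      have "\<sigma> a \<in> B" using s(1) a by (auto simp: bij_betw_def)
      hence "z u = phase A B a * phase A B (\<sigma> a)" using S[OF u a, of "\<sigma> a"] s(2)[OF a] by (simp add: z_def)
      moreover have "phase A B x * cnj (phase A B x) = 1" for x by (simp add: phase_def cis_cnj cis_mult)
      ultimately show ?thesis by (simp add: distrib_left mult.assoc mult.left_commute[of "phase A B a"])
    qed
    have "z u * cnj (F u) = (\<Sum>a\<in>A. of_real (Im (cnj u * a)) * (z u * cnj (phase A B a + phase A B (\<sigma> a))))"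
      unfolding Fu by (simp add: sum_distrib_left mult_ac del: times_complex.sel)
    also have "\<dots> = F u" unfolding Fu by (rule sum.cong) (simp_all only: swap)
    finally show ?thesis by simp
  qed
  have D: "2 * \<i> * of_real (\<delta> * Im (cnj u * v)) = cnj (F u) * cnj (F v) * (z v - z u)" if u: "u \<in> U" and v: "v \<in> U" for u v
  proof -
    have "2 * \<i> * of_real (Im (cnj (F u) * F v)) = cnj (F u) * F v - F u * cnj (F v)"
      by (simp add: complex_eq_iff)
    also have "\<dots> = cnj (F u) * (z v * cnj (F v)) - (z u * cnj (F u)) * cnj (F v)"
      by (simp only: zF[OF u, symmetric] zF[OF v, symmetric])
    also have "\<dots> = cnj (F u) * cnj (F v) * (z v - z u)" by (simp add: algebra_simps)
    finally show ?thesis by (simp only: FF)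
  qed
  show ?thesis
  proof (rule that[of "nat m" z])
    show "nat m > 0" using m by simp
    show "z u ^ nat m = 1" for u
    proof -
      have "z u ^ nat m = cis (real (nat m) * (2 * pi * of_int (S u) / of_int m))"
        unfolding z_def by (rule Complex.DeMoivre)
      also have "real (nat m) * (2 * pi * of_int (S u) / of_int m) = 0 + 2 * pi * of_int (S u)" using m by simp
      finally show ?thesis using cis_add_period[of 0 "S u"] by simp
    qed
    show "inj_on z U"
    proof (rule inj_onI, rule ccontr)
      fix u v assume uv: "u \<in> U" "v \<in> U" "z u = z v" "u \<noteq> v"
      hence "2 * \<i> * of_real (\<delta> * Im (cnj u * v)) = 0" using D[OF uv(1,2)] by simp
      hence "\<delta> * Im (cnj u * v) = 0" by (simp del: times_complex.sel)
      thus False using U(3)[OF uv(1,2,4)] \<delta> by simp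
    qed
    fix u1 u2 u3 u4 assume u: "u1 \<in> U" "u2 \<in> U" "u3 \<in> U" "u4 \<in> U"
    define d12 where "d12 = complex_of_real (Im (cnj u1 * u2))"
    define d34 where "d34 = complex_of_real (Im (cnj u3 * u4))"
    define d13 where "d13 = complex_of_real (Im (cnj u1 * u3))"
    define d24 where "d24 = complex_of_real (Im (cnj u2 * u4))"
    define c where "c = 2 * \<i> * complex_of_real \<delta>"
    have c: "c \<noteq> 0" using \<delta> by (simp add: c_def)
    have DD: "c * d12 = cnj (F u1) * cnj (F u2) * (z u2 - z u1)" "c * d34 = cnj (F u3) * cnj (F u4) * (z u4 - z u3)"
      "c * d13 = cnj (F u1) * cnj (F u3) * (z u3 - z u1)" "c * d24 = cnj (F u2) * cnj (F u4) * (z u4 - z u2)"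
      using D[OF u(1,2)] D[OF u(3,4)] D[OF u(1,3)] D[OF u(2,4)]
      unfolding c_def d12_def d34_def d13_def d24_def by (simp_all only: of_real_mult mult.assoc)
    have "(c * c) * (d12 * d34 * ((z u1 - z u3) * (z u2 - z u4))) = (c * d12) * (c * d34) * ((z u1 - z u3) * (z u2 - z u4))"
      by (simp only: ac_simps)
    also have "\<dots> = (c * d13) * (c * d24) * ((z u1 - z u2) * (z u3 - z u4))" 
    proof -
      have "f1 * f2 * (y2 - y1) * (f3 * f4 * (y4 - y3)) * ((y1 - y3) * (y2 - y4)) =
        f1 * f3 * (y3 - y1) * (f2 * f4 * (y4 - y2)) * ((y1 - y2) * (y3 - y4))" for f1 f2 f3 f4 y1 y2 y3 y4 :: complex
      proof -
        have e: "(y2 - y1) * (y4 - y3) = (y1 - y2) * (y3 - y4)" "(y3 - y1) * (y4 - y2) = (y1 - y3) * (y2 - y4)"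
          by (simp_all add: algebra_simps)
        have "f1 * f2 * (y2 - y1) * (f3 * f4 * (y4 - y3)) * ((y1 - y3) * (y2 - y4)) =
          f1 * f2 * f3 * f4 * ((y2 - y1) * (y4 - y3)) * ((y1 - y3) * (y2 - y4))" by (simp only: ac_simps)
        also have "\<dots> = f1 * f2 * f3 * f4 * ((y1 - y2) * (y3 - y4)) * ((y3 - y1) * (y4 - y2))" by (simp only: e)
        also have "\<dots> = f1 * f3 * (y3 - y1) * (f2 * f4 * (y4 - y2)) * ((y1 - y2) * (y3 - y4))" by (simp only: ac_simps)
        finally show ?thesis .
      qed
      thus ?thesis unfolding DD .
    qed
    also have "\<dots> = (c * c) * (d13 * d24 * ((z u1 - z u2) * (z u3 - z u4)))" by (simp only: ac_simps)
    finally have "d12 * d34 * ((z u1 - z u3) * (z u2 - z u4)) = d13 * d24 * ((z u1 - z u2) * (z u3 - z u4))"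
      using c by simp
    thus "of_real (Im (cnj u1 * u2) * Im (cnj u3 * u4)) * ((z u1 - z u3) * (z u2 - z u4)) =
      of_real (Im (cnj u1 * u3) * Im (cnj u2 * u4)) * ((z u1 - z u2) * (z u3 - z u4))"
      unfolding d12_def d34_def d13_def d24_def by (simp only: of_real_mult)
  qed
qed

subsection \<open>Cyclotomic fields and Delone sets\<close>

lemma subfield_complexI:
  assumes "1 \<in> K" "\<And>x. x \<in> K \<Longrightarrow> - x \<in> K" "\<And>x y. x \<in> K \<Longrightarrow> y \<in> K \<Longrightarrow> x + y \<in> K"
    "\<And>x y. x \<in> K \<Longrightarrow> y \<in> K \<Longrightarrow> x * y \<in> K" "\<And>x. x \<in> K \<Longrightarrow> x \<noteq> 0 \<Longrightarrow> inverse x \<in> K"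
  shows "subfield K (ring_of_type_algebra :: complex ring)"
proof -
  let ?R = "ring_of_type_algebra :: complex ring"
  interpret R: field ?R by (rule field_from_type_algebra)
  have ops: "carrier ?R = UNIV" "\<one>\<^bsub>?R\<^esub> = 1" "\<zero>\<^bsub>?R\<^esub> = 0" "x \<oplus>\<^bsub>?R\<^esub> y = x + y" "x \<otimes>\<^bsub>?R\<^esub> y = x * y" for x y
    by (simp_all add: ring_of_type_algebra_def)
  have minus: "\<ominus>\<^bsub>?R\<^esub> x = - x" for x
    using R.minus_equality[of "- x" x] by (simp add: ops)
  have inv: "inv\<^bsub>?R\<^esub> x = inverse x" if "x \<noteq> 0" for x
    using R.inv_unique'[of x "inverse x"] that by (simp add: ops)
  have "subring K ?R" using assms by (intro R.subringI) (auto simp: ops minus)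
  thus ?thesis using assms(5) inv by (intro R.subfieldI') (auto simp: ops)
qed

lemma subfield_complexD:
  assumes "subfield K (ring_of_type_algebra :: complex ring)"
  shows "1 \<in> K" "x \<in> K \<Longrightarrow> y \<in> K \<Longrightarrow> x + y \<in> K"
    "x \<in> K \<Longrightarrow> y \<in> K \<Longrightarrow> x * y \<in> K" "x \<in> K \<Longrightarrow> x \<noteq> 0 \<Longrightarrow> inverse x \<in> K"
proof -
  let ?R = "ring_of_type_algebra :: complex ring"
  interpret R: field ?R by (rule field_from_type_algebra)
  have ops: "carrier ?R = UNIV" "\<one>\<^bsub>?R\<^esub> = 1" "\<zero>\<^bsub>?R\<^esub> = 0" "x \<oplus>\<^bsub>?R\<^esub> y = x + y" "x \<otimes>\<^bsub>?R\<^esub> y = x * y" for x y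
    by (simp_all add: ring_of_type_algebra_def)
  have inv: "inv\<^bsub>?R\<^esub> x = inverse x" if "x \<noteq> 0" for x
    using R.inv_unique'[of x "inverse x"] that by (simp add: ops)
  have S: "subring K ?R" using assms by (rule subfieldE(1))
  show "1 \<in> K" using subringE(3)[OF S] by (simp add: ops)
  show "x + y \<in> K" if "x \<in> K" "y \<in> K" using subringE(7)[OF S that] by (simp add: ops)
  show "x * y \<in> K" if "x \<in> K" "y \<in> K" using subringE(6)[OF S that] by (simp add: ops)
  show "inverse x \<in> K" if "x \<in> K" "x \<noteq> 0"
    using R.subfield_m_inv(1)[OF assms, of x] that inv by (simp add: ops)
qed

lemma cyclotomic_field_eq:
  assumes n: "n > 0"
  shows "cyclotomic_field n = {a / b | a b. a \<in> cyclotomic_int n \<and> b \<in> cyclotomic_int n \<and> b \<noteq> 0}" (is "_ = ?K")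
  unfolding cyclotomic_field_def smallest_subfield_def
proof (rule hull_unique)
  have exp: "exp (2 * of_real pi * \<i> / of_nat n) = root_unity n"
    by (simp add: root_unity_def cis_conv_exp mult_ac)
  have in_K: "a / b \<in> ?K" if "a \<in> cyclotomic_int n" "b \<in> cyclotomic_int n" "b \<noteq> 0" for a b
    using that by blast
  have int_K: "a \<in> ?K" if "a \<in> cyclotomic_int n" for a
    using in_K[OF that cyclotomic_int_1] by simp
  show "\<rat> \<union> {exp (2 * of_real pi * \<i> / of_nat n)} \<subseteq> ?K"
  proof
    fix x assume "x \<in> \<rat> \<union> {exp (2 * of_real pi * \<i> / of_nat n)}"
    then consider "x \<in> \<rat>" | "x = root_unity n" by (auto simp: exp)
    thus "x \<in> ?K"
    proof cases
      case 1
      then obtain r where "x = of_rat r" by (elim Rats_cases)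
      moreover obtain a b where "r = Rat.Fract a b" "b > 0" by (metis Rat_cases)
      ultimately have "x = of_int a / of_int b" "(of_int b :: complex) \<noteq> 0"
        by (simp_all add: of_rat_rat)
      thus ?thesis using in_K[OF cyclotomic_int_of_int[of a] cyclotomic_int_of_int[of b]] by simp
    qed (use int_K[OF root_unity_in_cyclotomic_int] in simp)
  qed
  show "subfield ?K (ring_of_type_algebra :: complex ring)"
  proof (rule subfield_complexI)
    show "1 \<in> ?K" by (rule int_K[OF cyclotomic_int_1])
    fix x assume "x \<in> ?K"
    then obtain a b where x: "x = a / b" "a \<in> cyclotomic_int n" "b \<in> cyclotomic_int n" "b \<noteq> 0" by blast
    have "- a \<in> cyclotomic_int n" using cyclotomic_int_diff[OF cyclotomic_int_0 x(2)] by simp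
    from in_K[OF this x(3,4)] show "- x \<in> ?K" by (simp add: x(1))
    show "inverse x \<in> ?K" if "x \<noteq> 0"
      using in_K[OF x(3,2)] that x(1) by simp
    fix y assume "y \<in> ?K"
    then obtain c d where y: "y = c / d" "c \<in> cyclotomic_int n" "d \<in> cyclotomic_int n" "d \<noteq> 0" by blast
    have "x + y = (a * d + c * b) / (b * d)" using x y by (simp add: field_simps)
    moreover have "(a * d + c * b) / (b * d) \<in> ?K"
      using x y by (intro in_K cyclotomic_int_add cyclotomic_int_mult) auto
    ultimately show "x + y \<in> ?K" by simp
    have "x * y = (a * c) / (b * d)" using x y by simp
    moreover have "(a * c) / (b * d) \<in> ?K" using x y by (intro in_K cyclotomic_int_mult) auto
    ultimately show "x * y \<in> ?K" by simp
  qed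
  fix L assume L: "\<rat> \<union> {exp (2 * of_real pi * \<i> / of_nat n)} \<subseteq> L" "subfield L (ring_of_type_algebra :: complex ring)"
  note D = subfield_complexD[OF L(2)]
  have "ieval p (root_unity n) \<in> L" for p
  proof (induction p)
    case (pCons a p)
    have "of_int a \<in> L" "root_unity n \<in> L" using L(1) Rats_of_int[of a] exp by auto
    thus ?case using pCons D by auto
  qed (use L(1) in auto)
  hence "a \<in> L" if "a \<in> cyclotomic_int n" for a using that by (auto simp: cyclotomic_int_def)
  thus "?K \<subseteq> L" using D by (auto simp: divide_inverse)
qed

lemma cyclotomic_field_closed:
  assumes n: "n > 0"
  shows "x \<in> cyclotomic_field n \<Longrightarrow> y \<in> cyclotomic_field n \<Longrightarrow> x + y \<in> cyclotomic_field n"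
    "x \<in> cyclotomic_field n \<Longrightarrow> y \<in> cyclotomic_field n \<Longrightarrow> x - y \<in> cyclotomic_field n"
    "x \<in> cyclotomic_field n \<Longrightarrow> y \<in> cyclotomic_field n \<Longrightarrow> x * y \<in> cyclotomic_field n"
    "x \<in> cyclotomic_field n \<Longrightarrow> y \<in> cyclotomic_field n \<Longrightarrow> x / y \<in> cyclotomic_field n"
    "x \<in> cyclotomic_field n \<Longrightarrow> cnj x \<in> cyclotomic_field n"
    "x \<in> cyclotomic_int n \<Longrightarrow> x \<in> cyclotomic_field n"
proof -
  let ?K = "cyclotomic_field n"
  note eq = cyclotomic_field_eq[OF n]
  have in_K: "a / b \<in> ?K" if "a \<in> cyclotomic_int n" "b \<in> cyclotomic_int n" "b \<noteq> 0" for a b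
    unfolding eq using that by blast
  show int_K: "a \<in> ?K" if "a \<in> cyclotomic_int n" for a
    using in_K[OF that cyclotomic_int_1] by simp
  show "cnj x \<in> ?K" if xK: "x \<in> ?K"
  proof -
    obtain a b where x: "x = a / b" "a \<in> cyclotomic_int n" "b \<in> cyclotomic_int n" "b \<noteq> 0"
      using xK unfolding eq by blast
    thus ?thesis by (auto intro!: in_K cyclotomic_int_cnj n)
  qed
  assume "x \<in> ?K" "y \<in> ?K"
  then obtain a b c d where x: "x = a / b" "a \<in> cyclotomic_int n" "b \<in> cyclotomic_int n" "b \<noteq> 0"
    and y: "y = c / d" "c \<in> cyclotomic_int n" "d \<in> cyclotomic_int n" "d \<noteq> 0" unfolding eq by blast
  have "x + y = (a * d + c * b) / (b * d)" using x y by (simp add: field_simps)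
  thus "x + y \<in> ?K" using x y by (auto intro!: in_K cyclotomic_int_add cyclotomic_int_mult)
  have "x - y = (a * d - c * b) / (b * d)" using x y by (simp add: field_simps)
  thus "x - y \<in> ?K" using x y by (auto intro!: in_K cyclotomic_int_diff cyclotomic_int_mult)
  have "x * y = (a * c) / (b * d)" using x y by simp
  thus "x * y \<in> ?K" using x y by (auto intro!: in_K cyclotomic_int_mult)
  show "x / y \<in> ?K"
  proof (cases "c = 0")
    case True
    thus ?thesis using y int_K[OF cyclotomic_int_0] by simp
  next
    case False
    have "x / y = (a * d) / (b * c)" using x y by simp
    thus ?thesis using x y False by (auto intro!: in_K cyclotomic_int_mult)
  qed
qed

section \<open>Directions and X-rays in coordinates\<close>

lemma parallel_sym: "parallel u v \<Longrightarrow> parallel v u"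
proof -
  assume "parallel u v"
  then obtain c :: real where "c \<noteq> 0" "u = of_real c * v" by (auto simp: parallel_def)
  thus ?thesis unfolding parallel_def by (intro exI[of _ "1 / c"]) simp
qed

lemma nonparallel_Im:
  assumes "u \<noteq> 0" "v \<noteq> 0" "\<not> parallel u v"
  shows "Im (cnj u * v) \<noteq> 0"
proof
  assume im: "Im (cnj u * v) = 0"
  define r where "r = Re (cnj u * v)"
  have r: "cnj u * v = of_real r" unfolding r_def by (rule complex_eqI) (simp_all only: im Re_complex_of_real Im_complex_of_real)
  have r0: "r \<noteq> 0" using r assms(1,2) by auto
  have "of_real r * u = (u * cnj u) * v" by (simp only: r[symmetric] ac_simps)
  also have "\<dots> = of_real ((norm u)\<^sup>2) * v" by (simp only: complex_norm_square)
  finally have "of_real r * u = of_real ((norm u)\<^sup>2) * v" .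
  hence "u = of_real ((norm u)\<^sup>2) * v / of_real r" using r0 by (metis nonzero_mult_div_cancel_left of_real_eq_0_iff)
  hence "u = of_real ((norm u)\<^sup>2 / r) * v" by (simp only: of_real_divide times_divide_eq_left)
  moreover have "(norm u)\<^sup>2 / r \<noteq> 0" using r0 assms(1) by simp
  ultimately show False using assms(3) unfolding parallel_def by blast
qed

lemma parallel_Im:
  assumes "parallel u v"
  shows "Im (cnj u * v) = 0"
  using assms by (auto simp: parallel_def)

text \<open>A quotient \<open>a / b\<close> is a positive real multiple of \<open>a * cnj b\<close>,
  so each direction has an integral representative.\<close>

lemma strong_direction_int:
  assumes n: "n > 0" and S: "strong_cyclotomic_delone_set n \<Lambda>" and u: "u \<in> directions_of \<Lambda>"
  obtains v and c :: real where "v \<in> cyclotomic_int n" "v \<noteq> 0" "c \<noteq> 0" "u = of_real c * v"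
proof -
  obtain w c where w: "w \<in> difference_set \<Lambda>" "w \<noteq> 0" "c \<noteq> (0::real)" "u = of_real c * w"
    using u by (auto simp: directions_of_def parallel_def)
  have "w \<in> delone_field \<Lambda>" unfolding delone_field_def smallest_subfield_def using w(1) by (intro hull_inc) auto
  hence "w \<in> cyclotomic_field n" using S by (simp add: strong_cyclotomic_delone_set_def)
  then obtain a b where ab: "w = a / b" "a \<in> cyclotomic_int n" "b \<in> cyclotomic_int n" "b \<noteq> 0"
    unfolding cyclotomic_field_eq[OF n] by blast
  have "w = of_real (1 / (norm b)\<^sup>2) * (a * cnj b)"
  proof -
    have "of_real ((norm b)\<^sup>2) * w = b * cnj b * w" by (simp only: complex_norm_square)
    also have "\<dots> = a * cnj b" using ab by simp
    finally show ?thesis using ab(4) by (simp add: field_simps del: of_real_power)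
  qed
  hence "u = of_real (c * (1 / (norm b)\<^sup>2)) * (a * cnj b)" using w(4) by (simp only: of_real_mult mult.assoc)
  moreover have "a * cnj b \<in> cyclotomic_int n" using ab n by (intro cyclotomic_int_mult cyclotomic_int_cnj)
  moreover have "a * cnj b \<noteq> 0" using ab w(2) by auto
  ultimately show ?thesis using that[of "a * cnj b" "c * (1 / (norm b)\<^sup>2)"] w(3) ab(4) by simp
qed

text \<open>A homothety carrying \<open>0\<close> and \<open>w\<close> into the set makes a positive
  multiple of \<open>w\<close> a difference of two of its points.\<close>

lemma strong_direction_sgn:
  assumes S: "strong_cyclotomic_delone_set n \<Lambda>" and n: "n > 0" and w: "w \<in> cyclotomic_field n" "w \<noteq> 0"
  shows "sgn w \<in> directions_of \<Lambda>"
proof -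
  have K: "delone_field \<Lambda> = cyclotomic_field n" using S by (simp add: strong_cyclotomic_delone_set_def)
  have "{0, w} \<subseteq> delone_field \<Lambda>"
    unfolding K using w cyclotomic_field_closed(6)[OF n cyclotomic_int_0] by auto
  then obtain h where h: "homothety h" "h ` {0, w} \<subseteq> \<Lambda>"
    using S unfolding strong_cyclotomic_delone_set_def by (metis finite.emptyI finite.insertI)
  then obtain c t where c: "c > 0" "h = (\<lambda>z. of_real c * z + t)" by (auto simp: homothety_def)
  have "of_real c * w \<in> difference_set \<Lambda>"
  proof -
    have "h w \<in> \<Lambda>" "h 0 \<in> \<Lambda>" "of_real c * w = h w - h 0" using h(2) by (auto simp: c(2))
    thus ?thesis unfolding difference_set_def by blast
  qed
  moreover have "parallel (sgn w) (of_real c * w)"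
    unfolding parallel_def
    using w(2) c(1) by (intro exI[of _ "1 / (norm w * c)"]) (simp add: sgn_eq)
  moreover have "of_real c * w \<noteq> 0" using w(2) c(1) by simp
  ultimately show ?thesis using w(2) unfolding directions_of_def by (auto simp: norm_sgn)
qed

lemma line_in_direction_eq:
  assumes "u \<noteq> 0"
  shows "range (\<lambda>t::real. z + of_real t * u) = {y. Im (cnj u * y) = Im (cnj u * z)}"
proof (intro subset_antisym subsetI)
  fix y assume "y \<in> range (\<lambda>t::real. z + of_real t * u)"
  then obtain t :: real where y: "y = z + of_real t * u" by blast
  have "cnj u * y = cnj u * z + of_real (t * (norm u)\<^sup>2)"
    unfolding y of_real_mult complex_norm_square by (simp add: algebra_simps)
  thus "y \<in> {y. Im (cnj u * y) = Im (cnj u * z)}" by (simp del: times_complex.sel of_real_mult of_real_power)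
next
  fix y assume "y \<in> {y. Im (cnj u * y) = Im (cnj u * z)}"
  hence im: "Im (cnj u * (y - z)) = 0" by (simp add: algebra_simps)
  define r where "r = Re (cnj u * (y - z))"
  have r: "cnj u * (y - z) = of_real r" unfolding r_def by (rule complex_eqI) (simp_all only: im Re_complex_of_real Im_complex_of_real)
  have "of_real ((norm u)\<^sup>2) * (y - z) = of_real r * u" by (simp only: complex_norm_square r[symmetric] ac_simps)
  moreover have "complex_of_real ((norm u)\<^sup>2) \<noteq> 0" using assms by simp
  ultimately have "y - z = of_real r * u / of_real ((norm u)\<^sup>2)" by (metis nonzero_mult_div_cancel_left)
  hence "y = z + of_real r * u / of_real ((norm u)\<^sup>2)" by (metis add.commute diff_add_cancel)
  hence "y = z + of_real (r / (norm u)\<^sup>2) * u" by (simp only: of_real_divide times_divide_eq_left)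
  thus "y \<in> range (\<lambda>t::real. z + of_real t * u)" by blast
qed

lemma line_level_card:
  assumes u: "u \<noteq> 0" and X: "X_ray u F = X_ray u G"
  shows "card {x \<in> F. Im (cnj u * x) = h} = card {x \<in> G. Im (cnj u * x) = h}"
proof -
  \<comment> \<open>The point at level \<open>h\<close> on the normal to \<open>u\<close> through
    the origin.\<close>
  define z where "z = \<i> * of_real (h / (norm u)\<^sup>2) * u"
  have "cnj u * z = \<i> * of_real (h / (norm u)\<^sup>2) * (u * cnj u)" by (simp only: z_def ac_simps)
  also have "\<dots> = \<i> * of_real h" using u by (simp flip: complex_norm_square)
  finally have z: "Im (cnj u * z) = h" by (simp only:) simp
  define l where "l = range (\<lambda>t::real. z + of_real t * u)"
  have l: "l = {y. Im (cnj u * y) = h}" unfolding l_def line_in_direction_eq[OF u] z ..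
  have "l \<in> lines_in_direction u" by (auto simp: l_def lines_in_direction_def)
  hence "card (F \<inter> l) = card (G \<inter> l)" using fun_cong[OF X, of l] by (simp add: X_ray_def)
  moreover have "S \<inter> l = {x \<in> S. Im (cnj u * x) = h}" for S using l by auto
  ultimately show ?thesis by simp
qed

lemma fiberwise_bijection:
  assumes fin: "finite A" "finite B" and card: "\<And>h. card {a\<in>A. f a = h} = card {b\<in>B. g b = h}"
  shows "\<exists>\<sigma>. bij_betw \<sigma> A B \<and> (\<forall>a\<in>A. g (\<sigma> a) = f a)"
proof -
  have "\<exists>s. bij_betw s {a\<in>A. f a = h} {b\<in>B. g b = h}" for h
    using fin card by (intro finite_same_card_bij) auto
  then obtain s where s: "\<And>h. bij_betw (s h) {a\<in>A. f a = h} {b\<in>B. g b = h}" by metis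
  define \<sigma> where "\<sigma> a = s (f a) a" for a
  have \<sigma>: "\<sigma> a \<in> B \<and> g (\<sigma> a) = f a" if "a \<in> A" for a
    using bij_betw_apply[OF s, of a "f a"] that by (auto simp: \<sigma>_def)
  have "inj_on \<sigma> A"
  proof (rule inj_onI)
    fix x y assume xy: "x \<in> A" "y \<in> A" "\<sigma> x = \<sigma> y"
    hence "f x = f y" using \<sigma> by metis
    thus "x = y" using xy bij_betw_imp_inj_on[OF s[of "f x"]] by (auto simp: \<sigma>_def inj_on_def)
  qed
  moreover have "\<sigma> ` A = B"
  proof
    show "\<sigma> ` A \<subseteq> B" using \<sigma> by auto
    show "B \<subseteq> \<sigma> ` A"
    proof
      fix b assume "b \<in> B"
      hence "b \<in> s (g b) ` {a\<in>A. f a = g b}" using s[of "g b"] by (auto simp: bij_betw_def)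
      then obtain a where "a \<in> A" "f a = g b" "b = s (g b) a" by blast
      hence "b = \<sigma> a" by (simp add: \<sigma>_def)
      thus "b \<in> \<sigma> ` A" using \<open>a \<in> A\<close> by blast
    qed
  qed
  ultimately show ?thesis using \<sigma> by (auto simp: bij_betw_def)
qed

text \<open>Take the two differences of the convex subsets; deleting the common points preserves
  equality of X-rays. Two nonparallel directions force equal sums, hence a common centroid, which
  becomes the origin. It lies in both hulls, so adjoining it does not enlarge them.\<close>

lemma undetermined_separated_sets:
  assumes ud: "uniform_discrete \<Lambda>" and U: "\<And>u. u \<in> U \<Longrightarrow> u \<noteq> 0"
    and uv: "u0 \<in> U" "v0 \<in> U" "Im (cnj u0 * v0) \<noteq> 0" and nd: "\<not> determined_by \<Lambda> U"
  obtains A B where "sep_from_origin A B" "\<Sum>A = 0" "\<Sum>B = 0"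
    "\<And>u. u \<in> U \<Longrightarrow> \<exists>\<sigma>. bij_betw \<sigma> A B \<and> (\<forall>a\<in>A. Im (cnj u * \<sigma> a) = Im (cnj u * a))"
proof -
  obtain C C' where C: "convex_subset \<Lambda> C" "convex_subset \<Lambda> C'" "C \<noteq> C'"
    and XX: "\<And>u. u \<in> U \<Longrightarrow> X_ray u C = X_ray u C'" using nd unfolding determined_by_def by blast
  have fin: "finite C" "finite C'"
    using C ud uniform_discrete_subset uniform_discrete_finite_iff unfolding convex_subset_def by metis+
  define A0 where "A0 = C - C'"
  define B0 where "B0 = C' - C"
  have fin0: "finite A0" "finite B0" using fin by (auto simp: A0_def B0_def)
  have bij: "\<exists>\<sigma>. bij_betw \<sigma> A0 B0 \<and> (\<forall>a\<in>A0. Im (cnj u * \<sigma> a) = Im (cnj u * a))" if u: "u \<in> U" for u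
  proof (rule fiberwise_bijection[OF fin0])
    fix h
    let ?L = "{y. Im (cnj u * y) = h}"
    have eq: "card {x\<in>C. Im (cnj u * x) = h} = card {x\<in>C'. Im (cnj u * x) = h}"
      by (rule line_level_card[OF U[OF u] XX[OF u]])
    have A: "{a\<in>A0. Im (cnj u * a) = h} = {x\<in>C. Im (cnj u * x) = h} - {x\<in>C \<inter> C'. Im (cnj u * x) = h}"
      by (auto simp: A0_def)
    have B: "{a\<in>B0. Im (cnj u * a) = h} = {x\<in>C'. Im (cnj u * x) = h} - {x\<in>C \<inter> C'. Im (cnj u * x) = h}"
      by (auto simp: B0_def)
    have fI: "finite {x\<in>C \<inter> C'. Im (cnj u * x) = h}" using fin by auto
    have "card {a\<in>A0. Im (cnj u * a) = h} = card {x\<in>C. Im (cnj u * x) = h} - card {x\<in>C \<inter> C'. Im (cnj u * x) = h}"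
      unfolding A by (rule card_Diff_subset[OF fI]) auto
    moreover have "card {a\<in>B0. Im (cnj u * a) = h} = card {x\<in>C'. Im (cnj u * x) = h} - card {x\<in>C \<inter> C'. Im (cnj u * x) = h}"
      unfolding B by (rule card_Diff_subset[OF fI]) auto
    ultimately show "card {a\<in>A0. Im (cnj u * a) = h} = card {b\<in>B0. Im (cnj u * b) = h}" using eq by simp
  qed
  obtain \<sigma>0 where \<sigma>0: "bij_betw \<sigma>0 A0 B0" using bij[OF uv(1)] by blast
  have cards: "card A0 = card B0" using \<sigma>0 by (rule bij_betw_same_card)
  have ne: "A0 \<noteq> {}" "B0 \<noteq> {}"
  proof -
    have "A0 = {} \<longleftrightarrow> B0 = {}" using cards fin0 by (metis card_0_eq)
    moreover have "A0 \<noteq> {} \<or> B0 \<noteq> {}" using C(3) by (auto simp: A0_def B0_def)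
    ultimately show "A0 \<noteq> {}" "B0 \<noteq> {}" by blast+
  qed
  have hsum: "Im (cnj u * \<Sum>A0) = Im (cnj u * \<Sum>B0)" if u: "u \<in> U" for u
  proof -
    obtain \<sigma> where s: "bij_betw \<sigma> A0 B0" "\<And>a. a \<in> A0 \<Longrightarrow> Im (cnj u * \<sigma> a) = Im (cnj u * a)" using bij[OF u] by blast
    have "Im (cnj u * \<Sum>B0) = (\<Sum>b\<in>B0. Im (cnj u * b))" by (simp only: sum_distrib_left Im_sum)
    also have "\<dots> = (\<Sum>a\<in>A0. Im (cnj u * \<sigma> a))" by (rule sum.reindex_bij_betw[OF s(1), symmetric])
    also have "\<dots> = (\<Sum>a\<in>A0. Im (cnj u * a))" by (rule sum.cong) (simp_all only: s(2))
    also have "\<dots> = Im (cnj u * \<Sum>A0)" by (simp only: sum_distrib_left Im_sum)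
    finally show ?thesis by simp
  qed
  have sums: "\<Sum>A0 = \<Sum>B0"
  proof -
    define d where "d = \<Sum>A0 - \<Sum>B0"
    have d: "Im (cnj u0 * d) = 0" "Im (cnj v0 * d) = 0"
      using hsum[OF uv(1)] hsum[OF uv(2)] by (simp_all add: d_def right_diff_distrib del: times_complex.sel)
    have "(norm d)\<^sup>2 * Im (cnj u0 * v0) = Re (cnj d * v0) * Im (cnj u0 * d) + Im (cnj d * v0) * Re (cnj u0 * d)"
      by (rule plane_identity)
    also have "Im (cnj d * v0) = - Im (cnj v0 * d)" by (simp add: mult.commute)
    finally have "(norm d)\<^sup>2 * Im (cnj u0 * v0) = 0" unfolding d by simp
    hence "d = 0" using uv(3) by (simp del: times_complex.sel)
    thus ?thesis by (simp add: d_def)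
  qed
  define o' where "o' = \<Sum>A0 / of_nat (card A0)"
  have oB: "o' = \<Sum>B0 / of_nat (card B0)" by (simp add: o'_def sums cards)
  have centroid: "\<Sum>S / of_nat (card S) \<in> convex hull S" if "finite S" "S \<noteq> {}" for S :: "complex set"
  proof -
    have "(\<Sum>x\<in>S. (1 / real (card S)) *\<^sub>R x) \<in> convex hull S"
      using that by (intro convex_sum) (auto simp: convex_convex_hull hull_inc)
    also have "(\<Sum>x\<in>S. (1 / real (card S)) *\<^sub>R x) = \<Sum>S / of_nat (card S)"
      by (simp add: scaleR_conv_of_real sum_divide_distrib)
    finally show ?thesis .
  qed
  define A where "A = (\<lambda>x. x - o') ` A0"
  define B where "B = (\<lambda>x. x - o') ` B0"
  have tr: "x - o' \<notin> convex hull (insert 0 ((\<lambda>x. x - o') ` S))"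
    if "x \<in> \<Lambda>" "x \<notin> D" "D = convex hull D \<inter> \<Lambda>" "S \<subseteq> D" "o' \<in> convex hull S" for x S D
  proof
    assume "x - o' \<in> convex hull (insert 0 ((\<lambda>x. x - o') ` S))"
    also have "insert 0 ((\<lambda>x. x - o') ` S) = (\<lambda>x. - o' + x) ` (insert o' S)" by auto
    finally have "x - o' \<in> (\<lambda>x. - o' + x) ` (convex hull (insert o' S))" by (simp only: convex_hull_translation)
    hence "x \<in> convex hull (insert o' S)" by auto
    also have "\<dots> = convex hull S" using that(5) by (simp add: hull_redundant)
    also have "\<dots> \<subseteq> convex hull D" using that(4) by (rule hull_mono)
    finally show False using that by blast
  qed
  have CC: "C \<subseteq> \<Lambda>" "C = convex hull C \<inter> \<Lambda>" "C' \<subseteq> \<Lambda>" "C' = convex hull C' \<inter> \<Lambda>"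
    using C unfolding convex_subset_def by auto
  have sep: "sep_from_origin A B"
    unfolding sep_from_origin_def
  proof (intro conjI)
    show "finite A" "finite B" "A \<noteq> {}" "B \<noteq> {}" using fin0 ne by (auto simp: A_def B_def)
    have "x - o' \<notin> convex hull (insert 0 B)" if "x \<in> A0" for x
      unfolding B_def
      by (rule tr[of x C' B0]) (use that CC centroid[OF fin0(2) ne(2)] oB in \<open>auto simp: A0_def B0_def\<close>)
    thus "A \<inter> convex hull (insert 0 B) = {}" by (auto simp: A_def)
    have "x - o' \<notin> convex hull (insert 0 A)" if "x \<in> B0" for x
      unfolding A_def
      by (rule tr[of x C A0]) (use that CC centroid[OF fin0(1) ne(1)] o'_def in \<open>auto simp: A0_def B0_def\<close>)
    thus "B \<inter> convex hull (insert 0 A) = {}" by (auto simp: B_def)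
  qed
  have inj: "inj_on (\<lambda>x. x - o') S" for S by (auto simp: inj_on_def)
  have zero: "\<Sum>((\<lambda>x. x - o') ` S) = 0" if "o' = \<Sum>S / of_nat (card S)" "finite S" "S \<noteq> {}" for S
  proof -
    have "\<Sum>((\<lambda>x. x - o') ` S) = (\<Sum>x\<in>S. x - o')" by (simp add: sum.reindex[OF inj])
    also have "\<dots> = \<Sum>S - of_nat (card S) * o'" by (simp add: sum_subtractf)
    also have "\<dots> = 0" using that by simp
    finally show ?thesis .
  qed
  show ?thesis
  proof (rule that[OF sep])
    show "\<Sum>A = 0" unfolding A_def by (rule zero[OF o'_def fin0(1) ne(1)])
    show "\<Sum>B = 0" unfolding B_def by (rule zero[OF oB fin0(2) ne(2)])
    fix u assume "u \<in> U"
    then obtain \<sigma> where s: "bij_betw \<sigma> A0 B0" "\<And>a. a \<in> A0 \<Longrightarrow> Im (cnj u * \<sigma> a) = Im (cnj u * a)" using bij by blast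
    have b1: "bij_betw (\<lambda>x. x + o') A A0" by (rule bij_betw_byWitness[where f' = "\<lambda>x. x - o'"]) (auto simp: A_def)
    have b2: "bij_betw (\<lambda>x. x - o') B0 B" by (simp add: bij_betw_def inj B_def)
    have "bij_betw ((\<lambda>x. x - o') \<circ> \<sigma> \<circ> (\<lambda>x. x + o')) A B"
      using bij_betw_trans[OF b1 bij_betw_trans[OF s(1) b2]] by (simp add: comp_assoc)
    moreover have "Im (cnj u * ((\<lambda>x. x - o') \<circ> \<sigma> \<circ> (\<lambda>x. x + o')) a) = Im (cnj u * a)" if "a \<in> A" for a
    proof -
      have "a + o' \<in> A0" using that by (auto simp: A_def)
      from s(2)[OF this] show ?thesis by (simp add: algebra_simps)
    qed
    ultimately show "\<exists>\<sigma>. bij_betw \<sigma> A B \<and> (\<forall>a\<in>A. Im (cnj u * \<sigma> a) = Im (cnj u * a))" by blast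
  qed
qed

theorem undetermined_roots_of_unity:
  assumes ud: "uniform_discrete \<Lambda>" and U: "finite U" "card U \<ge> 4" "\<And>u. u \<in> U \<Longrightarrow> u \<noteq> 0"
    "pairwise (\<lambda>u v. \<not> parallel u v) U" and nd: "\<not> determined_by \<Lambda> U"
  obtains M :: nat and z :: "complex \<Rightarrow> complex" where "M > 0" "\<And>u. u \<in> U \<Longrightarrow> z u ^ M = 1" "inj_on z U"
    "\<And>u1 u2 u3 u4. u1 \<in> U \<Longrightarrow> u2 \<in> U \<Longrightarrow> u3 \<in> U \<Longrightarrow> u4 \<in> U \<Longrightarrow>
      of_real (Im (cnj u1 * u2) * Im (cnj u3 * u4)) * ((z u1 - z u3) * (z u2 - z u4)) =
      of_real (Im (cnj u1 * u3) * Im (cnj u2 * u4)) * ((z u1 - z u2) * (z u3 - z u4))"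
proof -
  have np: "Im (cnj u * v) \<noteq> 0" if "u \<in> U" "v \<in> U" "u \<noteq> v" for u v
    using U(3)[OF that(1)] U(3)[OF that(2)] U(4) that by (intro nonparallel_Im) (auto simp: pairwise_def)
  obtain u0 v0 where uv: "u0 \<in> U" "v0 \<in> U" "u0 \<noteq> v0"
  proof -
    have "\<not> card U \<le> Suc 0" using U(2) by simp
    thus ?thesis using that U(1) by (auto simp: card_le_Suc0_iff_eq)
  qed
  obtain A B where AB: "sep_from_origin A B" "\<Sum>A = 0" "\<Sum>B = 0"
    "\<And>u. u \<in> U \<Longrightarrow> \<exists>\<sigma>. bij_betw \<sigma> A B \<and> (\<forall>a\<in>A. Im (cnj u * \<sigma> a) = Im (cnj u * a))"
    using undetermined_separated_sets[OF ud U(3) uv(1,2) np[OF uv] nd] by blast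
  show ?thesis
    by (rule directions_from_roots_of_unity[OF AB(1-3) U(1,2) np U(3) AB(4)]) (use that in blast)+
qed

subsection \<open>Dihedral polygons\<close>

lemma Im_of_real_mult: "Im (of_real c * w) = c * Im w"
  by simp

lemma strong_uniform_discrete: "strong_cyclotomic_delone_set n \<Lambda> \<Longrightarrow> uniform_discrete \<Lambda>"
  by (simp add: strong_cyclotomic_delone_set_def delone_set_def)

text \<open>Points in convex position are extreme in their hull, and a convex set stays convex when
  an extreme point is removed.\<close>

lemma convex_subset_remove_vertices:
  assumes W: "finite W" "W \<subseteq> \<Lambda>" "\<And>x. x \<in> W \<Longrightarrow> x \<notin> convex hull (W - {x})" and W1: "W1 \<subseteq> W"
  shows "convex_subset \<Lambda> (convex hull W \<inter> \<Lambda> - W1)"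
proof -
  let ?C = "convex hull W \<inter> \<Lambda> - W1"
  have bd: "bounded (convex hull W)" using W(1) by (intro bounded_convex_hull finite_imp_bounded)
  have "x \<in> ?C" if x: "x \<in> convex hull ?C" "x \<in> \<Lambda>" for x
  proof -
    have "convex hull ?C \<subseteq> convex hull W" by (rule hull_minimal) (auto simp: convex_convex_hull)
    moreover have "x \<notin> W1"
    proof
      assume "x \<in> W1"
      hence "x extreme_point_of (convex hull W)"
        using extreme_point_of_convex_hull_convex_independent[OF finite_imp_compact[OF W(1)] W(3)] W1 by blast
      hence cv: "convex (convex hull W - {x})" using extreme_point_of_stillconvex[OF convex_convex_hull] by blast
      have "convex hull ?C \<subseteq> convex hull W - {x}" using \<open>x \<in> W1\<close> by (intro hull_minimal cv) auto
      thus False using x(1) by auto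
    qed
    ultimately show ?thesis using x by blast
  qed
  hence "?C = convex hull ?C \<inter> \<Lambda>" using hull_subset[of ?C convex] by blast
  moreover have "bounded ?C" using bd by (rule bounded_subset) auto
  ultimately show ?thesis unfolding convex_subset_def by blast
qed

text \<open>A homothety moves the vertices into the set. The two convex subsets consist of the
  points of the set in the polygon, without \<open>W1\<close> or without \<open>W2\<close>; all
  other points contribute equally to every X-ray.\<close>

lemma undetermined_from_polygon:
  assumes S: "strong_cyclotomic_delone_set n \<Lambda>" and fin: "finite V1" "finite V2"
    and disj: "V1 \<inter> V2 = {}" "V1 \<noteq> {}" and K: "V1 \<union> V2 \<subseteq> cyclotomic_field n"
    and ext: "\<And>x. x \<in> V1 \<union> V2 \<Longrightarrow> x \<notin> convex hull (V1 \<union> V2 - {x})"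
    and U: "\<And>u. u \<in> U \<Longrightarrow> u \<noteq> 0"
    and card: "\<And>u k. u \<in> U \<Longrightarrow> card {x\<in>V1. Im (cnj u * x) = k} = card {x\<in>V2. Im (cnj u * x) = k}"
  shows "\<not> determined_by \<Lambda> U"
proof -
  have "\<exists>h. homothety h \<and> h ` (V1 \<union> V2) \<subseteq> \<Lambda>"
    using S K fin unfolding strong_cyclotomic_delone_set_def by (metis finite_UnI)
  then obtain h where h: "homothety h" "h ` (V1 \<union> V2) \<subseteq> \<Lambda>" by blast
  then obtain c t where c: "c > 0" "h = (\<lambda>z. of_real c * z + t)" by (auto simp: homothety_def)
  have injh: "inj h" using c by (auto simp: inj_def)
  have hull: "convex hull (h ` T) = h ` (convex hull T)" for T
  proof -
    have "h ` T = (\<lambda>y. t + y) ` ((\<lambda>z. c *\<^sub>R z) ` T)" for T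
      by (auto simp: c(2) image_image scaleR_conv_of_real add.commute)
    thus ?thesis by (simp only: convex_hull_translation convex_hull_scaling)
  qed
  define W1 where "W1 = h ` V1"
  define W2 where "W2 = h ` V2"
  define W where "W = W1 \<union> W2"
  have WV: "W = h ` (V1 \<union> V2)" by (simp add: W_def W1_def W2_def image_Un)
  have finW: "finite W" unfolding WV using fin by simp
  have extW: "x \<notin> convex hull (W - {x})" if xW: "x \<in> W" for x
  proof -
    obtain y where y: "x = h y" "y \<in> V1 \<union> V2" using xW by (auto simp: WV)
    have "W - {x} = h ` (V1 \<union> V2 - {y})" unfolding WV y(1) using injh by (auto simp: inj_def)
    thus ?thesis using ext[OF y(2)] injh unfolding hull y(1) by (auto simp: hull inj_image_mem_iff)
  qed
  define P where "P = convex hull W \<inter> \<Lambda>"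
  have finP: "finite P"
  proof -
    have "bounded P" unfolding P_def using finW
      by (intro bounded_subset[OF bounded_convex_hull[OF finite_imp_bounded]]) auto
    moreover have "uniform_discrete P"
      using strong_uniform_discrete[OF S] by (rule uniform_discrete_subset) (simp add: P_def)
    ultimately show ?thesis using uniform_discrete_finite_iff by blast
  qed
  have WP: "W \<subseteq> P" unfolding P_def using h(2) hull_subset[of W convex] by (auto simp: WV)
  have conv: "convex_subset \<Lambda> (P - W1)" "convex_subset \<Lambda> (P - W2)"
    unfolding P_def using h(2) extW by (auto intro!: convex_subset_remove_vertices finW simp: W_def[symmetric] WV[symmetric])
       (auto simp: W_def)
  have ne: "P - W1 \<noteq> P - W2"
  proof -
    obtain x where x: "x \<in> V1" using disj by blast
    have "h x \<in> P" using WP x by (auto simp: W_def W1_def)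
    moreover have "h x \<notin> W2" using x disj injh by (auto simp: W2_def inj_def)
    moreover have "h x \<in> W1" using x by (auto simp: W1_def)
    ultimately show ?thesis by blast
  qed
  have "X_ray u (P - W1) = X_ray u (P - W2)" if u: "u \<in> U" for u
    unfolding X_ray_def
  proof (rule restrict_ext)
    fix l assume "l \<in> lines_in_direction u"
    then obtain z where "l = range (\<lambda>t::real. z + of_real t * u)" by (auto simp: lines_in_direction_def)
    then obtain k where l: "l = {y. Im (cnj u * y) = k}" using line_in_direction_eq[OF U[OF u]] by blast
    define k' where "k' = (k - Im (cnj u * t)) / c"
    have hk: "Im (cnj u * h x) = k \<longleftrightarrow> Im (cnj u * x) = k'" for x
    proof -
      have "cnj u * h x = of_real c * (cnj u * x) + cnj u * t" by (simp add: c(2) algebra_simps)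
      hence "Im (cnj u * h x) = c * Im (cnj u * x) + Im (cnj u * t)" by (simp del: times_complex.sel add: Im_of_real_mult)
      thus ?thesis using c(1) by (auto simp: k'_def field_simps simp del: times_complex.sel)
    qed
    have img: "card ((h ` V) \<inter> l) = card {x\<in>V. Im (cnj u * x) = k'}" for V
    proof -
      have "(h ` V) \<inter> l = h ` {x\<in>V. Im (cnj u * x) = k'}" using hk unfolding l by blast
      thus ?thesis using injh by (simp add: card_image inj_on_subset)
    qed
    have cW: "card (W1 \<inter> l) = card (W2 \<inter> l)" unfolding W1_def W2_def img by (rule card[OF u])
    have "card ((P - W1) \<inter> l) = card (P \<inter> l) - card (W1 \<inter> l)"
      using finW WP by (subst card_Diff_subset[symmetric]) (auto simp: W_def intro!: arg_cong[of _ _ "Finite_Set.card"])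
    moreover have "card ((P - W2) \<inter> l) = card (P \<inter> l) - card (W2 \<inter> l)"
      using finW WP by (subst card_Diff_subset[symmetric]) (auto simp: W_def intro!: arg_cong[of _ _ "Finite_Set.card"])
    ultimately show "card ((P - W1) \<inter> l) = card ((P - W2) \<inter> l)" using cW by simp
  qed
  thus ?thesis using conv ne unfolding determined_by_def by blast
qed

text \<open>The tangent at \<open>x\<close> strictly separates \<open>x\<close> from the other
  points of the circle.\<close>

lemma circle_convex_position:
  assumes "\<And>y. y \<in> S \<Longrightarrow> norm y = norm (x :: complex)"
  shows "x \<notin> convex hull (S - {x})"
proof -
  have "S - {x} \<subseteq> {y. inner x y < inner x x}"
  proof
    fix y assume y: "y \<in> S - {x}"
    hence "0 < inner (x - y) (x - y)" by auto
    also have "inner (x - y) (x - y) = inner x x - 2 * inner x y + inner y y"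
      by (simp add: inner_diff_left inner_diff_right inner_commute)
    also have "inner y y = inner x x" using assms[of y] y by (simp add: power2_norm_eq_inner[symmetric])
    finally show "y \<in> {y. inner x y < inner x x}" by simp
  qed
  hence "convex hull (S - {x}) \<subseteq> {y. inner x y < inner x x}" by (intro hull_minimal convex_halfspace_lt)
  thus ?thesis by auto
qed

text \<open>The normals to the \<open>N\<close> reflection axes of the dihedral group generated by \<open>root_unity N\<close> and conjugation.\<close>
definition axis_normal :: "nat \<Rightarrow> nat \<Rightarrow> complex" where
  "axis_normal N k = \<i> * cis (pi * k / N)"

definition axis_reflection :: "nat \<Rightarrow> nat \<Rightarrow> complex \<Rightarrow> complex" where
  "axis_reflection N k x = cis (2 * pi * k / N) * cnj x"

lemma reflection_difference:
  "x - axis_reflection N k x = of_real (2 * Im (cnj (cis (pi * k / N)) * x)) * axis_normal N k"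
proof -
  define e where "e = cis (pi * k / N)"
  have ee: "e * cnj e = 1" by (simp add: e_def cis_cnj cis_mult)
  have e2: "cis (2 * pi * k / N) = e * e" by (simp add: e_def cis_mult mult.assoc)
  have "of_real (2 * Im w) * \<i> = w - cnj w" for w by (simp add: complex_eq_iff)
  hence "of_real (2 * Im (cnj e * x)) * axis_normal N k = (cnj e * x - cnj (cnj e * x)) * e"
    by (simp only: axis_normal_def e_def[symmetric] mult.assoc[symmetric])
  also have "\<dots> = (e * cnj e) * x - e * e * cnj x" by (simp add: algebra_simps)
  finally show ?thesis by (simp add: axis_reflection_def e2 ee e_def[symmetric])
qed

lemma reflection_involution: "axis_reflection N k (axis_reflection N k x) = x"
  by (simp add: axis_reflection_def cis_cnj cis_mult flip: mult.assoc)

lemma cis_root: "N > 0 \<Longrightarrow> cis (2 * pi * k / N) ^ N = 1" for k N :: nat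
  by (simp add: root_unity_power[symmetric] power_mult[symmetric] mult.commute[of k]) (simp add: power_mult)

lemma norm_unity: "w ^ N = 1 \<Longrightarrow> N > 0 \<Longrightarrow> norm (w::complex) = 1"
  by (metis norm_ge_zero norm_one norm_power power_eq_1_iff not_gr_zero)

text \<open>The dihedral orbit splits into the rotation orbits \<open>S1\<close> of \<open>z\<close>
  and \<open>S2\<close> of \<open>cnj z\<close>, which are disjoint because \<open>z ^ N\<close> is
  not real. Each reflection exchanges them along lines parallel to its normal; \<open>\<phi>\<close>
  preserves this and the convex position.\<close>

lemma dihedral_undetermined:
  assumes S: "strong_cyclotomic_delone_set n \<Lambda>" and \<phi>: "linear \<phi>" "inj \<phi>"
    and N: "N > 0" and z: "Im (z ^ N) \<noteq> 0"
    and K: "\<And>w. w ^ N = 1 \<Longrightarrow> \<phi> (w * z) \<in> cyclotomic_field n \<and> \<phi> (w * cnj z) \<in> cyclotomic_field n"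
    and U: "\<And>u. u \<in> U \<Longrightarrow> u \<noteq> 0 \<and> (\<exists>k. \<exists>r::real. u = of_real r * \<phi> (axis_normal N k))"
  shows "\<not> determined_by \<Lambda> U"
proof -
  define S1 where "S1 = (\<lambda>w. w * z) ` {w. w ^ N = 1}"
  define S2 where "S2 = (\<lambda>w. w * cnj z) ` {w. w ^ N = 1}"
  have finR: "finite {w::complex. w ^ N = 1}" using N by (intro finite_roots_unity) auto
  have fin: "finite S1" "finite S2" using finR by (auto simp: S1_def S2_def)
  have norm: "norm x = norm z" if "x \<in> S1 \<union> S2" for x
    using that norm_unity[OF _ N] by (auto simp: S1_def S2_def norm_mult)
  have disj: "S1 \<inter> S2 = {}"
  proof (rule ccontr)
    assume "S1 \<inter> S2 \<noteq> {}"
    then obtain w w' where "w ^ N = 1" "w' ^ N = 1" "w * z = w' * cnj z" by (auto simp: S1_def S2_def)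
    hence "z ^ N = cnj (z ^ N)" by (metis complex_cnj_power mult_1 power_mult_distrib)
    hence "Im (z ^ N) = - Im (z ^ N)" by (metis cnj.sel(2))
    thus False using z by simp
  qed
  have ne: "S1 \<noteq> {}" using power_one[of N] unfolding S1_def by blast
  show ?thesis
  proof (rule undetermined_from_polygon[OF S, of "\<phi> ` S1" "\<phi> ` S2"])
    show "finite (\<phi> ` S1)" "finite (\<phi> ` S2)" using fin by auto
    show "\<phi> ` S1 \<inter> \<phi> ` S2 = {}" using disj \<phi>(2) by (simp add: image_Int[symmetric])
    show "\<phi> ` S1 \<noteq> {}" using ne by simp
    show "\<phi> ` S1 \<union> \<phi> ` S2 \<subseteq> cyclotomic_field n" using K by (auto simp: S1_def S2_def)
    show "x \<notin> convex hull (\<phi> ` S1 \<union> \<phi> ` S2 - {x})" if xS: "x \<in> \<phi> ` S1 \<union> \<phi> ` S2" for x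
    proof -
      obtain y where y: "x = \<phi> y" "y \<in> S1 \<union> S2" using xS by auto
      have "\<phi> ` S1 \<union> \<phi> ` S2 - {x} = \<phi> ` (S1 \<union> S2 - {y})" unfolding y(1) using \<phi>(2) by (auto simp: inj_def)
      moreover have "y \<notin> convex hull (S1 \<union> S2 - {y})" using norm y(2) by (intro circle_convex_position) auto
      ultimately show ?thesis using \<phi> y(1) by (simp add: convex_hull_linear_image[symmetric] inj_image_mem_iff)
    qed
    show "u \<noteq> 0" if "u \<in> U" for u using U[OF that] by blast
    fix u h assume "u \<in> U"
    then obtain k r where u: "u = of_real r * \<phi> (axis_normal N k)" using U by blast
    define f where "f x = Im (cnj u * \<phi> x)" for x
    define \<rho> where "\<rho> = axis_reflection N k"
    have f\<rho>: "f (\<rho> x) = f x" for x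
    proof -
      obtain s :: real where "x - \<rho> x = of_real s * axis_normal N k" unfolding \<rho>_def using reflection_difference by blast
      hence "\<phi> x - \<phi> (\<rho> x) = s *\<^sub>R \<phi> (axis_normal N k)"
        by (metis linear_diff[OF \<phi>(1)] linear_scale[OF \<phi>(1)] scaleR_conv_of_real)
      hence d: "\<phi> x - \<phi> (\<rho> x) = of_real s * \<phi> (axis_normal N k)" by (simp only: scaleR_conv_of_real)
      have "cnj u * \<phi> x - cnj u * \<phi> (\<rho> x) = cnj u * (\<phi> x - \<phi> (\<rho> x))" by (simp only: right_diff_distrib)
      also have "\<dots> = of_real (r * s) * (\<phi> (axis_normal N k) * cnj (\<phi> (axis_normal N k)))"
        unfolding d u by (simp add: mult_ac)
      also have "\<dots> = of_real (r * s * (norm (\<phi> (axis_normal N k)))\<^sup>2)" by (simp only: complex_norm_square[symmetric] of_real_mult)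
      finally have "Im (cnj u * \<phi> x - cnj u * \<phi> (\<rho> x)) = 0" by (simp only: Im_complex_of_real)
      thus ?thesis by (simp add: f_def)
    qed
    have \<rho>1: "\<rho> x \<in> S2" if x1: "x \<in> S1" for x
    proof -
      obtain w where w: "x = w * z" "w ^ N = 1" using x1 by (auto simp: S1_def)
      have "\<rho> x = (cis (2 * pi * k / N) * cnj w) * cnj z" by (simp add: \<rho>_def axis_reflection_def w(1))
      moreover have "(cis (2 * pi * k / N) * cnj w) ^ N = 1"
        using cis_root[OF N, of k] w(2) by (simp add: power_mult_distrib flip: complex_cnj_power)
      ultimately show ?thesis unfolding S2_def by blast
    qed
    have \<rho>2: "\<rho> x \<in> S1" if x2: "x \<in> S2" for x
    proof -
      obtain w where w: "x = w * cnj z" "w ^ N = 1" using x2 by (auto simp: S2_def)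
      have "\<rho> x = (cis (2 * pi * k / N) * cnj w) * z" by (simp add: \<rho>_def axis_reflection_def w(1))
      moreover have "(cis (2 * pi * k / N) * cnj w) ^ N = 1"
        using cis_root[OF N, of k] w(2) by (simp add: power_mult_distrib flip: complex_cnj_power)
      ultimately show ?thesis unfolding S1_def by blast
    qed
    have \<rho>\<rho>: "\<rho> (\<rho> x) = x" for x unfolding \<rho>_def by (rule reflection_involution)
    have "bij_betw \<rho> {x\<in>S1. f x = h} {x\<in>S2. f x = h}"
      by (rule bij_betw_byWitness[where f' = \<rho>]) (auto simp: f\<rho> \<rho>1 \<rho>2 \<rho>\<rho>)
    hence eq: "card {x\<in>S1. f x = h} = card {x\<in>S2. f x = h}" by (rule bij_betw_same_card)
    have img: "card {y\<in>\<phi> ` T. Im (cnj u * y) = h} = card {x\<in>T. f x = h}" for T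
    proof -
      have "{y\<in>\<phi> ` T. Im (cnj u * y) = h} = \<phi> ` {x\<in>T. f x = h}" by (auto simp: f_def)
      thus ?thesis using \<phi>(2) by (simp add: card_image inj_on_subset)
    qed
    show "card {x\<in>\<phi> ` S1. Im (cnj u * x) = h} = card {x\<in>\<phi> ` S2. Im (cnj u * x) = h}"
      unfolding img by (rule eq)
  qed
qed

lemma real_multiple_direction:
  assumes S: "strong_cyclotomic_delone_set n \<Lambda>" and n: "n > 0"
    and r: "of_real r * w \<in> cyclotomic_field n" "r \<noteq> 0" "w \<noteq> 0"
  shows "sgn w \<in> directions_of \<Lambda>"
proof (cases "r > 0")
  case True
  have "sgn (of_real r * w) = sgn w" using True by (simp add: sgn_mult sgn_of_real)
  thus ?thesis using strong_direction_sgn[OF S n r(1)] r by simp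
next
  case False
  have "0 - of_real r * w \<in> cyclotomic_field n"
    using r(1) cyclotomic_field_closed(2,6)[OF n] cyclotomic_int_0 by blast
  moreover have "sgn (0 - of_real r * w) = sgn w" using False r by (simp add: sgn_mult sgn_of_real sgn_minus)
  ultimately show ?thesis using strong_direction_sgn[OF S n, of "0 - of_real r * w"] r by simp
qed

lemma sgn_eq_of_real: "sgn w = of_real (1 / norm w) * (w::complex)"
  by (simp add: sgn_eq)

text \<open>The image of \<open>z\<close> minus its mirror image lies in the field and is a nonzero
  real multiple of the image of the axis normal; so the \<open>N\<close> normals yield directions of
  the set.\<close>

lemma dihedral_directions:
  assumes S: "strong_cyclotomic_delone_set n \<Lambda>" and n: "n > 0" and \<phi>: "linear \<phi>" "inj \<phi>"
    and N: "N > 0" and z: "Im (z ^ N) \<noteq> 0"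
    and K: "\<And>w. w ^ N = 1 \<Longrightarrow> \<phi> (w * z) \<in> cyclotomic_field n \<and> \<phi> (w * cnj z) \<in> cyclotomic_field n"
  shows "\<exists>U. nonparallel_directions \<Lambda> U \<and> card U = N \<and> (\<forall>U'\<subseteq>U. \<not> determined_by \<Lambda> U')"
proof -
  define D where "D k = \<phi> (axis_normal N k)" for k
  have D0: "D k \<noteq> 0" for k
  proof
    assume "D k = 0"
    hence "\<phi> (axis_normal N k) = \<phi> 0" by (simp add: D_def linear_0[OF \<phi>(1)])
    hence "axis_normal N k = 0" using \<phi>(2) by (auto simp: inj_def)
    thus False by (simp add: axis_normal_def)
  qed
  have nonpar: "\<not> parallel (sgn (D j)) (sgn (D k))" if "j < N" "k < N" "j \<noteq> k" for j k
  proof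
    assume "parallel (sgn (D j)) (sgn (D k))"
    then obtain c :: real where "sgn (D j) = of_real c * sgn (D k)" by (auto simp: parallel_def)
    hence "of_real (norm (D j)) * sgn (D j) = of_real (norm (D j) * c / norm (D k)) * D k" by (simp add: sgn_eq)
    hence "D j = (norm (D j) * c / norm (D k)) *\<^sub>R D k" using D0[of j] by (simp add: sgn_eq scaleR_conv_of_real)
    then obtain s where "\<phi> (axis_normal N j) = s *\<^sub>R \<phi> (axis_normal N k)" unfolding D_def by blast
    hence "\<phi> (axis_normal N j) = \<phi> (s *\<^sub>R axis_normal N k)" by (simp add: linear_scale[OF \<phi>(1)])
    hence "axis_normal N j = s *\<^sub>R axis_normal N k" using \<phi>(2) by (auto simp: inj_def)
    hence "cis (pi * j / N) = of_real s * cis (pi * k / N)" by (simp add: axis_normal_def scaleR_conv_of_real mult.left_commute)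
    hence "cis (pi * j / N) * cis (- (pi * k / N)) = of_real s * (cis (pi * k / N) * cis (- (pi * k / N)))" by (simp only: mult.assoc)
    hence "cis (pi * j / N - pi * k / N) = of_real s" by (simp only: cis_mult) simp
    hence "sin (pi * j / N - pi * k / N) = 0" by (metis Im_complex_of_real cis.sel(2))
    moreover have "pi * j / N - pi * k / N = pi * (real j - real k) / N" by (simp add: diff_divide_distrib right_diff_distrib)
    ultimately have "sin (pi * (real j - real k) / N) = 0" by simp
    then obtain i :: int where "pi * (real j - real k) / N = of_int i * pi" using sin_zero_iff_int2 by blast
    hence "pi * (real j - real k) = pi * (of_int i * real N)" using N by (simp add: divide_eq_eq mult_ac)
    hence "real j - real k = of_int i * real N" by (simp only: mult_cancel_left) simp
    hence i: "int j - int k = i * int N" by (metis of_int_diff of_int_eq_iff of_int_mult of_int_of_nat_eq)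
    have "\<bar>int j - int k\<bar> < int N" using that by auto
    hence "i = 0" unfolding i using N by (simp add: abs_mult)
    thus False using i that by simp
  qed
  define U where "U = (\<lambda>k. sgn (D k)) ` {..<N}"
  have refl: "parallel (sgn (D k)) (sgn (D k))" for k by (auto simp: parallel_def intro!: exI[of _ 1])
  have inj: "inj_on (\<lambda>k. sgn (D k)) {..<N}"
    by (rule inj_onI) (metis nonpar refl lessThan_iff)
  have dir: "sgn (D k) \<in> directions_of \<Lambda>" for k
  proof -
    define r where "r = 2 * Im (cnj (cis (pi * k / N)) * z)"
    have diff: "z - axis_reflection N k z = of_real r * axis_normal N k" unfolding r_def by (rule reflection_difference)
    have "of_real r * D k = \<phi> (1 * z) - \<phi> (cis (2 * pi * k / N) * cnj z)"
    proof -
      have "of_real r * D k = \<phi> (r *\<^sub>R axis_normal N k)"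
        unfolding D_def linear_scale[OF \<phi>(1)] by (rule scaleR_conv_of_real[symmetric])
      also have "r *\<^sub>R axis_normal N k = z - axis_reflection N k z" by (simp only: diff scaleR_conv_of_real)
      finally show ?thesis by (simp add: linear_diff[OF \<phi>(1)] axis_reflection_def)
    qed
    moreover have "\<phi> (1 * z) \<in> cyclotomic_field n" using K[of 1] by simp
    moreover have "\<phi> (cis (2 * pi * k / N) * cnj z) \<in> cyclotomic_field n" using K[OF cis_root[OF N]] by blast
    ultimately have "of_real r * D k \<in> cyclotomic_field n" using cyclotomic_field_closed(2)[OF n] by simp
    moreover have "r \<noteq> 0"
    proof
      assume "r = 0"
      hence "z = cis (2 * pi * k / N) * cnj z" using diff by (simp add: axis_reflection_def)
      hence "z ^ N = cnj (z ^ N)" by (metis cis_root[OF N] complex_cnj_power mult_1 power_mult_distrib)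
      hence "Im (z ^ N) = - Im (z ^ N)" by (metis cnj.sel(2))
      thus False using z by simp
    qed
    ultimately show ?thesis by (rule real_multiple_direction[OF S n _ _ D0])
  qed
  have "nonparallel_directions \<Lambda> U"
    unfolding nonparallel_directions_def U_def using dir nonpar by (auto simp: pairwise_def)
  moreover have "card U = N" unfolding U_def by (simp add: card_image[OF inj])
  moreover have "\<not> determined_by \<Lambda> U'" if U': "U' \<subseteq> U" for U'
  proof (rule dihedral_undetermined[OF S \<phi> N z K])
    fix u assume "u \<in> U'"
    then obtain k where k: "u = sgn (D k)" using U' by (auto simp: U_def)
    show "u \<noteq> 0 \<and> (\<exists>k. \<exists>r::real. u = of_real r * \<phi> (axis_normal N k))"
      using D0[of k] sgn_eq_of_real[of "D k"] unfolding k D_def[symmetric] sgn_zero_iff by blast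
  qed
  ultimately show ?thesis by blast
qed

text \<open>The polynomials \<open>(X + \<zeta>)^N\<close> and \<open>(X + cnj \<zeta>)^N\<close>
  differ, so they agree at only finitely many natural numbers.\<close>

lemma generic_translate:
  assumes N: "N > 0" and \<zeta>: "Im \<zeta> \<noteq> 0"
  obtains q :: nat where "Im ((of_nat q + \<zeta>) ^ N) \<noteq> 0"
proof -
  define p where "p = [:\<zeta>, 1:] ^ N - [:cnj \<zeta>, 1:] ^ N"
  have "poly p (- \<zeta>) = - ((cnj \<zeta> - \<zeta>) ^ N)" using N by (simp add: p_def zero_power)
  moreover have "cnj \<zeta> - \<zeta> \<noteq> 0" using \<zeta> by (simp add: complex_eq_iff)
  ultimately have "p \<noteq> 0" by auto
  hence "finite {x. poly p x = 0}" by (rule poly_roots_finite)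
  moreover have "infinite (range (of_nat :: nat \<Rightarrow> complex))" by (rule range_inj_infinite) (simp add: inj_of_nat)
  ultimately have "\<not> range of_nat \<subseteq> {x. poly p x = 0}" using finite_subset by blast
  then obtain q where q: "poly p (of_nat q) \<noteq> 0" by blast
  have "poly p (of_nat q) = (of_nat q + \<zeta>) ^ N - cnj ((of_nat q + \<zeta>) ^ N)" by (simp add: p_def add.commute)
  hence "(of_nat q + \<zeta>) ^ N \<noteq> cnj ((of_nat q + \<zeta>) ^ N)" using q by simp
  hence "Im ((of_nat q + \<zeta>) ^ N) \<noteq> 0" by (metis complex_cnj_cancel_iff complex_eq_iff cnj.sel neg_equal_0_iff_equal)
  thus ?thesis by (rule that)
qed

lemma Im_root_unity_pos: "n \<ge> 3 \<Longrightarrow> Im (root_unity n) > 0"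
  unfolding root_unity_def cis.sel by (rule sin_gt_zero) (auto simp: field_simps)

text \<open>The roots of unity of order \<open>lcm n 2\<close> are cyclotomic integers, since for
  odd \<open>n\<close> they are the \<open>n\<close>-th ones and their negatives. The dihedral
  construction thus applies with the identity map.\<close>

lemma strong_directions_lcm:
  assumes n: "n \<ge> 3" and S: "strong_cyclotomic_delone_set n \<Lambda>"
  shows "\<exists>U. nonparallel_directions \<Lambda> U \<and> card U = lcm n 2 \<and> (\<forall>U'\<subseteq>U. \<not> determined_by \<Lambda> U')"
proof -
  let ?N = "lcm n 2"
  have n0: "n > 0" and N: "?N > 0" using n by (auto simp: lcm_pos_nat)
  obtain q where q: "Im ((of_nat q + root_unity n) ^ ?N) \<noteq> 0"
    using generic_translate[OF N] Im_root_unity_pos[OF n] by (metis less_irrefl)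
  define z where "z = of_nat q + root_unity n"
  have zint: "z \<in> cyclotomic_int n" unfolding z_def
    using cyclotomic_int_of_int[of "int q" n] by (intro cyclotomic_int_add root_unity_in_cyclotomic_int) simp
  have unity: "w \<in> cyclotomic_int n" if w: "w ^ ?N = 1" for w
  proof (cases "even n")
    case True
    hence "?N = n" by (simp add: lcm_proj1_if_dvd_nat)
    thus ?thesis using w unity_in_cyclotomic_int[OF n0] by simp
  next
    case False
    hence "?N = n * 2" by (simp add: lcm_coprime)
    hence "(w ^ n)\<^sup>2 = 1" using w by (simp add: power_mult)
    hence "w ^ n = 1 \<or> (- w) ^ n = 1" using False by (auto simp: power2_eq_1_iff)
    thus ?thesis
    proof
      assume "(- w) ^ n = 1"
      hence "- w \<in> cyclotomic_int n" by (rule unity_in_cyclotomic_int[OF n0])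
      from cyclotomic_int_diff[OF cyclotomic_int_0 this] show ?thesis by simp
    qed (rule unity_in_cyclotomic_int[OF n0])
  qed
  show ?thesis
  proof (rule dihedral_directions[OF S n0 _ _ N])
    show "linear (\<lambda>x::complex. x)" by (rule linear_ident)
    show "inj (\<lambda>x::complex. x)" by simp
    show "Im (z ^ ?N) \<noteq> 0" using q by (simp add: z_def)
    show "w * z \<in> cyclotomic_field n \<and> w * cnj z \<in> cyclotomic_field n" if "w ^ ?N = 1" for w
      using unity[OF that] zint
      by (intro conjI cyclotomic_field_closed(6)[OF n0] cyclotomic_int_mult cyclotomic_int_cnj n0) auto
  qed
qed

text \<open>\<open>\<phi>\<close> sends the basis \<open>1\<close>, \<open>\<omega>\<close> of the
  hexagonal lattice to \<open>v1\<close>, \<open>v2\<close>. Sixth roots of unity preserve this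
  lattice, so the image of the orbit lies in the field even where \<open>\<omega>\<close> does not.
  The three normals are -1, \<open>- \<omega>\<close> and \<open>\<omega> - 1\<close>.\<close>

lemma hexagonal_map:
  assumes n: "n > 0" and v: "v1 \<in> cyclotomic_field n" "v2 \<in> cyclotomic_field n" "Im (cnj v1 * v2) \<noteq> 0"
  obtains \<phi> z where "linear \<phi>" "inj \<phi>" "Im (z ^ 6) \<noteq> 0"
    "\<And>w. w ^ 6 = 1 \<Longrightarrow> \<phi> (w * z) \<in> cyclotomic_field n \<and> \<phi> (w * cnj z) \<in> cyclotomic_field n"
    "\<phi> (axis_normal 6 3) = - v1" "\<phi> (axis_normal 6 5) = - v2" "\<phi> (axis_normal 6 1) = v2 - v1"
proof -
  define \<omega> where "\<omega> = root_unity 6"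
  have \<omega>: "\<omega> = Complex (1/2) (sqrt 3 / 2)"
    by (simp add: \<omega>_def root_unity_def complex_eq_iff cos_60 sin_60)
  have \<omega>2: "\<omega> * \<omega> = \<omega> - 1" by (simp add: \<omega> complex_eq_iff)
  define \<phi> where "\<phi> w = of_real (Re w - Im w / sqrt 3) * v1 + of_real (2 * Im w / sqrt 3) * v2" for w
  have lin: "linear \<phi>"
    by (rule linearI) (simp_all add: \<phi>_def add_divide_distrib diff_divide_distrib algebra_simps scaleR_conv_of_real)
  have inj: "inj \<phi>"
  proof (subst linear_injective_0[OF lin], intro allI impI)
    fix w assume w: "\<phi> w = 0"
    have "cnj v1 * \<phi> w = of_real (Re w - Im w / sqrt 3) * (v1 * cnj v1) + of_real (2 * Im w / sqrt 3) * (cnj v1 * v2)"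
      by (simp only: \<phi>_def) (simp add: algebra_simps)
    also have "v1 * cnj v1 = of_real ((norm v1)\<^sup>2)" by (simp only: complex_norm_square)
    finally have "Im (cnj v1 * \<phi> w) = (2 * Im w / sqrt 3) * Im (cnj v1 * v2)"
      by (simp only: plus_complex.sel of_real_mult[symmetric] Im_complex_of_real Im_of_real_mult add_0)
    hence "Im w = 0" using v(3) w by simp
    moreover from this have "Re w = 0" using w v(3) by (auto simp: \<phi>_def)
    ultimately show "w = 0" by (simp add: complex_eq_iff)
  qed
  have coord: "\<phi> (of_real x + of_real y * \<omega>) = of_real x * v1 + of_real y * v2" for x y
  proof -
    let ?w = "of_real x + of_real y * \<omega>"
    have re: "Re ?w = x + y / 2" and im: "Im ?w = y * (sqrt 3 / 2)" by (simp_all add: \<omega>)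
    have "Re ?w - Im ?w / sqrt 3 = x" "2 * Im ?w / sqrt 3 = y" unfolding re im by simp_all
    thus ?thesis unfolding \<phi>_def by (simp only:)
  qed
  define L where "L = {of_int x + of_int y * \<omega> | x y. True}"
  have LK: "\<phi> x \<in> cyclotomic_field n" if xL: "x \<in> L" for x
  proof -
    obtain a b :: int where "x = of_int a + of_int b * \<omega>" using xL by (auto simp: L_def)
    hence "\<phi> x = of_int a * v1 + of_int b * v2" using coord[of "of_int a" "of_int b"] by simp
    thus ?thesis using v cyclotomic_field_closed[OF n] cyclotomic_int_of_int by auto
  qed
  have L\<omega>: "\<omega> * x \<in> L" if xL: "x \<in> L" for x
  proof -
    obtain a b :: int where "x = of_int a + of_int b * \<omega>" using xL by (auto simp: L_def)
    hence "\<omega> * x = of_int a * \<omega> + of_int b * (\<omega> * \<omega>)" by (simp add: algebra_simps)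
    also have "\<dots> = of_int (- b) + of_int (a + b) * \<omega>" unfolding \<omega>2 by (simp add: algebra_simps)
    finally show ?thesis unfolding L_def by blast
  qed
  have Lw: "w * x \<in> L" if w: "w ^ 6 = 1" and "x \<in> L" for w x
  proof -
    obtain e where e: "w = \<omega> ^ e" using root_unity_powers[of 6 w] w by (auto simp: \<omega>_def)
    show ?thesis unfolding e using that(2) L\<omega> by (induction e) (auto simp: mult.assoc)
  qed
  have "Im \<omega> \<noteq> 0" by (simp add: \<omega>)
  then obtain q where q: "Im ((of_nat q + \<omega>) ^ 6) \<noteq> 0" using generic_translate[of 6 \<omega>] by auto
  define z where "z = of_nat q + \<omega>"
  have "z = of_int (int q) + of_int 1 * \<omega>" by (simp add: z_def)
  hence zL: "z \<in> L" unfolding L_def by blast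
  have "cnj \<omega> = 1 - \<omega>" by (simp add: \<omega> complex_eq_iff)
  hence "cnj z = of_int (int q + 1) + of_int (- 1) * \<omega>" by (simp add: z_def)
  hence zL': "cnj z \<in> L" unfolding L_def by blast
  have a3: "axis_normal 6 3 = of_real (-1) + of_real 0 * \<omega>"
    by (simp add: axis_normal_def complex_eq_iff)
  have a1: "axis_normal 6 1 = of_real (-1) + of_real 1 * \<omega>"
    by (simp add: axis_normal_def \<omega> complex_eq_iff cos_30 sin_30)
  have a5: "axis_normal 6 5 = of_real 0 + of_real (-1) * \<omega>"
  proof -
    have "pi * 5 / 6 = pi - pi / 6" by simp
    hence "cos (pi * 5 / 6) = - cos (pi / 6)" "sin (pi * 5 / 6) = sin (pi / 6)" by (simp_all only: cos_pi_minus sin_pi_minus)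
    thus ?thesis by (simp add: axis_normal_def \<omega> complex_eq_iff cos_30 sin_30)
  qed
  show ?thesis
  proof (rule that[OF lin inj])
    show "Im (z ^ 6) \<noteq> 0" using q by (simp add: z_def)
    show "\<phi> (w * z) \<in> cyclotomic_field n \<and> \<phi> (w * cnj z) \<in> cyclotomic_field n" if "w ^ 6 = 1" for w
      using LK Lw[OF that] zL zL' by blast
    show "\<phi> (axis_normal 6 3) = - v1" "\<phi> (axis_normal 6 5) = - v2" "\<phi> (axis_normal 6 1) = v2 - v1"
      unfolding a1 a3 a5 coord by simp_all
  qed
qed

subsection \<open>The theorem\<close>

lemma determined_by_mono: "determined_by \<Lambda> U \<Longrightarrow> U \<subseteq> U' \<Longrightarrow> determined_by \<Lambda> U'"
  unfolding determined_by_def by blast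

lemma nonparallel_directions_subset:
  "nonparallel_directions \<Lambda> U \<Longrightarrow> U' \<subseteq> U \<Longrightarrow> nonparallel_directions \<Lambda> U'"
  unfolding nonparallel_directions_def by (auto intro: finite_subset pairwise_subset)

lemma direction_nonzero: "u \<in> directions_of \<Lambda> \<Longrightarrow> u \<noteq> 0"
  by (auto simp: directions_of_def)

lemma nonparallel_directions_Im:
  assumes "nonparallel_directions \<Lambda> U" "u \<in> U" "v \<in> U" "u \<noteq> v"
  shows "Im (cnj u * v) \<noteq> 0"
  using assms direction_nonzero by (intro nonparallel_Im) (auto simp: nonparallel_directions_def pairwise_def)

text \<open>The factor \<open>2 * \<i>\<close> produces a difference of conjugate products; an
  imaginary part by itself may fall outside the ring.\<close>

lemma Im_in_cyclotomic_int:
  assumes "n > 0" "v \<in> cyclotomic_int n" "w \<in> cyclotomic_int n"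
  shows "2 * \<i> * of_real (Im (cnj v * w)) \<in> cyclotomic_int n"
proof -
  have "2 * \<i> * of_real (Im (cnj v * w)) = cnj v * w - v * cnj w" by (simp add: complex_eq_iff)
  thus ?thesis using assms by (auto intro!: cyclotomic_int_diff cyclotomic_int_mult cyclotomic_int_cnj)
qed

text \<open>The real factors between directions and their integral representatives cancel in the
  cross ratio relation. Hence the roots of unity \<open>z u\<close> have cross ratios that are
  quotients of cyclotomic integers, and \<open>card_unity_cross_ratios\<close> bounds their
  number.\<close>

theorem strong_determined:
  assumes n: "n > 0" and S: "strong_cyclotomic_delone_set n \<Lambda>"
    and U: "nonparallel_directions \<Lambda> U" and card: "card U \<ge> 7" "card U > lcm n 2"
  shows "determined_by \<Lambda> U"
proof (rule ccontr)
  assume nd: "\<not> determined_by \<Lambda> U"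
  have U': "finite U" "U \<subseteq> directions_of \<Lambda>" "pairwise (\<lambda>u v. \<not> parallel u v) U"
    using U by (auto simp: nonparallel_directions_def)
  have U0: "\<And>u. u \<in> U \<Longrightarrow> u \<noteq> 0" using U'(2) direction_nonzero by blast
  have "card U \<ge> 4" using card by simp
  from undetermined_roots_of_unity[OF strong_uniform_discrete[OF S] U'(1) this U0 U'(3) nd]
  obtain M :: nat and z :: "complex \<Rightarrow> complex" where M: "M > 0" and z: "\<And>u. u \<in> U \<Longrightarrow> z u ^ M = 1" "inj_on z U"
    and rel: "\<And>u1 u2 u3 u4. u1 \<in> U \<Longrightarrow> u2 \<in> U \<Longrightarrow> u3 \<in> U \<Longrightarrow> u4 \<in> U \<Longrightarrow>
      of_real (Im (cnj u1 * u2) * Im (cnj u3 * u4)) * ((z u1 - z u3) * (z u2 - z u4)) =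
      of_real (Im (cnj u1 * u3) * Im (cnj u2 * u4)) * ((z u1 - z u2) * (z u3 - z u4))" by metis
  have "\<exists>v c. v \<in> cyclotomic_int n \<and> c \<noteq> (0::real) \<and> u = of_real c * v" if "u \<in> U" for u
    using strong_direction_int[OF n S] U'(2) that by blast
  then obtain v c where v: "\<And>u. u \<in> U \<Longrightarrow> v u \<in> cyclotomic_int n" "\<And>u. u \<in> U \<Longrightarrow> c u \<noteq> (0::real)"
    "\<And>u. u \<in> U \<Longrightarrow> u = of_real (c u) * v u" by metis
  define D where "D u w = 2 * \<i> * of_real (Im (cnj (v u) * v w))" for u w
  have Dint: "D u w \<in> cyclotomic_int n" if "u \<in> U" "w \<in> U" for u w
    unfolding D_def using v(1) that n by (intro Im_in_cyclotomic_int) auto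
  have ImD: "Im (cnj u * w) = c u * c w * Im (cnj (v u) * v w)" if "u \<in> U" "w \<in> U" for u w
  proof -
    have "cnj u * w = of_real (c u * c w) * (cnj (v u) * v w)"
      by (subst (1) v(3)[OF that(1)], subst (1) v(3)[OF that(2)]) (simp add: mult_ac)
    thus ?thesis by (simp only: Im_of_real_mult)
  qed
  have D0: "D u w \<noteq> 0" if "u \<in> U" "w \<in> U" "u \<noteq> w" for u w
  proof
    assume "D u w = 0"
    hence "Im (cnj (v u) * v w) = 0" unfolding D_def by (simp del: times_complex.sel)
    hence "Im (cnj u * w) = 0" unfolding ImD[OF that(1,2)] by simp
    thus False using nonparallel_directions_Im[OF U that] by simp
  qed
  define T where "T = z ` U"
  have cr: "cross_ratios_in (cyclotomic_int n) T"
    unfolding cross_ratios_in_def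
  proof (intro ballI impI)
    fix x1 x2 x3 x4 assume x: "x1 \<in> T" "x2 \<in> T" "x3 \<in> T" "x4 \<in> T" and d: "distinct [x1, x2, x3, x4]"
    then obtain u1 u2 u3 u4 where u: "x1 = z u1" "x2 = z u2" "x3 = z u3" "x4 = z u4"
      "u1 \<in> U" "u2 \<in> U" "u3 \<in> U" "u4 \<in> U" by (auto simp: T_def)
    have ne: "u1 \<noteq> u3" "u2 \<noteq> u4" using d u by auto
    define k where "k = c u1 * c u2 * c u3 * c u4"
    have k: "k \<noteq> 0" using v(2) u by (simp add: k_def)
    define i12 i34 i13 i24 where "i12 = Im (cnj (v u1) * v u2)" and "i34 = Im (cnj (v u3) * v u4)"
      and "i13 = Im (cnj (v u1) * v u3)" and "i24 = Im (cnj (v u2) * v u4)"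
    have "of_real (k * (i12 * i34)) * ((x1 - x3) * (x2 - x4)) = of_real (k * (i13 * i24)) * ((x1 - x2) * (x3 - x4))"
      using rel[OF u(5-8)] unfolding ImD[OF u(5,6)] ImD[OF u(7,8)] ImD[OF u(5,7)] ImD[OF u(6,8)]
      unfolding u(1-4) i12_def[symmetric] i34_def[symmetric] i13_def[symmetric] i24_def[symmetric] k_def
      by (simp only: ac_simps)
    hence r: "of_real (i12 * i34) * ((x1 - x3) * (x2 - x4)) = of_real (i13 * i24) * ((x1 - x2) * (x3 - x4))"
      using k by (simp only: of_real_mult[of k] mult.assoc mult_cancel_left of_real_eq_0_iff) simp
    have "D u1 u3 * D u2 u4 * ((x1 - x2) * (x3 - x4)) = (2 * \<i>)\<^sup>2 * (of_real (i13 * i24) * ((x1 - x2) * (x3 - x4)))"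
      by (simp only: D_def i13_def i24_def power2_eq_square of_real_mult ac_simps)
    also have "\<dots> = D u1 u2 * D u3 u4 * ((x1 - x3) * (x2 - x4))"
      unfolding r[symmetric] by (simp only: D_def i12_def i34_def power2_eq_square of_real_mult ac_simps)
    finally show "\<exists>a\<in>cyclotomic_int n. \<exists>b\<in>cyclotomic_int n. b \<noteq> 0 \<and> b * ((x1 - x2) * (x3 - x4)) = a * ((x1 - x3) * (x2 - x4))"
      using Dint D0 u ne
      by (intro bexI[of _ "D u1 u2 * D u3 u4"] bexI[of _ "D u1 u3 * D u2 u4"]) (auto intro!: cyclotomic_int_mult)
  qed
  have "card T \<le> lcm n 2"
  \<comment> \<open>The order \<open>M * n\<close> in place of \<open>M\<close> makes it a multiple
    of \<open>n\<close>.\<close>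
  proof (rule card_unity_cross_ratios[OF n, of "M * n"])
    show "x ^ (M * n) = 1" if "x \<in> T" for x using that z(1) by (auto simp: T_def power_mult)
    show "7 \<le> card T" using card z(2) by (simp add: T_def card_image)
  qed (use M n U'(1) cr in \<open>auto simp: T_def\<close>)
  moreover have "card T = card U" using z(2) by (simp add: T_def card_image)
  ultimately show False using card by simp
qed

lemma four_determining_directions:
  assumes n: "n \<ge> 3" and S: "strong_cyclotomic_delone_set n \<Lambda>"
  shows "\<exists>U. nonparallel_directions \<Lambda> U \<and> card U = 4 \<and> determined_by \<Lambda> U"
proof -
  define \<zeta> where "\<zeta> = root_unity n"
  define s where "s = Im \<zeta>"
  have s: "s > 0" unfolding s_def \<zeta>_def by (rule Im_root_unity_pos[OF n])
  have n0: "n > 0" using n by simp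
  \<comment> \<open>With \<open>1 + c * \<zeta>\<close> as last vector the cross ratio is
    \<open>1 - c\<close>; the choice \<open>c = -4\<close> gives the excluded value 5.\<close>
  define v where "v i = (if i = 0 then 1 else if i = 1 then \<zeta> else if i = 2 then 1 + \<zeta> else 1 - 4 * \<zeta>)" for i :: nat
  have vint: "v i \<in> cyclotomic_int n" for i
  proof -
    have "4 * \<zeta> \<in> cyclotomic_int n" using cyclotomic_int_mult[OF cyclotomic_int_of_int[of 4]] root_unity_in_cyclotomic_int
      by (simp add: \<zeta>_def)
    thus ?thesis unfolding v_def using cyclotomic_int_1 root_unity_in_cyclotomic_int[of n]
      by (auto simp: \<zeta>_def[symmetric] intro!: cyclotomic_int_add cyclotomic_int_diff)
  qed
  have Dv: "Im (cnj (v 0) * v 1) = s" "Im (cnj (v 0) * v 2) = s" "Im (cnj (v 0) * v 3) = - 4 * s"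
    "Im (cnj (v 1) * v 2) = - s" "Im (cnj (v 1) * v 3) = - s" "Im (cnj (v 2) * v 3) = - 5 * s"
    by (simp_all add: v_def s_def algebra_simps)
  have v0: "v i \<noteq> 0" for i
    using s by (auto simp: v_def s_def complex_eq_iff)
  define g where "g i = 1 / norm (v i)" for i
  have g: "g i > 0" for i using v0[of i] by (simp add: g_def)
  define u where "u i = sgn (v i)" for i
  have ug: "u i = of_real (g i) * v i" for i by (simp only: u_def g_def sgn_eq_of_real)
  have Du: "Im (cnj (u i) * u j) = g i * g j * Im (cnj (v i) * v j)" for i j
  proof -
    have "cnj (u i) * u j = of_real (g i * g j) * (cnj (v i) * v j)" unfolding ug by (simp add: mult_ac)
    thus ?thesis by (simp only: Im_of_real_mult)
  qed
  have sym: "Im (cnj x * y) = - Im (cnj y * x)" for x y by simp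
  have lt: "Im (cnj (v i) * v j) \<noteq> 0" if "i < j" "j < 4" for i j
  proof -
    have "(i = 0 \<and> (j = 1 \<or> j = 2 \<or> j = 3)) \<or> (i = 1 \<and> (j = 2 \<or> j = 3)) \<or> (i = 2 \<and> j = 3)" using that by linarith
    thus ?thesis using Dv s by (elim disjE conjE) (simp_all del: times_complex.sel)
  qed
  have ne: "Im (cnj (u i) * u j) \<noteq> 0" if "i < 4" "j < 4" "i \<noteq> j" for i j
  proof (cases "i < j")
    case True
    thus ?thesis using lt[of i j] that g[of i] g[of j] unfolding Du by (simp del: times_complex.sel)
  next
    case False
    hence "Im (cnj (v j) * v i) \<noteq> 0" using lt[of j i] that by simp
    hence "Im (cnj (v i) * v j) \<noteq> 0" using sym[of "v i" "v j"] by linarith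
    thus ?thesis using g[of i] g[of j] unfolding Du by (simp del: times_complex.sel)
  qed
  have nonpar: "\<not> parallel (u i) (u j)" if "i < 4" "j < 4" "i \<noteq> j" for i j
    using ne[OF that] parallel_Im by blast
  have inj: "inj_on u {..<4}"
    by (rule inj_onI) (metis lessThan_iff ne parallel_Im complex_cnj_mult complex_mult_cnj mult.commute Im_complex_of_real)
  define U where "U = u ` {..<4}"
  have dir: "u i \<in> directions_of \<Lambda>" for i
    unfolding u_def using vint v0 by (intro strong_direction_sgn[OF S n0] cyclotomic_field_closed(6)[OF n0]) auto
  have nU: "nonparallel_directions \<Lambda> U"
    unfolding nonparallel_directions_def U_def using dir nonpar by (auto simp: pairwise_def)
  have cU: "card U = 4" unfolding U_def by (simp add: card_image[OF inj])
  have "determined_by \<Lambda> U"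
  proof (rule ccontr)
    assume nd: "\<not> determined_by \<Lambda> U"
    have U': "finite U" "pairwise (\<lambda>u v. \<not> parallel u v) U" "\<And>u. u \<in> U \<Longrightarrow> u \<noteq> 0"
      using nU direction_nonzero unfolding nonparallel_directions_def by auto
    have "card U \<ge> 4" using cU by simp
    from undetermined_roots_of_unity[OF strong_uniform_discrete[OF S] U'(1) this U'(3) U'(2) nd]
    obtain M :: nat and z :: "complex \<Rightarrow> complex" where M: "M > 0" and z: "\<And>u. u \<in> U \<Longrightarrow> z u ^ M = 1" "inj_on z U"
      and rel: "\<And>u1 u2 u3 u4. u1 \<in> U \<Longrightarrow> u2 \<in> U \<Longrightarrow> u3 \<in> U \<Longrightarrow> u4 \<in> U \<Longrightarrow>
        of_real (Im (cnj u1 * u2) * Im (cnj u3 * u4)) * ((z u1 - z u3) * (z u2 - z u4)) =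
        of_real (Im (cnj u1 * u3) * Im (cnj u2 * u4)) * ((z u1 - z u2) * (z u3 - z u4))" by metis
    have uU: "u 0 \<in> U" "u 1 \<in> U" "u 2 \<in> U" "u 3 \<in> U" by (auto simp: U_def)
    define k where "k = g 0 * g 1 * g 2 * g 3 * s * s"
    have k: "k \<noteq> 0" using g[of 0] g[of 1] g[of 2] g[of 3] s by (simp add: k_def)
    have "Im (cnj (u 0) * u 1) * Im (cnj (u 2) * u 3) = - 5 * k" "Im (cnj (u 0) * u 2) * Im (cnj (u 1) * u 3) = - k"
      unfolding Du Dv by (simp_all add: k_def)
    from rel[OF uU, unfolded this]
    have "of_real (- k) * (5 * ((z (u 0) - z (u 2)) * (z (u 1) - z (u 3)))) = of_real (- k) * ((z (u 0) - z (u 1)) * (z (u 2) - z (u 3)))"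
      by (simp add: mult_ac)
    hence "(z (u 0) - z (u 1)) * (z (u 2) - z (u 3)) = 5 * ((z (u 0) - z (u 2)) * (z (u 1) - z (u 3)))"
      using k by (metis mult_left_cancel neg_equal_0_iff_equal of_real_eq_0_iff)
    moreover have "z (u 0) \<noteq> z (u 1)" "z (u 2) \<noteq> z (u 3)"
      using z(2) uU inj by (auto simp: inj_on_eq_iff[OF z(2)] inj_on_eq_iff[OF inj])
    ultimately show False using unity_cross_ratio_not_5[OF M z(1)[OF uU(1)] z(1)[OF uU(2)] z(1)[OF uU(3)] z(1)[OF uU(4)]] by blast
  qed
  thus ?thesis using nU cU by blast
qed

text \<open>Supplies the extremal set for \<open>n = 4\<close>, the one case with
  \<open>lcm n 2 < 6\<close>. The plane basis in the field is \<open>1\<close>,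
  \<open>root_unity n\<close>.\<close>

lemma hexagonal_directions:
  assumes n: "n \<ge> 3" and S: "strong_cyclotomic_delone_set n \<Lambda>"
  shows "\<exists>U. nonparallel_directions \<Lambda> U \<and> card U = 6 \<and> (\<forall>U'\<subseteq>U. \<not> determined_by \<Lambda> U')"
proof -
  have n0: "n > 0" using n by simp
  have 1: "1 \<in> cyclotomic_field n" by (rule cyclotomic_field_closed(6)[OF n0 cyclotomic_int_1])
  have 2: "root_unity n \<in> cyclotomic_field n" by (rule cyclotomic_field_closed(6)[OF n0 root_unity_in_cyclotomic_int])
  have 3: "Im (cnj 1 * root_unity n) \<noteq> 0" using Im_root_unity_pos[OF n] by simp
  obtain \<phi> z where \<phi>: "linear \<phi>" "inj \<phi>" "Im (z ^ 6) \<noteq> 0"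
    "\<And>w. w ^ 6 = 1 \<Longrightarrow> \<phi> (w * z) \<in> cyclotomic_field n \<and> \<phi> (w * cnj z) \<in> cyclotomic_field n"
    using hexagonal_map[OF n0 1 2 3] by metis
  show ?thesis by (rule dihedral_directions[OF S n0 \<phi>(1,2) _ \<phi>(3,4)]) auto
qed

text \<open>Three directions can be rescaled inside the field to \<open>w1\<close>,
  \<open>w2\<close> and \<open>w2 - w1\<close>, which \<open>hexagonal_map\<close> realises, up to
  sign, as images of three axis normals.\<close>

lemma three_directions_undetermined:
  assumes n: "n > 0" and S: "strong_cyclotomic_delone_set n \<Lambda>"
    and U: "nonparallel_directions \<Lambda> U" "card U = 3"
  shows "\<not> determined_by \<Lambda> U"
proof -
  obtain u1 u2 u3 where u: "U = {u1, u2, u3}" "u1 \<noteq> u2" "u1 \<noteq> u3" "u2 \<noteq> u3"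
    using U(2) by (auto simp: card_3_iff)
  have "\<exists>v c. v \<in> cyclotomic_int n \<and> c \<noteq> (0::real) \<and> u = of_real c * v" if "u \<in> U" for u
    using strong_direction_int[OF n S] U(1) that unfolding nonparallel_directions_def by blast
  then obtain v c where v: "\<And>u. u \<in> U \<Longrightarrow> v u \<in> cyclotomic_int n" "\<And>u. u \<in> U \<Longrightarrow> c u \<noteq> (0::real)"
    "\<And>u. u \<in> U \<Longrightarrow> u = of_real (c u) * v u" by metis
  have uU: "u1 \<in> U" "u2 \<in> U" "u3 \<in> U" using u by auto
  define D where "D u w = Im (cnj (v u) * v w)" for u w
  have D0: "D u w \<noteq> 0" if "u \<in> U" "w \<in> U" "u \<noteq> w" for u w
  proof
    assume "D u w = 0"
    hence 0: "Im (cnj (v u) * v w) = 0" by (simp add: D_def)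
    have "cnj u * w = of_real (c u * c w) * (cnj (v u) * v w)"
      by (subst (1) v(3)[OF that(1)], subst (1) v(3)[OF that(2)]) (simp add: mult_ac)
    hence "Im (cnj u * w) = 0" by (simp only: Im_of_real_mult 0 mult_zero_right)
    thus False using nonparallel_directions_Im[OF U(1) that] by simp
  qed
  \<comment> \<open>Cramer's rule for \<open>v u3\<close> in the basis \<open>v u1\<close>,
    \<open>v u2\<close>. The coefficients lie in the field because the factor
    \<open>2 * \<i>\<close> cancels in the quotients.\<close>
  define a where "a = D u3 u2 / D u1 u2"
  define b where "b = D u1 u3 / D u1 u2"
  have a0: "a \<noteq> 0" and b0: "b \<noteq> 0" using D0 uU u by (auto simp: a_def b_def)
  have D12: "D u1 u2 \<noteq> 0" using D0 uU u by auto
  have v3: "v u3 = of_real a * v u1 + of_real b * v u2"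
  proof -
    have "of_real (D u1 u2) * v u3 = of_real (D u3 u2) * v u1 + of_real (D u1 u3) * v u2"
      by (simp add: D_def complex_eq_iff algebra_simps)
    thus ?thesis using D12 by (simp add: a_def b_def add_divide_eq_iff field_simps)
  qed
  have real_K: "of_real (D x y / D x' y') \<in> cyclotomic_field n" if "x \<in> U" "y \<in> U" "x' \<in> U" "y' \<in> U" for x y x' y'
  proof -
    have "of_real (D x y / D x' y') = (2 * \<i> * of_real (D x y)) / (2 * \<i> * of_real (D x' y'))" by simp
    moreover have "2 * \<i> * of_real (D x y) \<in> cyclotomic_field n" "2 * \<i> * of_real (D x' y') \<in> cyclotomic_field n"
      unfolding D_def using v(1) that by (auto intro!: cyclotomic_field_closed(6) Im_in_cyclotomic_int n simp del: times_complex.sel)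
    ultimately show ?thesis using cyclotomic_field_closed(4)[OF n] by metis
  qed
  define w1 where "w1 = of_real (- a) * v u1"
  define w2 where "w2 = of_real b * v u2"
  have vK: "v u \<in> cyclotomic_field n" if "u \<in> U" for u using v(1)[OF that] by (rule cyclotomic_field_closed(6)[OF n])
  have "of_real a * v u1 \<in> cyclotomic_field n"
    unfolding a_def using real_K vK uU by (intro cyclotomic_field_closed(3)[OF n]) auto
  hence K1: "w1 \<in> cyclotomic_field n"
    using cyclotomic_field_closed(2,6)[OF n] cyclotomic_int_0[of n] unfolding w1_def
    by (metis diff_0 mult_minus_left of_real_minus)
  have K2: "w2 \<in> cyclotomic_field n"
    unfolding w2_def b_def using real_K vK uU by (intro cyclotomic_field_closed(3)[OF n]) auto
  have w3: "w2 - w1 = v u3" by (simp add: w1_def w2_def v3)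
  have "cnj w1 * w2 = of_real (- a * b) * (cnj (v u1) * v u2)" by (simp add: w1_def w2_def mult_ac)
  hence "Im (cnj w1 * w2) = - a * b * D u1 u2" by (simp only: Im_of_real_mult D_def)
  hence ne: "Im (cnj w1 * w2) \<noteq> 0" using a0 b0 D12 by simp
  obtain \<phi> z where \<phi>: "linear \<phi>" "inj \<phi>" "Im (z ^ 6) \<noteq> 0"
    "\<And>w. w ^ 6 = 1 \<Longrightarrow> \<phi> (w * z) \<in> cyclotomic_field n \<and> \<phi> (w * cnj z) \<in> cyclotomic_field n"
    "\<phi> (axis_normal 6 3) = - w1" "\<phi> (axis_normal 6 5) = - w2" "\<phi> (axis_normal 6 1) = w2 - w1"
    by (rule hexagonal_map[OF n K1 K2 ne]) blast
  show ?thesis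
  proof (rule dihedral_undetermined[OF S \<phi>(1,2) _ \<phi>(3,4)])
    fix u assume uin: "u \<in> U"
    have "\<exists>k. \<exists>r::real. u = of_real r * \<phi> (axis_normal 6 k)"
    proof -
      consider "u = u1" | "u = u2" | "u = u3" using uin u by auto
      thus ?thesis
      proof cases
        case 1
        have "u = of_real (c u1 / a) * \<phi> (axis_normal 6 3)"
          unfolding \<phi>(5) w1_def using v(3)[OF uU(1)] a0 1 by simp
        thus ?thesis by blast
      next
        case 2
        have "u = of_real (- c u2 / b) * \<phi> (axis_normal 6 5)"
          unfolding \<phi>(6) w2_def using v(3)[OF uU(2)] b0 2 by simp
        thus ?thesis by blast
      next
        case 3
        have "u = of_real (c u3) * \<phi> (axis_normal 6 1)"
          unfolding \<phi>(7) w3 using v(3)[OF uU(3)] 3 by simp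
        thus ?thesis by blast
      qed
    qed
    moreover have "u \<noteq> 0" using U(1) uin direction_nonzero unfolding nonparallel_directions_def by blast
    ultimately show "u \<noteq> 0 \<and> (\<exists>k. \<exists>r::real. u = of_real r * \<phi> (axis_normal 6 k))" by blast
  qed simp
qed

text \<open>The vectors \<open>q + root_unity n\<close> share one nonzero imaginary part, so they
  are pairwise nonparallel, and finitely many directions cannot block them all.\<close>

lemma extend_directions:
  assumes n: "n \<ge> 3" and S: "strong_cyclotomic_delone_set n \<Lambda>" and U: "nonparallel_directions \<Lambda> U"
  shows "\<exists>u. u \<notin> U \<and> nonparallel_directions \<Lambda> (insert u U)"
proof -
  have n0: "n > 0" using n by simp
  define w where "w q = of_nat q + root_unity n" for q :: nat
  have im: "Im (w q) > 0" for q using Im_root_unity_pos[OF n] by (simp add: w_def)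
  have w0: "w q \<noteq> 0" for q using im[of q] by auto
  have wint: "w q \<in> cyclotomic_int n" for q
    unfolding w_def using cyclotomic_int_of_int[of "int q" n] by (intro cyclotomic_int_add root_unity_in_cyclotomic_int) simp
  have dir: "sgn (w q) \<in> directions_of \<Lambda>" for q
    using wint w0 by (intro strong_direction_sgn[OF S n0] cyclotomic_field_closed(6)[OF n0]) auto
  have one: "q = q'" if par: "parallel (sgn (w q)) u" "parallel (sgn (w q')) u" for q q' u
  proof -
    obtain c d :: real where cd: "c \<noteq> 0" "d \<noteq> 0" "sgn (w q) = of_real c * u" "sgn (w q') = of_real d * u"
      using par by (auto simp: parallel_def)
    have "of_real (d * (1 / norm (w q))) * w q = of_real (c * (1 / norm (w q'))) * w q'"
      using cd by (simp only: of_real_mult mult.assoc sgn_eq_of_real[symmetric]) simp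
    moreover define s t where "s = d * (1 / norm (w q))" and "t = c * (1 / norm (w q'))"
    ultimately have eq: "of_real s * w q = of_real t * w q'" by simp
    have "s * Im (w q) = t * Im (w q')" "s * Re (w q) = t * Re (w q')"
      using arg_cong[OF eq, of Im] arg_cong[OF eq, of Re] by simp_all
    moreover have "Im (w q) = Im (w q')" by (simp add: w_def)
    ultimately have "s = t" "s * Re (w q) = t * Re (w q')" using im[of q'] by auto
    moreover have "s \<noteq> 0" using cd w0 by (simp add: s_def)
    ultimately have "Re (w q) = Re (w q')" by simp
    thus ?thesis by (simp add: w_def)
  qed
  have "\<exists>q. \<forall>u\<in>U. \<not> parallel (sgn (w q)) u"
  proof (rule ccontr)
    assume "\<not> (\<exists>q. \<forall>u\<in>U. \<not> parallel (sgn (w q)) u)"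
    then obtain f where f: "\<And>q. f q \<in> U" "\<And>q. parallel (sgn (w q)) (f q)" by metis
    have "inj f" using one f(2) by (metis injI)
    hence "infinite (range f)" by (rule range_inj_infinite)
    moreover have "range f \<subseteq> U" using f(1) by auto
    ultimately show False using U finite_subset unfolding nonparallel_directions_def by blast
  qed
  then obtain q where q: "\<And>u. u \<in> U \<Longrightarrow> \<not> parallel (sgn (w q)) u" by blast
  have "parallel x x" for x by (auto simp: parallel_def intro!: exI[of _ 1])
  hence "sgn (w q) \<notin> U" using q by blast
  moreover have "nonparallel_directions \<Lambda> (insert (sgn (w q)) U)"
    using U dir q parallel_sym unfolding nonparallel_directions_def by (auto simp: pairwise_insert)
  ultimately show ?thesis by blast
qed

text \<open>A subset of an undetermining set of directions is undetermining too, so directions are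
  added until there are three.\<close>

lemma few_directions_undetermined:
  assumes n: "n \<ge> 3" and S: "strong_cyclotomic_delone_set n \<Lambda>"
    and U: "nonparallel_directions \<Lambda> U" "card U < 4"
  shows "\<not> determined_by \<Lambda> U"
  using U
proof (induction "3 - card U" arbitrary: U)
  case 0
  hence "card U = 3" by simp
  thus ?case using three_directions_undetermined[OF _ S 0(2)] n by simp
next
  case (Suc k)
  obtain u where u: "u \<notin> U" "nonparallel_directions \<Lambda> (insert u U)" using extend_directions[OF n S Suc(3)] by blast
  have "finite U" using Suc(3) by (simp add: nonparallel_directions_def)
  hence "card (insert u U) = Suc (card U)" using u by simp
  hence "\<not> determined_by \<Lambda> (insert u U)" using Suc u by (intro Suc(1)) auto
  thus ?case using determined_by_mono by blast
qed

lemma least_determining_numberI: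
  assumes "determined_by_any \<Lambda> (Suc N)" "nonparallel_directions \<Lambda> U" "card U = N" "\<forall>U'\<subseteq>U. \<not> determined_by \<Lambda> U'"
  shows "least_determining_number \<Lambda> (Suc N)"
  unfolding least_determining_number_def
proof (intro conjI allI impI assms(1))
  fix k assume k: "determined_by_any \<Lambda> k"
  show "Suc N \<le> k"
  proof (rule ccontr)
    assume "\<not> Suc N \<le> k"
    hence "k \<le> card U" using assms(3) by simp
    then obtain U' where "U' \<subseteq> U" "card U' = k" by (metis obtain_subset_with_card_n)
    thus False using k assms(2,4) nonparallel_directions_subset unfolding determined_by_any_def by blast
  qed
qed

theorem theorem3:
  fixes n :: nat
  assumes "n \<ge> 3"
  shows
    "(\<forall>\<Lambda>. strong_cyclotomic_delone_set n \<Lambda> \<longrightarrow>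
        (\<exists>U. nonparallel_directions \<Lambda> U \<and> card U = 4 \<and> determined_by \<Lambda> U) \<and>
        (\<forall>U. nonparallel_directions \<Lambda> U \<and> card U < 4 \<longrightarrow> \<not> determined_by \<Lambda> U)) \<and>
     (\<exists>m. \<forall>\<Lambda>. strong_cyclotomic_delone_set n \<Lambda> \<longrightarrow> determined_by_any \<Lambda> m) \<and>
     (n = 4 \<longrightarrow>
        (\<forall>\<Lambda>. strong_cyclotomic_delone_set n \<Lambda> \<longrightarrow> least_determining_number \<Lambda> 7)) \<and>
     (n \<noteq> 4 \<and> (n \<le> 50 \<or> n = 61) \<longrightarrow>
        (\<forall>\<Lambda>. strong_cyclotomic_delone_set n \<Lambda> \<longrightarrow>
           least_determining_number \<Lambda> (lcm n 2 + 1)))"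
proof -
  have n0: "n > 0" using assms by simp
  have upper: "determined_by_any \<Lambda> m" if "strong_cyclotomic_delone_set n \<Lambda>" "m \<ge> 7" "m > lcm n 2" for \<Lambda> m
    unfolding determined_by_any_def using strong_determined[OF n0 that(1)] that(2,3) by blast
  have four: "least_determining_number \<Lambda> 7" if S: "strong_cyclotomic_delone_set n \<Lambda>" and n4: "n = 4" for \<Lambda>
  proof -
    have "lcm n 2 = 4" unfolding n4 by (simp add: lcm_proj1_if_dvd_nat)
    hence "determined_by_any \<Lambda> 7" using upper[OF S, of 7] by simp
    thus ?thesis using hexagonal_directions[OF assms S] least_determining_numberI[of \<Lambda> 6] by auto
  qed
  have other: "least_determining_number \<Lambda> (lcm n 2 + 1)" if S: "strong_cyclotomic_delone_set n \<Lambda>" and n4: "n \<noteq> 4" for \<Lambda>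
  proof -
    \<comment> \<open>Ensures that \<open>lcm n 2 + 1\<close> reaches the threshold 7 of
      \<open>upper\<close> as well, so that the dihedral set of \<open>lcm n 2\<close> directions is
      extremal.\<close>
    have "lcm n 2 \<ge> 6"
    proof (cases "even n")
      case True
      hence "lcm n 2 = n" by (simp add: lcm_proj1_if_dvd_nat)
      moreover have "n \<noteq> 3" "n \<noteq> 5" using True by auto
      ultimately show ?thesis using assms n4 by linarith
    next
      case False
      hence "lcm n 2 = n * 2" by (simp add: lcm_coprime)
      thus ?thesis using assms by simp
    qed
    hence "determined_by_any \<Lambda> (Suc (lcm n 2))" using upper[OF S, of "Suc (lcm n 2)"] by simp
    thus ?thesis using strong_directions_lcm[OF assms S] least_determining_numberI[of \<Lambda> "lcm n 2"] by auto
  qed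
  have "determined_by_any \<Lambda> (lcm n 2 + 7)" if "strong_cyclotomic_delone_set n \<Lambda>" for \<Lambda>
    using upper[OF that, of "lcm n 2 + 7"] by simp
  thus ?thesis
    using four_determining_directions[OF assms] few_directions_undetermined[OF assms] four other by blast
qed

end
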